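(* Let $p\ge2$ be an integer. For an integer $k\ge 0$ and $\varepsilon>0$ let $B_{N,k}(\varepsilon)=\{\mathrm{Crt}_{N,k}((-E_\infty(p)+\varepsilon,\infty))>0\}$ be the event that there is a critical point of index $k$ of the Hamiltonian $H_{N,p}$ with critical value above the level $-N(E_\infty(p)-\varepsilon)$. Then for all $k\ge 0$ and $\varepsilon>0$, $$\limsup_{N\to\infty}\frac{1}{N^2}\log\mathbb P(B_{N,k}(\varepsilon))<0.$$
   Context: Let $S^{N-1}(\sqrt N)\subset\mathbb R^N$ be the Euclidean sphere of radius $\sqrt N$ centered at $0$. The Hamiltonian of the $p$-spin spherical spin glass is the random function on $S^{N-1}(\sqrt N)$ $$H_{N,p}(\boldsymbol\sigma)=\frac{1}{N^{(p-1)/2}}\sum_{i_1,\dots,i_p=1}^N J_{i_1,\dots,i_p}\,\sigma_{i_1}\cdots\sigma_{i_p},$$ where the $J_{i_1,\dots,i_p}$ are independent standard Gaussian random variables. For a Borel set $B\subset\mathbb R$ and $0\le k<N$, $\mathrm{Crt}_{N,k}(B)$ is the (random) number of points $\boldsymbol\sigma\in S^{N-1}(\sqrt N)$ with $\nabla H_{N,p}(\boldsymbol\sigma)=0$, $H_{N,p}(\boldsymbol\sigma)\in NB=\{Nx:x\in B\}$, and such that the Hessian $\nabla^2H_{N,p}(\boldsymbol\sigma)$ has exactly $k$ negative eigenvalues (gradient and covariant Hessian on the sphere; $k$ is the index). The threshold is $E_\infty(p)=2\sqrt{\frac{p-1}{p}}$. Convention: $\log 0=-\infty$. *)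

theory Defs
  imports "HOL-Probability.Probability" "Jordan_Normal_Form.Char_Poly"
begin

text \<open>
  The dimension \<open>N\<close> varies inside the final statement, so points of \<open>\<real>\<^sup>N\<close> are vectors
  with carrier \<^term>\<open>carrier_vec N\<close>, and all derivatives are taken along straight lines.
\<close>

definition vec_sphere :: "nat \<Rightarrow> real \<Rightarrow> real vec set" where
  "vec_sphere N r = {x \<in> carrier_vec N. sqrt (scalar_prod x x) = r}"

definition dir_deriv :: "(real vec \<Rightarrow> real) \<Rightarrow> real vec \<Rightarrow> real vec \<Rightarrow> real" where
  "dir_deriv f x u = deriv (\<lambda>t. f (x + t \<cdot>\<^sub>v u)) 0"

definition eucl_grad :: "(real vec \<Rightarrow> real) \<Rightarrow> real vec \<Rightarrow> real vec" where
  "eucl_grad f x = vec (dim_vec x) (\<lambda>i. dir_deriv f x (unit_vec (dim_vec x) i))"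

text \<open>Orthogonal projection onto the tangent space at \<open>x\<close> of the centred sphere through \<open>x\<close>.\<close>

definition tangent_proj :: "real vec \<Rightarrow> real vec \<Rightarrow> real vec" where
  "tangent_proj x w = w - (scalar_prod w x / scalar_prod x x) \<cdot>\<^sub>v x"

text \<open>
  For \<open>f\<close> smooth near the sphere, \<open>sphere_grad f\<close> is the Riemannian gradient of the
  restriction of \<open>f\<close> to each centred sphere.  The Levi-Civita derivative of a tangent field
  \<open>G\<close> is the tangential part of its Euclidean derivative, and the covariant Hessian is
  \<open>\<nabla>\<^sup>2f(u, v) = \<langle>\<nabla>\<^sub>u grad f, v\<rangle>\<close>.  For \<open>x\<close> on the sphere and \<open>u\<close>, \<open>v\<close> tangent at \<open>x\<close>, this
  depends on the values of \<open>f\<close> on the sphere only.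
\<close>

definition sphere_grad :: "(real vec \<Rightarrow> real) \<Rightarrow> real vec \<Rightarrow> real vec" where
  "sphere_grad f x = tangent_proj x (eucl_grad f x)"

definition cov_deriv :: "(real vec \<Rightarrow> real vec) \<Rightarrow> real vec \<Rightarrow> real vec \<Rightarrow> real vec" where
  "cov_deriv G x u =
     tangent_proj x (vec (dim_vec x) (\<lambda>i. dir_deriv (\<lambda>y. vec_index (G y) i) x u))"

definition sphere_hess :: "(real vec \<Rightarrow> real) \<Rightarrow> real vec \<Rightarrow> real vec \<Rightarrow> real vec \<Rightarrow> real" where
  "sphere_hess f x u v = scalar_prod (cov_deriv (sphere_grad f) x u) v"

definition tangent_frame :: "real vec \<Rightarrow> (nat \<Rightarrow> real vec) \<Rightarrow> bool" where
  "tangent_frame x e \<longleftrightarrow>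
     (\<forall>a < dim_vec x - 1. e a \<in> carrier_vec (dim_vec x) \<and> scalar_prod (e a) x = 0) \<and>
     (\<forall>a < dim_vec x - 1. \<forall>b < dim_vec x - 1.
        scalar_prod (e a) (e b) = (if a = b then 1 else 0))"

definition hess_matrix ::
    "(real vec \<Rightarrow> real) \<Rightarrow> real vec \<Rightarrow> (nat \<Rightarrow> real vec) \<Rightarrow> real mat" where
  "hess_matrix f x e =
     mat (dim_vec x - 1) (dim_vec x - 1) (\<lambda>(a, b). sphere_hess f x (e a) (e b))"

text \<open>Eigenvalues are counted with multiplicity.\<close>

definition num_neg_eigenvalues :: "real mat \<Rightarrow> nat" where
  "num_neg_eigenvalues A =
     (\<Sum>l\<in>{l. eigenvalue A l \<and> l < 0}. Polynomial.order l (char_poly A))"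

text \<open>
  Changing the orthonormal frame conjugates the Hessian matrix by an orthogonal matrix, so the
  choice of frame is immaterial.
\<close>

definition has_index :: "(real vec \<Rightarrow> real) \<Rightarrow> real vec \<Rightarrow> nat \<Rightarrow> bool" where
  "has_index f x k \<longleftrightarrow>
     (\<exists>e. tangent_frame x e \<and> num_neg_eigenvalues (hess_matrix f x e) = k)"

text \<open>
  A multi-index \<open>(i\<^sub>1, \<dots>, i\<^sub>p)\<close> is an extensional function on \<open>{..<p}\<close>; coordinates
  are numbered from \<open>0\<close>.  The argument \<open>j\<close> is a realisation of the couplings.
\<close>

definition hamiltonian :: "nat \<Rightarrow> ((nat \<Rightarrow> nat) \<Rightarrow> real) \<Rightarrow> nat \<Rightarrow> real vec \<Rightarrow> real" where
  "hamiltonian p j N x =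
     1 / real N powr ((real p - 1) / 2) *
     (\<Sum>i \<in> {..<p} \<rightarrow>\<^sub>E {..<N}. j i * (\<Prod>l<p. vec_index x (i l)))"

text \<open>The number of critical points, as the counting measure of the set of critical points.\<close>

definition Crt ::
    "nat \<Rightarrow> ((nat \<Rightarrow> nat) \<Rightarrow> real) \<Rightarrow> nat \<Rightarrow> nat \<Rightarrow> real set \<Rightarrow> ennreal" where
  "Crt p j N k B = emeasure (count_space UNIV)
     {x \<in> vec_sphere N (sqrt (real N)).
        sphere_grad (hamiltonian p j N) x = 0\<^sub>v N \<and>
        hamiltonian p j N x \<in> (\<lambda>b. real N * b) ` B \<and>
        has_index (hamiltonian p j N) x k}"

definition E_infty :: "nat \<Rightarrow> real" where
  "E_infty p = 2 * sqrt ((real p - 1) / real p)"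

text \<open>Logarithm with the convention \<open>log 0 = -\<infinity>\<close>.\<close>

definition ereal_log :: "real \<Rightarrow> ereal" where
  "ereal_log t = (if t = 0 then - \<infinity> else ereal (ln t))"

end

theory Submission
  imports Defs
begin

text \<open>
  At every point of the sphere the covariant Hessian is \<open>B - (p H / N) I\<close> on the tangent space, where
  \<open>B = P (D\<^sup>2 H) P\<close> and \<open>P\<close> projects onto the tangent space.  An index \<open>k\<close> and a value above
  \<open>- N (E\<^sub>\<infinity> - \<epsilon>)\<close> therefore leave at most \<open>k\<close> eigenvalues of \<open>B\<close> below a level strictly above the
  spectral edge \<open>- p E\<^sub>\<infinity>\<close>, so that one of \<open>k + 1\<close> disjoint windows \<open>(- b - \<kappa>, - b + \<kappa>)\<close> with
  \<open>b < p E\<^sub>\<infinity>\<close> contains no eigenvalue.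

  For a fixed point, \<open>B\<close> is a multiple of a GOE matrix on the tangent space.  With \<open>X = B + b I\<close>,
  \<open>G = X\<^sup>-\<^sup>1\<close>, \<open>q = (tr G\<^sup>2\<^sup>l)\<^sup>1\<^sup>/\<^sup>2\<^sup>l\<close> with \<open>l\<close> at least of order \<open>log N\<close> (so that \<open>q\<close> is comparable to the norm of
  \<open>G\<close>), and \<open>\<phi> = exp (- s q)\<close>, integration by parts of the field \<open>\<phi> G\<close> gives
  \<open>E [\<phi> (N - 1 - b t + v t\<^sup>2)] \<le> 2 v s E [\<phi> q\<^sup>3]\<close>, where \<open>t = tr (P G)\<close> and \<open>v = p (p - 1) / N\<close>.
  The quadratic on the left is at least a multiple of \<open>N\<close> because \<open>b\<close> lies inside the semicircle,
  and for \<open>s\<close> a small multiple of \<open>N\<^sup>2\<close> the right-hand side is absorbed except where \<open>q\<close> is large.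
  Hence \<open>E \<phi>\<close> is far below the values of \<open>\<phi>\<close> on the event that the window is empty, and this event
  has probability at most \<open>exp (- c N\<^sup>2)\<close>.  A net of the sphere has only \<open>exp (O (N log N))\<close>
  points, so a union bound concludes.
\<close>

section \<open>Matrices as functions of two indices\<close>

text \<open>Speed \<open>N^2\<close> is forced by the continuum of points: an estimate exponential
  in \<open>N\<close> alone would be lost to the net. A gap is that unlikely for the following
  reason. If \<open>B\<close> has no eigenvalue near \<open>- b\<close>, then
  \<open>t = tr (P G)\<close> is a regular real statistic, and integration by parts (the loop
  equation of the semicircle law) pushes it towards a root of \<open>v t^2 - b t + N - 1\<close>,
  which has no real root in the bulk. So neither the joint density of eigenvalues nor a large
  deviation principle for the spectral measure is required. The obstacle is that \<open>G\<close>
  blows up at singular matrices. The factor \<open>exp (- s q)\<close> makes the field bounded and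
  differentiable everywhere, at the price of the cubic term in \<open>q\<close>. Since
  \<open>v\<close> has order \<open>1 / N\<close> and the quadratic has order \<open>N\<close>, this
  term leaves room for \<open>s\<close> of order \<open>N^2\<close>, and \<open>s\<close> sets the
  rate. A Schatten norm stands in for the operator norm because its derivative is again a trace,
  which the covariance can contract. Spectral facts are obtained from quadratic forms and kernels
  instead of diagonalisation.\<close>

type_synonym rmat = "nat \<Rightarrow> nat \<Rightarrow> real"

definition mmul :: "nat \<Rightarrow> rmat \<Rightarrow> rmat \<Rightarrow> nat \<Rightarrow> nat \<Rightarrow> real" where
  "mmul N A B = (\<lambda>a b. \<Sum>c<N. A a c * B c b)"

definition idm :: "nat \<Rightarrow> nat \<Rightarrow> nat \<Rightarrow> real" where
  "idm N = (\<lambda>a b. if a = b \<and> a < N then 1 else 0)"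

text \<open>Vanishing outside the \<open>N\<close> by \<open>N\<close> block turns matrix identities
  into equalities of functions, so they rewrite without index bounds while \<open>N\<close> remains
  an ordinary variable.\<close>

definition msupp :: "nat \<Rightarrow> rmat \<Rightarrow> bool" where
  "msupp N A \<longleftrightarrow> (\<forall>a b. N \<le> a \<or> N \<le> b \<longrightarrow> A a b = 0)"

definition msym :: "rmat \<Rightarrow> bool" where
  "msym A \<longleftrightarrow> (\<forall>a b. A a b = A b a)"

primrec mpow :: "nat \<Rightarrow> rmat \<Rightarrow> nat \<Rightarrow> nat \<Rightarrow> nat \<Rightarrow> real" where
  "mpow N A 0 = idm N"
| "mpow N A (Suc n) = mmul N (mpow N A n) A"

definition tr :: "nat \<Rightarrow> rmat \<Rightarrow> real" where
  "tr N A = (\<Sum>a<N. A a a)"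

definition mv :: "nat \<Rightarrow> rmat \<Rightarrow> (nat \<Rightarrow> real) \<Rightarrow> nat \<Rightarrow> real" where
  "mv N A v = (\<lambda>a. \<Sum>b<N. A a b * v b)"

definition nrm2 :: "nat \<Rightarrow> (nat \<Rightarrow> real) \<Rightarrow> real" where
  "nrm2 N v = (\<Sum>a<N. (v a)\<^sup>2)"

definition mdet :: "nat \<Rightarrow> rmat \<Rightarrow> real" where
  "mdet N X = Determinant.det (mat N N (\<lambda>(a, b). X a b))"

text \<open>Adjugate over determinant: a rational function of the entries, from which measurability
  and continuity follow. At a singular matrix the division by zero yields the zero matrix.\<close>

definition minv :: "nat \<Rightarrow> rmat \<Rightarrow> nat \<Rightarrow> nat \<Rightarrow> real" where
  "minv N X = (\<lambda>a b. if a < N \<and> b < N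
     then adj_mat (mat N N (\<lambda>(a, b). X a b)) $$ (a, b) / mdet N X else 0)"

section \<open>Matrix algebra, inverses and kernels\<close>

lemma mmul_assoc: "mmul N (mmul N A B) C = mmul N A (mmul N B C)"
proof (intro ext)
  fix a b
  have "mmul N (mmul N A B) C a b = (\<Sum>c<N. \<Sum>d<N. A a d * B d c * C c b)"
    by (simp add: mmul_def sum_distrib_right)
  also have "\<dots> = (\<Sum>d<N. \<Sum>c<N. A a d * B d c * C c b)" by (rule sum.swap)
  also have "\<dots> = mmul N A (mmul N B C) a b"
    by (simp add: mmul_def sum_distrib_left mult.assoc)
  finally show "mmul N (mmul N A B) C a b = mmul N A (mmul N B C) a b" .
qed

lemma mmul_idm_left: "msupp N A \<Longrightarrow> mmul N (idm N) A = A"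
proof (intro ext)
  fix a b assume A: "msupp N A"
  have "mmul N (idm N) A a b = (\<Sum>c<N. if c = a then A a b else 0)"
    unfolding mmul_def idm_def by (intro sum.cong) auto
  also have "\<dots> = A a b" using A by (auto simp: msupp_def)
  finally show "mmul N (idm N) A a b = A a b" .
qed

lemma mmul_idm_right: "msupp N A \<Longrightarrow> mmul N A (idm N) = A"
proof (intro ext)
  fix a b assume A: "msupp N A"
  have "mmul N A (idm N) a b = (\<Sum>c<N. if c = b then A a b else 0)"
    unfolding mmul_def idm_def by (intro sum.cong) auto
  also have "\<dots> = A a b" using A by (auto simp: msupp_def)
  finally show "mmul N A (idm N) a b = A a b" .
qed

lemma msupp_mmul: "msupp N A \<Longrightarrow> msupp N B \<Longrightarrow> msupp N (mmul N A B)"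
  unfolding msupp_def mmul_def by auto

lemma msupp_idm: "msupp N (idm N)"
  unfolding msupp_def idm_def by auto

lemma msupp_mpow: "msupp N A \<Longrightarrow> msupp N (mpow N A n)"
  by (induction n) (auto simp: msupp_idm msupp_mmul)

lemma msupp_minv: "msupp N (minv N X)"
  unfolding msupp_def minv_def by auto

lemma tr_mmul_comm: "tr N (mmul N A B) = tr N (mmul N B A)"
  unfolding tr_def mmul_def by (subst sum.swap) (simp add: mult.commute)

lemma mpow_add: "msupp N A \<Longrightarrow> mmul N (mpow N A m) (mpow N A n) = mpow N A (m + n)"
  by (induction n) (simp_all add: mmul_idm_right msupp_mpow mmul_assoc[symmetric])

lemma mpow_1: "msupp N A \<Longrightarrow> mpow N A (Suc 0) = A"
  by (simp add: mmul_idm_left)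

lemma mpow_Suc_left: "msupp N A \<Longrightarrow> mmul N A (mpow N A n) = mpow N A (Suc n)"
  using mpow_add[of N A "Suc 0" n] mpow_1[of N A] by simp

lemma msym_mmul_swap: "msym A \<Longrightarrow> msym B \<Longrightarrow> mmul N A B a b = mmul N B A b a"
  unfolding msym_def mmul_def by (intro sum.cong) (auto simp: mult.commute)

lemma msym_mpow:
  assumes "msupp N A" "msym A" shows "msym (mpow N A n)"
proof (induction n)
  case 0
  show ?case by (auto simp: msym_def idm_def)
next
  case (Suc n)
  show ?case
    unfolding msym_def
  proof (intro allI)
    fix a b
    have "mpow N A (Suc n) a b = mmul N A (mpow N A n) b a"
      using msym_mmul_swap[OF Suc.IH assms(2)] by simp
    then show "mpow N A (Suc n) a b = mpow N A (Suc n) b a"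
      using mpow_Suc_left[OF assms(1)] by simp
  qed
qed

lemma mv_mmul: "mv N (mmul N A B) v = mv N A (mv N B v)"
proof
  fix a
  have "mv N (mmul N A B) v a = (\<Sum>c<N. \<Sum>d<N. A a d * B d c * v c)"
    by (simp add: mmul_def mv_def sum_distrib_right)
  also have "\<dots> = (\<Sum>d<N. \<Sum>c<N. A a d * B d c * v c)" by (rule sum.swap)
  also have "\<dots> = mv N A (mv N B v) a"
    by (simp add: mv_def sum_distrib_left mult.assoc)
  finally show "mv N (mmul N A B) v a = mv N A (mv N B v) a" .
qed

lemma mv_idm: "a < N \<Longrightarrow> mv N (idm N) v a = v a"
proof -
  assume a: "a < N"
  have "mv N (idm N) v a = (\<Sum>c<N. if c = a then v a else 0)"
    unfolding mv_def idm_def using a by (intro sum.cong) auto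
  then show ?thesis using a by simp
qed

lemma nrm2_cong: "(\<And>a. a < N \<Longrightarrow> v a = w a) \<Longrightarrow> nrm2 N v = nrm2 N w"
  unfolding nrm2_def by (intro sum.cong) auto

lemma nrm2_nonneg: "0 \<le> nrm2 N v"
  unfolding nrm2_def by (intro sum_nonneg) auto

lemma nrm2_zero_iff: "nrm2 N v = 0 \<longleftrightarrow> (\<forall>a<N. v a = 0)"
  unfolding nrm2_def by (subst sum_nonneg_eq_0_iff) auto

lemma nrm2_mv_idm: "nrm2 N (mv N (idm N) v) = nrm2 N v"
  by (intro nrm2_cong) (simp add: mv_idm)

lemma msym_mv_adjoint:
  assumes "msym A"
  shows "(\<Sum>a<N. mv N A v a * w a) = (\<Sum>a<N. v a * mv N A w a)"
proof -
  have "(\<Sum>a<N. mv N A v a * w a) = (\<Sum>a<N. \<Sum>b<N. A a b * v b * w a)"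
    by (simp add: mv_def sum_distrib_right)
  also have "\<dots> = (\<Sum>b<N. \<Sum>a<N. A a b * v b * w a)" by (rule sum.swap)
  also have "\<dots> = (\<Sum>b<N. v b * mv N A w b)"
    using assms by (auto simp: mv_def sum_distrib_left msym_def mult_ac intro!: sum.cong)
  finally show ?thesis .
qed

lemma mmul_minv:
  assumes "msupp N X" "mdet N X \<noteq> 0"
  shows "mmul N X (minv N X) = idm N" "mmul N (minv N X) X = idm N"
proof -
  let ?M = "mat N N (\<lambda>(a, b). X a b)"
  have M: "?M \<in> carrier_mat N N" by simp
  note adj = adj_mat[OF M]
  have dims: "dim_row (adj_mat ?M) = N" "dim_col (adj_mat ?M) = N" using adj(1) by auto
  show "mmul N X (minv N X) = idm N"
  proof (intro ext)
    fix a b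
    show "mmul N X (minv N X) a b = idm N a b"
    proof (cases "a < N \<and> b < N")
      case True
      have "mmul N X (minv N X) a b = (\<Sum>c<N. X a c * adj_mat ?M $$ (c, b)) / mdet N X"
        using True by (simp add: mmul_def minv_def sum_divide_distrib)
      also have "(\<Sum>c<N. X a c * adj_mat ?M $$ (c, b)) = (?M * adj_mat ?M) $$ (a, b)"
        using True dims by (simp add: scalar_prod_def lessThan_atLeast0)
      also have "\<dots> = mdet N X * idm N a b"
        unfolding adj(2) using True by (simp add: idm_def mdet_def)
      finally show ?thesis using assms(2) by simp
    next
      case False
      then show ?thesis using assms(1) msupp_minv[of N X]
        by (auto simp: mmul_def idm_def msupp_def)
    qed
  qed
  show "mmul N (minv N X) X = idm N"
  proof (intro ext)
    fix a b
    show "mmul N (minv N X) X a b = idm N a b"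
    proof (cases "a < N \<and> b < N")
      case True
      have "mmul N (minv N X) X a b = (\<Sum>c<N. adj_mat ?M $$ (a, c) * X c b) / mdet N X"
        using True by (simp add: mmul_def minv_def sum_divide_distrib)
      also have "(\<Sum>c<N. adj_mat ?M $$ (a, c) * X c b) = (adj_mat ?M * ?M) $$ (a, b)"
        using True dims by (simp add: scalar_prod_def lessThan_atLeast0)
      also have "\<dots> = mdet N X * idm N a b"
        unfolding adj(3) using True by (simp add: idm_def mdet_def)
      finally show ?thesis using assms(2) by simp
    next
      case False
      then show ?thesis using assms(1) msupp_minv[of N X]
        by (auto simp: mmul_def idm_def msupp_def)
    qed
  qed
qed

text \<open>The transpose of the inverse is a left inverse of the symmetric \<open>X\<close>, and a
  left inverse equals a right inverse.\<close>

lemma msym_minv: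
  assumes "msupp N X" "msym X" "mdet N X \<noteq> 0"
  shows "msym (minv N X)"
proof -
  let ?G = "minv N X"
  define H where "H = (\<lambda>a b. ?G b a)"
  have suppH: "msupp N H" using msupp_minv[of N X] by (auto simp: H_def msupp_def)
  have "mmul N H X = idm N"
  proof (intro ext)
    fix a b
    have "mmul N H X a b = mmul N X ?G b a"
      using assms(2) by (auto simp: mmul_def H_def msym_def mult.commute intro!: sum.cong)
    then show "mmul N H X a b = idm N a b"
      using mmul_minv(1)[OF assms(1,3)] by (simp add: idm_def)
  qed
  then have "H = ?G"
    using mmul_assoc[of N H X ?G] mmul_minv(1)[OF assms(1,3)]
      mmul_idm_right[OF suppH] mmul_idm_left[OF msupp_minv] by simp
  then have "\<And>a b. ?G b a = ?G a b" by (metis H_def)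
  then show ?thesis unfolding msym_def by blast
qed

lemma mdet_zero_kernel:
  assumes "mdet N X = 0"
  obtains v where "nrm2 N v \<noteq> 0" "\<And>a. a < N \<Longrightarrow> mv N X v a = 0"
proof -
  let ?M = "mat N N (\<lambda>(a, b). X a b)"
  have M: "?M \<in> carrier_mat N N" by simp
  obtain w where w: "w \<in> carrier_vec N" "w \<noteq> 0\<^sub>v N" "?M *\<^sub>v w = 0\<^sub>v N"
    using det_0_iff_vec_prod_zero_field[OF M] assms by (auto simp: mdet_def)
  show ?thesis
  proof (rule that[of "vec_index w"])
    show "nrm2 N (vec_index w) \<noteq> 0"
      using w(1,2) by (auto simp: nrm2_zero_iff intro!: eq_vecI)
    fix a assume a: "a < N"
    have "mv N X (vec_index w) a = (?M *\<^sub>v w) $ a"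
      using a w(1) by (auto simp: mv_def scalar_prod_def lessThan_atLeast0)
    then show "mv N X (vec_index w) a = 0" using w(3) a by simp
  qed
qed

lemma mdet_nonzeroI:
  assumes "\<kappa> > 0" "\<And>v. \<kappa>\<^sup>2 * nrm2 N v \<le> nrm2 N (mv N X v)"
  shows "mdet N X \<noteq> 0"
proof
  assume "mdet N X = 0"
  then obtain v where v: "nrm2 N v \<noteq> 0" "\<And>a. a < N \<Longrightarrow> mv N X v a = 0"
    using mdet_zero_kernel by blast
  have "nrm2 N (mv N X v) = 0" using v(2) by (simp add: nrm2_zero_iff)
  then have "\<kappa>\<^sup>2 * nrm2 N v \<le> 0" using assms(2)[of v] by simp
  then show False using assms(1) v(1) nrm2_nonneg[of N v]
    by (smt (verit) mult_pos_pos zero_less_power)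
qed

lemma mv_mpow_Suc: "msupp N A \<Longrightarrow> mv N (mpow N A (Suc n)) v = mv N A (mv N (mpow N A n) v)"
  by (simp add: mv_mmul[symmetric] mpow_Suc_left del: mpow.simps)

section \<open>Schatten norms of even order\<close>

lemma tr_mpow_even:
  assumes "msupp N A" "msym A"
  shows "tr N (mpow N A (l + l)) = (\<Sum>a<N. \<Sum>b<N. (mpow N A l a b)\<^sup>2)"
proof -
  have "tr N (mpow N A (l + l)) = tr N (mmul N (mpow N A l) (mpow N A l))"
    using mpow_add[OF assms(1)] by simp
  also have "\<dots> = (\<Sum>a<N. \<Sum>b<N. (mpow N A l a b)\<^sup>2)"
    unfolding tr_def mmul_def using msym_mpow[OF assms, of l]
    by (auto simp: msym_def power2_eq_square intro!: sum.cong)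
  finally show ?thesis .
qed

lemma nrm2_mv_le_frobenius:
  "nrm2 N (mv N A v) \<le> (\<Sum>a<N. \<Sum>b<N. (A a b)\<^sup>2) * nrm2 N v"
  unfolding nrm2_def mv_def sum_distrib_right
  by (intro sum_mono) (use Cauchy_Schwarz_ineq_sum in \<open>simp add: sum_distrib_right[symmetric]\<close>)

text \<open>The squared norms of the iterates of a symmetric matrix are log-convex.\<close>

lemma nrm2_mv_power_le:
  assumes A: "msupp N A" "msym A" and l: "l > 0"
  shows "nrm2 N (mv N A v) ^ l \<le> nrm2 N v ^ l * tr N (mpow N A (l + l))"
proof -
  define a where "a j = nrm2 N (mv N (mpow N A j) v)" for j
  have a0: "a 0 = nrm2 N v" by (simp add: a_def nrm2_mv_idm)
  have a1: "a (Suc 0) = nrm2 N (mv N A v)"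
    by (simp only: a_def mpow_1[OF A(1)])
  have nn: "0 \<le> a j" for j by (simp add: a_def nrm2_nonneg)
  have logconv: "(a (Suc j))\<^sup>2 \<le> a j * a (Suc (Suc j))" for j
  proof -
    let ?f = "mv N (mpow N A j) v"
    have "a (Suc j) = (\<Sum>i<N. mv N A ?f i * mv N A ?f i)"
      by (simp add: a_def nrm2_def mv_mpow_Suc[OF A(1)] power2_eq_square del: mpow.simps)
    also have "\<dots> = (\<Sum>i<N. ?f i * mv N A (mv N A ?f) i)"
      by (rule msym_mv_adjoint[OF A(2)])
    finally have "(a (Suc j))\<^sup>2 = (\<Sum>i<N. ?f i * mv N A (mv N A ?f) i)\<^sup>2" by simp
    also have "\<dots> \<le> (\<Sum>i<N. (?f i)\<^sup>2) * (\<Sum>i<N. (mv N A (mv N A ?f) i)\<^sup>2)"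
      by (rule Cauchy_Schwarz_ineq_sum)
    finally show ?thesis
      by (simp add: a_def nrm2_def mv_mpow_Suc[OF A(1)] del: mpow.simps)
  qed
  \<comment> \<open>Log-convexity makes the ratios \<open>a (Suc j) / a j\<close> nondecreasing; the
    products avoid dividing by an \<open>a j\<close> that may vanish.\<close>
  have step: "a (Suc 0) * a j \<le> a 0 * a (Suc j)" for j
  proof (induction j)
    case (Suc j)
    show ?case
    proof (cases "a (Suc j) = 0")
      case True
      then show ?thesis using nn by simp
    next
      case False
      then have pos: "a (Suc j) > 0" using nn[of "Suc j"] by simp
      have "a (Suc 0) * a (Suc j) * a (Suc j) \<le> a (Suc 0) * (a j * a (Suc (Suc j)))"
        using logconv[of j] nn[of "Suc 0"] by (simp add: power2_eq_square mult.assoc mult_left_mono)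
      also have "\<dots> \<le> a 0 * a (Suc j) * a (Suc (Suc j))"
        using Suc.IH nn[of "Suc (Suc j)"]
        by (metis mult.assoc mult_right_mono)
      finally have "(a (Suc 0) * a (Suc j)) * a (Suc j) \<le> (a 0 * a (Suc (Suc j))) * a (Suc j)"
        by (simp add: mult_ac)
      then show ?thesis using pos by simp
    qed
  qed simp
  have iter: "a (Suc 0) ^ Suc j \<le> a 0 ^ j * a (Suc j)" for j
  proof (induction j)
    case (Suc j)
    have "a (Suc 0) ^ Suc (Suc j) \<le> a (Suc 0) * (a 0 ^ j * a (Suc j))"
      using mult_left_mono[OF Suc.IH nn[of "Suc 0"]] by simp
    also have "\<dots> \<le> a 0 ^ j * (a 0 * a (Suc (Suc j)))"
      using mult_left_mono[OF step[of "Suc j"], of "a 0 ^ j"] nn[of 0] by (simp add: mult_ac)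
    finally show ?case by (simp add: mult_ac)
  qed simp
  obtain j where j: "l = Suc j" using l by (cases l) auto
  have "a (Suc 0) ^ l \<le> a 0 ^ j * a l" using iter[of j] j by simp
  also have "\<dots> \<le> a 0 ^ j * (tr N (mpow N A (l + l)) * a 0)"
    using nrm2_mv_le_frobenius[of N "mpow N A l" v] nn[of 0]
    by (intro mult_left_mono) (auto simp: a_def nrm2_mv_idm tr_mpow_even[OF A])
  finally show ?thesis by (simp add: a0 a1 j mult_ac)
qed

text \<open>The Schatten norm of order \<open>2 l\<close> of a symmetric matrix. It dominates the
  operator norm, exceeds it at most by the factor \<open>N^(1 / (2 l))\<close>, and is
  differentiable where it is positive.\<close>

definition qn :: "nat \<Rightarrow> nat \<Rightarrow> rmat \<Rightarrow> real" where
  "qn N l A = root (l + l) (tr N (mpow N A (l + l)))"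

lemma tr_mpow_even_nonneg:
  "msupp N A \<Longrightarrow> msym A \<Longrightarrow> 0 \<le> tr N (mpow N A (l + l))"
  by (simp add: tr_mpow_even sum_nonneg)

lemma qn_nonneg: "msupp N A \<Longrightarrow> msym A \<Longrightarrow> 0 \<le> qn N l A"
  unfolding qn_def using tr_mpow_even_nonneg by (cases "l = 0") auto

lemma qn_power:
  "msupp N A \<Longrightarrow> msym A \<Longrightarrow> l > 0 \<Longrightarrow> qn N l A ^ (l + l) = tr N (mpow N A (l + l))"
  unfolding qn_def using tr_mpow_even_nonneg by (intro real_root_pow_pos2) auto

lemma nrm2_mv_le_qn:
  assumes A: "msupp N A" "msym A" and l: "l > 0"
  shows "nrm2 N (mv N A v) \<le> (qn N l A)\<^sup>2 * nrm2 N v"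
proof -
  have "nrm2 N (mv N A v) ^ l \<le> ((qn N l A)\<^sup>2 * nrm2 N v) ^ l"
    using nrm2_mv_power_le[OF assms, of v] qn_power[OF assms]
    by (simp add: power_mult_distrib power_mult[symmetric] mult_2[symmetric] mult.commute)
  then show ?thesis
    using l nrm2_nonneg by (auto intro: power_le_imp_le_base[of _ "l - 1"])
qed

lemma nrm2_mv_mpow_le_qn:
  assumes A: "msupp N A" "msym A" and l: "l > 0"
  shows "nrm2 N (mv N (mpow N A j) v) \<le> (qn N l A ^ j)\<^sup>2 * nrm2 N v"
proof (induction j)
  case 0
  then show ?case by (simp add: nrm2_mv_idm)
next
  case (Suc j)
  have "nrm2 N (mv N (mpow N A (Suc j)) v) \<le> (qn N l A)\<^sup>2 * nrm2 N (mv N (mpow N A j) v)"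
    using nrm2_mv_le_qn[OF assms] by (simp only: mv_mpow_Suc[OF A(1)])
  also have "\<dots> \<le> (qn N l A)\<^sup>2 * ((qn N l A ^ j)\<^sup>2 * nrm2 N v)"
    by (intro mult_left_mono Suc) auto
  finally show ?case by (simp add: power_mult_distrib mult_ac)
qed

definition bvec :: "nat \<Rightarrow> nat \<Rightarrow> real" where
  "bvec b = (\<lambda>a. if a = b then 1 else 0)"

lemma mv_bvec: "b < N \<Longrightarrow> mv N A (bvec b) = (\<lambda>a. A a b)"
  by (auto simp: mv_def bvec_def if_distrib[of "(*) _"] cong: if_cong)

lemma nrm2_bvec: "b < N \<Longrightarrow> nrm2 N (bvec b) = 1"
proof -
  assume b: "b < N"
  have "nrm2 N (bvec b) = (\<Sum>a<N. if a = b then 1 else 0)"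
    unfolding nrm2_def bvec_def by (intro sum.cong) auto
  then show ?thesis using b by simp
qed

lemma mpow_entry_le_qn:
  assumes A: "msupp N A" "msym A" and l: "l > 0"
  shows "\<bar>mpow N A j a b\<bar> \<le> qn N l A ^ j"
proof (cases "a < N \<and> b < N")
  case True
  have "(mpow N A j a b)\<^sup>2 \<le> (\<Sum>a<N. (mpow N A j a b)\<^sup>2)"
    using True by (intro member_le_sum) auto
  also have "\<dots> = nrm2 N (mv N (mpow N A j) (bvec b))"
    using True by (simp add: mv_bvec nrm2_def)
  also have "\<dots> \<le> (qn N l A ^ j)\<^sup>2"
    using nrm2_mv_mpow_le_qn[OF assms, of j "bvec b"] True by (simp add: nrm2_bvec)
  finally show ?thesis
    using qn_nonneg[OF A] by (metis abs_le_square_iff abs_of_nonneg zero_le_power)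
next
  case False
  then have "mpow N A j a b = 0" using msupp_mpow[OF A(1), of j] by (auto simp: msupp_def)
  then show ?thesis using qn_nonneg[OF A] by simp
qed

text \<open>Applying \<open>A\<close> once more to each column of the \<open>l\<close>-th power
  costs the squared operator norm, hence at most \<open>q^2\<close>. The power
  \<open>2 l + 2\<close> appears because differentiating \<open>q\<close> produces the inverse to
  the power \<open>2 l + 1\<close>, which then meets the inverse in the field.\<close>

lemma tr_mpow_le_qn:
  assumes A: "msupp N A" "msym A" and l: "l > 0"
  shows "tr N (mpow N A (Suc l + Suc l)) \<le> qn N l A ^ (Suc l + Suc l)"
proof -
  have col: "mpow N A (Suc l) a b = mv N A (mv N (mpow N A l) (bvec b)) a" if "b < N" for a b
    using that by (metis mv_bvec mv_mpow_Suc[OF A(1)])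
  have "tr N (mpow N A (Suc l + Suc l)) = (\<Sum>b<N. nrm2 N (mv N A (mv N (mpow N A l) (bvec b))))"
    unfolding tr_mpow_even[OF A] nrm2_def
    by (subst sum.swap) (auto simp: col simp del: mpow.simps intro!: sum.cong)
  also have "\<dots> \<le> (\<Sum>b<N. (qn N l A)\<^sup>2 * nrm2 N (mv N (mpow N A l) (bvec b)))"
    by (intro sum_mono nrm2_mv_le_qn assms)
  also have "\<dots> = (qn N l A)\<^sup>2 * tr N (mpow N A (l + l))"
    unfolding tr_mpow_even[OF A] sum_distrib_left[symmetric]
    by (subst sum.swap) (auto simp: mv_bvec nrm2_def intro!: sum.cong)
  also have "\<dots> = qn N l A ^ (Suc l + Suc l)"
    by (simp add: qn_power[OF assms, symmetric] power2_eq_square)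
  finally show ?thesis .
qed

lemma nrm2_mv_minv_le:
  assumes "\<kappa> > 0" "\<And>v. \<kappa>\<^sup>2 * nrm2 N v \<le> nrm2 N (mv N X v)" "msupp N X"
  shows "nrm2 N (mv N (minv N X) v) \<le> nrm2 N v / \<kappa>\<^sup>2"
proof -
  have "mv N X (mv N (minv N X) v) = mv N (idm N) v"
    using mmul_minv(1)[OF assms(3) mdet_nonzeroI[OF assms(1,2)]] by (simp add: mv_mmul[symmetric])
  then have "\<kappa>\<^sup>2 * nrm2 N (mv N (minv N X) v) \<le> nrm2 N v"
    using assms(2)[of "mv N (minv N X) v"] by (simp add: nrm2_mv_idm)
  then show ?thesis using assms(1) by (simp add: field_simps)
qed

text \<open>Each of the \<open>N\<close> columns of the \<open>l\<close>-th power of the inverse has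
  squared norm at most \<open>\<kappa>^(- 2 l)\<close>; the root of \<open>N\<close> is the loss
  from the operator norm to the Schatten norm.\<close>

lemma qn_gap_le:
  assumes "\<kappa> > 0" "\<And>v. \<kappa>\<^sup>2 * nrm2 N v \<le> nrm2 N (mv N X v)" "msupp N X" "msym X" "l > 0"
  shows "qn N l (minv N X) \<le> root (l + l) (real N) / \<kappa>"
proof -
  let ?G = "minv N X"
  have G: "msupp N ?G" "msym ?G"
    using msupp_minv msym_minv[OF assms(3,4) mdet_nonzeroI[OF assms(1,2)]] by auto
  have pw: "nrm2 N (mv N (mpow N ?G j) v) \<le> nrm2 N v / (\<kappa>\<^sup>2) ^ j" for j v
  proof (induction j)
    case (Suc j)
    have "nrm2 N (mv N (mpow N ?G (Suc j)) v) \<le> nrm2 N (mv N (mpow N ?G j) v) / \<kappa>\<^sup>2"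
      using nrm2_mv_minv_le[OF assms(1,2,3)] by (simp only: mv_mpow_Suc[OF G(1)])
    also have "\<dots> \<le> nrm2 N v / (\<kappa>\<^sup>2) ^ j / \<kappa>\<^sup>2"
      by (intro divide_right_mono Suc) auto
    finally show ?case by (simp add: mult_ac)
  qed (simp add: nrm2_mv_idm)
  have "tr N (mpow N ?G (l + l)) = (\<Sum>b<N. nrm2 N (mv N (mpow N ?G l) (bvec b)))"
    unfolding tr_mpow_even[OF G] nrm2_def
    by (subst sum.swap) (auto simp: mv_bvec intro!: sum.cong)
  also have "\<dots> \<le> (\<Sum>b<N. 1 / (\<kappa>\<^sup>2) ^ l)"
    using pw[of l] by (intro sum_mono) (metis lessThan_iff nrm2_bvec)
  also have "\<dots> = real N / \<kappa> ^ (l + l)"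
    by (simp add: power_mult[symmetric] mult_2)
  finally have "qn N l ?G \<le> root (l + l) (real N / \<kappa> ^ (l + l))"
    unfolding qn_def using assms(5) by (intro real_root_le_mono) auto
  also have "\<dots> = root (l + l) (real N) / \<kappa>"
    using assms(1,5) by (simp add: real_root_divide real_root_power_cancel)
  finally show ?thesis .
qed

lemma qn_minv_pos:
  assumes "N > 0" "msupp N X" "msym X" "mdet N X \<noteq> 0" "l > 0"
  shows "qn N l (minv N X) > 0"
proof (rule ccontr)
  let ?G = "minv N X"
  have G: "msupp N ?G" "msym ?G" using msupp_minv msym_minv[OF assms(2-4)] by auto
  assume "\<not> qn N l ?G > 0"
  then have "qn N l ?G = 0" using qn_nonneg[OF G, of l] by simp
  then have "?G a b = 0" for a b
    using mpow_entry_le_qn[OF G assms(5), of "Suc 0" a b] by (simp add: mmul_idm_left G(1))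
  then have "mmul N X ?G 0 0 = 0" by (simp add: mmul_def)
  then show False using mmul_minv(1)[OF assms(2,4)] assms(1) by (simp add: idm_def)
qed

section \<open>The barrier field and its derivative\<close>

lemma mdet_altdef:
  "mdet N X = (\<Sum>p | p permutes {0..<N}. of_int (sign p) * (\<Prod>i = 0..<N. X i (p i)))"
proof -
  have "(\<Prod>i = 0..<N. mat N N (\<lambda>(a, b). X a b) $$ (i, p i)) = (\<Prod>i = 0..<N. X i (p i))"
    if "p permutes {0..<N}" for p
    using permutes_in_image[OF that] by (intro prod.cong) auto
  then show ?thesis
    unfolding mdet_def by (subst det_def'[of _ N]) (auto intro!: sum.cong)
qed

text \<open>The order embedding that misses \<open>a\<close>. It writes each minor as a determinant
  of a reindexed matrix, so facts about \<open>mdet\<close> carry over to the entries of the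
  inverse.\<close>

definition skip :: "nat \<Rightarrow> nat \<Rightarrow> nat" where
  "skip a i = (if i < a then i else Suc i)"

lemma minv_altdef:
  "minv N X a b = (if a < N \<and> b < N then
     (- 1) ^ (a + b) * mdet (N - 1) (\<lambda>i j. X (skip b i) (skip a j)) / mdet N X else 0)"
proof (cases "a < N \<and> b < N")
  case True
  have "mat_delete (mat N N (\<lambda>(a, b). X a b)) b a
      = mat (N - 1) (N - 1) (\<lambda>(i, j). X (skip b i) (skip a j))"
    using True unfolding mat_delete_def by (intro eq_matI) (auto simp: skip_def)
  then show ?thesis
    using True unfolding minv_def mdet_def by (simp add: adj_mat_def cofactor_def add.commute)
qed (auto simp: minv_def)

lemma measurable_mdet:
  assumes "\<And>a b. (\<lambda>x. X x a b) \<in> borel_measurable M"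
  shows "(\<lambda>x. mdet N (X x)) \<in> borel_measurable M"
  unfolding mdet_altdef using assms by measurable

lemma measurable_minv:
  assumes "\<And>a b. (\<lambda>x. X x a b) \<in> borel_measurable M"
  shows "(\<lambda>x. minv N (X x) a b) \<in> borel_measurable M"
proof (cases "a < N \<and> b < N")
  case True
  then show ?thesis
    unfolding minv_altdef using assms
    by (auto intro!: borel_measurable_divide borel_measurable_times measurable_mdet)
next
  case False
  then show ?thesis by (simp only: minv_altdef False if_False) simp
qed

lemma isCont_mdet:
  assumes "\<And>a b. isCont (\<lambda>x. X x a b) (t :: real)"
  shows "isCont (\<lambda>x. mdet N (X x)) t"
  unfolding mdet_altdef using assms by (intro continuous_intros) auto

lemma isCont_minv:
  assumes "\<And>a b. isCont (\<lambda>x. X x a b) (t :: real)" "mdet N (X t) \<noteq> 0"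
  shows "isCont (\<lambda>x. minv N (X x) a b) t"
proof (cases "a < N \<and> b < N")
  case True
  then show ?thesis
    unfolding minv_altdef using assms by (auto intro!: continuous_intros isCont_mdet)
next
  case False
  then show ?thesis by (simp only: minv_altdef False if_False) simp
qed

section \<open>Derivatives along a line, the path followed when a single coupling varies\<close>

definition mline :: "rmat \<Rightarrow> rmat \<Rightarrow> real \<Rightarrow> nat \<Rightarrow> nat \<Rightarrow> real" where
  "mline X C t = (\<lambda>a b. X a b + t * C a b)"

lemma mline_0 [simp]: "mline X C 0 = X"
  by (simp add: mline_def)

lemma mline_add: "mline (mline X C t) C h = mline X C (h + t)"
  by (simp add: mline_def algebra_simps)

lemma msupp_mline: "msupp N X \<Longrightarrow> msupp N C \<Longrightarrow> msupp N (mline X C t)"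
  by (simp add: msupp_def mline_def)

lemma msym_mline: "msym X \<Longrightarrow> msym C \<Longrightarrow> msym (mline X C t)"
  by (simp add: msym_def mline_def)

lemma isCont_mline: "isCont (\<lambda>t. mline X C t a b) t"
  unfolding mline_def by (intro continuous_intros)

text \<open>The resolvent identity \<open>G t - G 0 = - t G t C G 0\<close> turns continuity of the
  inverse into differentiability.\<close>

lemma DERIV_minv_mline:
  assumes X: "msupp N X" "mdet N X \<noteq> 0" and C: "msupp N C"
  shows "((\<lambda>t. minv N (mline X C t) a b) has_real_derivative
    - mmul N (minv N X) (mmul N C (minv N X)) a b) (at 0)"
proof -
  let ?G = "\<lambda>t. minv N (mline X C t)"
  have c: "isCont (\<lambda>t. ?G t a b) 0" for a b
    using X by (intro isCont_minv isCont_mline) auto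
  have "isCont (\<lambda>t. mdet N (mline X C t)) 0" by (intro isCont_mdet isCont_mline)
  then have ev: "\<forall>\<^sub>F t in at 0. mdet N (mline X C t) \<noteq> 0"
    using X(2) by (auto simp: isCont_def intro!: tendsto_imp_eventually_ne)
  have eq: "(?G t a b - ?G 0 a b) / t = - mmul N (?G t) (mmul N C (?G 0)) a b"
    if t: "mdet N (mline X C t) \<noteq> 0" "t \<noteq> 0" for t
  proof -
    have l: "mmul N (?G t) (mmul N (mline X C t) (?G 0)) = ?G 0"
      using mmul_minv(2)[OF msupp_mline[OF X(1) C] t(1)]
      by (simp add: mmul_assoc[symmetric] mmul_idm_left msupp_minv)
    have r: "mmul N (?G t) (mmul N X (?G 0)) = ?G t"
      using mmul_minv(1)[OF X] by (simp add: mmul_idm_right msupp_minv)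
    have "mmul N (?G t) (mmul N (mline X C t) (?G 0)) a b
        = mmul N (?G t) (mmul N X (?G 0)) a b + t * mmul N (?G t) (mmul N C (?G 0)) a b"
      by (simp add: mmul_def mline_def sum.distrib sum_distrib_left sum_distrib_right algebra_simps)
    then have "?G 0 a b = ?G t a b + t * mmul N (?G t) (mmul N C (?G 0)) a b"
      unfolding l r .
    then show ?thesis using t(2) by (simp add: field_simps)
  qed
  have "((\<lambda>t. - mmul N (?G t) (mmul N C (?G 0)) a b) \<longlongrightarrow> - mmul N (?G 0) (mmul N C (?G 0)) a b) (at 0)"
    unfolding mmul_def using c by (intro tendsto_intros) (auto simp: isCont_def)
  then have "((\<lambda>t. (?G t a b - ?G 0 a b) / t) \<longlongrightarrow> - mmul N (?G 0) (mmul N C (?G 0)) a b) (at 0)"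
    by (rule Lim_transform_eventually)
      (use ev in \<open>auto simp: eq[unfolded mline_0] eventually_at_filter elim!: eventually_mono\<close>)
  then show ?thesis by (simp add: DERIV_def)
qed

lemma mmul_sum_left: "mmul N (\<lambda>a b. \<Sum>j\<in>S. A j a b) B a b = (\<Sum>j\<in>S. mmul N (A j) B a b)"
  unfolding mmul_def sum_distrib_right by (rule sum.swap)

lemma mmul_uminus_left: "mmul N (\<lambda>a b. - A a b) B a b = - mmul N A B a b"
  unfolding mmul_def by (simp add: sum_negf)

lemma mmul_uminus_right: "mmul N A (\<lambda>a b. - B a b) a b = - mmul N A B a b"
  unfolding mmul_def by (simp add: sum_negf)

lemma DERIV_mmul:
  assumes "\<And>a b. ((\<lambda>t. A t a b) has_real_derivative A' a b) (at 0)"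
    and "\<And>a b. ((\<lambda>t. B t a b) has_real_derivative B' a b) (at 0)"
  shows "((\<lambda>t. mmul N (A t) (B t) a b) has_real_derivative
    mmul N A' (B 0) a b + mmul N (A 0) B' a b) (at 0)"
  unfolding mmul_def sum.distrib[symmetric]
  by (auto intro!: DERIV_sum DERIV_mult'[THEN DERIV_cong] assms)

lemma DERIV_mpow_minv_mline:
  assumes X: "msupp N X" "mdet N X \<noteq> 0" and C: "msupp N C"
  defines "G \<equiv> minv N X"
  shows "((\<lambda>t. mpow N (minv N (mline X C t)) n a b) has_real_derivative
    - (\<Sum>j<n. mmul N (mpow N G (Suc j)) (mmul N C (mpow N G (n - j))) a b)) (at 0)"
proof (induction n arbitrary: a b)
  case (Suc n)
  have sG: "msupp N G" by (simp add: G_def msupp_minv)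
  let ?D = "\<lambda>n a b. \<Sum>j<n. mmul N (mpow N G (Suc j)) (mmul N C (mpow N G (n - j))) a b"
  have d: "((\<lambda>t. mmul N (mpow N (minv N (mline X C t)) n) (minv N (mline X C t)) a b) has_real_derivative
    mmul N (\<lambda>a b. - ?D n a b) G a b + mmul N (mpow N G n) (\<lambda>a b. - mmul N G (mmul N C G) a b) a b) (at 0)"
    using DERIV_mmul[OF Suc.IH DERIV_minv_mline[OF X C], where N = N and a = a and b = b] by (simp add: G_def)
  have e1: "mmul N (\<lambda>a b. - ?D n a b) G a b
      = - (\<Sum>j<n. mmul N (mpow N G (Suc j)) (mmul N C (mpow N G (Suc n - j))) a b)"
    unfolding mmul_uminus_left mmul_sum_left
    by (auto simp: Suc_diff_le mmul_assoc intro!: sum.cong)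
  have e2: "mmul N (mpow N G n) (\<lambda>a b. - mmul N G (mmul N C G) a b) a b
      = - mmul N (mpow N G (Suc n)) (mmul N C (mpow N G (Suc n - n))) a b"
    unfolding mmul_uminus_right using mpow_1[OF sG] by (simp add: mmul_assoc)
  show ?case
    using d unfolding e1 e2 by (simp add: mmul_assoc)
qed simp

text \<open>The product rule for noncommuting factors gives \<open>n\<close> terms, which cyclicity
  of the trace makes equal.\<close>

lemma DERIV_tr_mpow_minv_mline:
  assumes X: "msupp N X" "mdet N X \<noteq> 0" and C: "msupp N C"
  shows "((\<lambda>t. tr N (mpow N (minv N (mline X C t)) n)) has_real_derivative
    - real n * tr N (mmul N (mpow N (minv N X) (Suc n)) C)) (at 0)"
proof -
  let ?G = "minv N X"
  have sG: "msupp N ?G" by (simp add: msupp_minv)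
  have "((\<lambda>t. tr N (mpow N (minv N (mline X C t)) n)) has_real_derivative
     (\<Sum>a<N. - (\<Sum>j<n. mmul N (mpow N ?G (Suc j)) (mmul N C (mpow N ?G (n - j))) a a))) (at 0)"
    unfolding tr_def by (intro DERIV_sum DERIV_mpow_minv_mline assms)
  also have "(\<Sum>a<N. - (\<Sum>j<n. mmul N (mpow N ?G (Suc j)) (mmul N C (mpow N ?G (n - j))) a a))
      = - (\<Sum>j<n. tr N (mmul N (mpow N ?G (Suc j)) (mmul N C (mpow N ?G (n - j)))))"
    by (simp add: sum_negf tr_def sum.swap[of _ "{..<n}"])
  also have "(\<Sum>j<n. tr N (mmul N (mpow N ?G (Suc j)) (mmul N C (mpow N ?G (n - j)))))
      = (\<Sum>j<n. tr N (mmul N (mpow N ?G (Suc n)) C))"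
  proof (intro sum.cong refl)
    fix j assume "j \<in> {..<n}"
    then have j: "n - j + Suc j = Suc n" by simp
    have "tr N (mmul N (mpow N ?G (Suc j)) (mmul N C (mpow N ?G (n - j))))
        = tr N (mmul N (mmul N (mpow N ?G (Suc j)) C) (mpow N ?G (n - j)))"
      by (simp only: mmul_assoc)
    also have "\<dots> = tr N (mmul N (mmul N (mpow N ?G (n - j)) (mpow N ?G (Suc j))) C)"
      by (subst tr_mmul_comm) (simp only: mmul_assoc)
    finally show "tr N (mmul N (mpow N ?G (Suc j)) (mmul N C (mpow N ?G (n - j))))
        = tr N (mmul N (mpow N ?G (Suc n)) C)"
      by (simp only: mpow_add[OF sG] j)
  qed
  finally show ?thesis by simp
qed

text \<open>At a singular matrix \<open>minv\<close> is the zero matrix, so for \<open>l > 0\<close>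
  the exponential would be 1 there. The value 0 is the right one: it is the limit when the norm of
  the inverse diverges.\<close>

definition barrier :: "nat \<Rightarrow> nat \<Rightarrow> real \<Rightarrow> rmat \<Rightarrow> real" where
  "barrier N l s X = (if mdet N X = 0 then 0 else exp (- s * qn N l (minv N X)))"

text \<open>The trace inner product of the field with \<open>C\<close>: its component along the
  coupling whose coefficient matrix is \<open>C\<close>.\<close>

definition field_comp :: "nat \<Rightarrow> nat \<Rightarrow> real \<Rightarrow> rmat \<Rightarrow> rmat \<Rightarrow> real" where
  "field_comp N l s C X = barrier N l s X * tr N (mmul N C (minv N X))"

text \<open>Chain rule along \<open>C\<close>: the inverse \<open>G\<close> changes by
  \<open>- G C G\<close> and \<open>q\<close> by \<open>- tr (G^(2 l + 1) C) / q^(2 l - 1)\<close>.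
  The factor \<open>barrier\<close> gives the value 0 at singular matrices.\<close>

definition field_deriv :: "nat \<Rightarrow> nat \<Rightarrow> real \<Rightarrow> rmat \<Rightarrow> rmat \<Rightarrow> real" where
  "field_deriv N l s C X = barrier N l s X *
     (s * tr N (mmul N (mpow N (minv N X) (Suc (l + l))) C) / qn N l (minv N X) ^ (l + l - 1)
        * tr N (mmul N C (minv N X))
      - tr N (mmul N C (mmul N (minv N X) (mmul N C (minv N X)))))"

lemma DERIV_field_comp_regular:
  assumes N: "N > 0" and l: "l > 0" and X: "msupp N X" "msym X" "mdet N X \<noteq> 0"
    and C: "msupp N C" "msym C"
  shows "((\<lambda>t. field_comp N l s C (mline X C t)) has_real_derivative field_deriv N l s C X) (at 0)"
proof -
  let ?G = "minv N X"
  let ?q = "qn N l ?G"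
  have q: "?q > 0" by (intro qn_minv_pos N X l)
  have G: "msupp N ?G" "msym ?G" using msupp_minv msym_minv[OF X] by auto
  have tpos: "tr N (mpow N ?G (l + l)) > 0"
    using qn_power[OF G l] q by (metis zero_less_power)
  have dq: "((\<lambda>t. qn N l (minv N (mline X C t))) has_real_derivative
      - tr N (mmul N (mpow N ?G (Suc (l + l))) C) / ?q ^ (l + l - 1)) (at 0)"
  proof -
    have "(root (l + l) has_real_derivative inverse (real (l + l) * ?q ^ (l + l - Suc 0)))
        (at (tr N (mpow N (minv N (mline X C 0)) (l + l))))"
      unfolding qn_def mline_0 using l tpos by (intro DERIV_real_root) auto
    from DERIV_chain2[OF this DERIV_tr_mpow_minv_mline[OF X(1,3) C(1)]]
    have "((\<lambda>t. root (l + l) (tr N (mpow N (minv N (mline X C t)) (l + l)))) has_real_derivative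
        inverse (real (l + l) * ?q ^ (l + l - Suc 0)) *
        (- real (l + l) * tr N (mmul N (mpow N ?G (Suc (l + l))) C))) (at 0)"
      by simp
    then show ?thesis
      unfolding qn_def[of N l "minv N (mline X C t)" for t]
      by (rule DERIV_cong) (use l in \<open>simp add: field_simps\<close>)
  qed
  have dt: "((\<lambda>t. tr N (mmul N C (minv N (mline X C t)))) has_real_derivative
      - tr N (mmul N C (mmul N ?G (mmul N C ?G)))) (at 0)"
  proof -
    have "((\<lambda>t. tr N (mmul N C (minv N (mline X C t)))) has_real_derivative
       (\<Sum>a<N. mmul N (\<lambda>_ _. 0) (minv N (mline X C 0)) a a
          + mmul N C (\<lambda>a b. - mmul N ?G (mmul N C ?G) a b) a a)) (at 0)"
      unfolding tr_def
      by (intro DERIV_sum DERIV_mmul DERIV_minv_mline X C) auto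
    then show ?thesis
      by (rule DERIV_cong) (simp add: mmul_uminus_right tr_def sum_negf, simp add: mmul_def sum_negf)
  qed
  have "isCont (\<lambda>t. mdet N (mline X C t)) 0" by (intro isCont_mdet isCont_mline)
  then have "((\<lambda>t. mdet N (mline X C t)) \<longlongrightarrow> mdet N (mline X C 0)) (nhds 0)"
    unfolding isCont_def
    by (rule tendsto_at_iff_tendsto_nhds[of "\<lambda>t. mdet N (mline X C t)" 0, THEN iffD1])
  then have ev: "\<forall>\<^sub>F t in nhds 0. mdet N (mline X C t) \<noteq> 0"
    by (rule tendsto_imp_eventually_ne) (use X(3) in simp)
  have "((\<lambda>t. exp (- s * qn N l (minv N (mline X C t))) * tr N (mmul N C (minv N (mline X C t))))
      has_real_derivative field_deriv N l s C X) (at 0)"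
    unfolding field_deriv_def barrier_def
    by (rule DERIV_cong, rule DERIV_mult, rule DERIV_fun_exp, rule DERIV_cmult, rule dq, rule dt)
      (use X(3) in \<open>simp add: algebra_simps\<close>)
  then show ?thesis
    by (rule DERIV_cong_ev[OF refl _ refl, THEN iffD1, rotated])
      (use ev in \<open>auto simp: field_comp_def barrier_def elim: eventually_mono\<close>)
qed


text \<open>A crude norm is enough: it serves boundedness of the field and its derivative at
  singular matrices, and never enters the final constants.\<close>

definition msum1 :: "nat \<Rightarrow> rmat \<Rightarrow> real" where
  "msum1 N C = (\<Sum>a<N. \<Sum>b<N. \<bar>C a b\<bar>)"

lemma msum1_nonneg: "0 \<le> msum1 N C"
  unfolding msum1_def by (intro sum_nonneg) auto

lemma abs_tr_mmul_le:
  assumes "\<And>a b. \<bar>A a b\<bar> \<le> K"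
  shows "\<bar>tr N (mmul N C A)\<bar> \<le> msum1 N C * K"
proof -
  have "\<bar>tr N (mmul N C A)\<bar> \<le> (\<Sum>a<N. \<Sum>b<N. \<bar>C a b\<bar> * \<bar>A b a\<bar>)"
    unfolding tr_def mmul_def
    by (intro order.trans[OF sum_abs] sum_mono order.trans[OF sum_abs]) (simp add: abs_mult)
  also have "\<dots> \<le> (\<Sum>a<N. \<Sum>b<N. \<bar>C a b\<bar> * K)"
    by (intro sum_mono mult_left_mono assms) auto
  finally show ?thesis by (simp add: msum1_def sum_distrib_right)
qed

lemma abs_mmul_mmul_le:
  assumes "\<And>a b. \<bar>A a b\<bar> \<le> K" "\<And>a b. \<bar>B a b\<bar> \<le> L"
  shows "\<bar>mmul N A (mmul N C B) a b\<bar> \<le> K * (msum1 N C * L)"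
proof -
  have K: "K \<ge> 0" using assms(1)[of 0 0] by linarith
  have "\<bar>mmul N A (mmul N C B) a b\<bar> \<le> (\<Sum>c<N. \<bar>A a c\<bar> * (\<Sum>d<N. \<bar>C c d\<bar> * \<bar>B d b\<bar>))"
    unfolding mmul_def
    by (intro order.trans[OF sum_abs] sum_mono)
      (auto simp: abs_mult intro!: mult_left_mono order.trans[OF sum_abs])
  also have "\<dots> \<le> (\<Sum>c<N. K * (\<Sum>d<N. \<bar>C c d\<bar> * L))"
    using K by (intro sum_mono mult_mono assms sum_nonneg) auto
  finally show ?thesis by (simp add: msum1_def sum_distrib_right sum_distrib_left)
qed

lemma power_exp_le: "x \<ge> 0 \<Longrightarrow> x ^ n * exp (- x) \<le> fact n" for x :: real
proof -
  assume x: "x \<ge> 0"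
  have "x ^ n / fact n \<le> exp x"
  proof -
    have "(\<Sum>k\<in>{n}. x ^ k /\<^sub>R fact k) \<le> (\<Sum>k. x ^ k /\<^sub>R fact k)"
      using x summable_exp_generic[of x] by (intro sum_le_suminf) auto
    then show ?thesis by (simp add: exp_def divide_inverse mult.commute)
  qed
  then show ?thesis by (simp add: exp_minus field_simps)
qed

lemma power_exp_le': "s > 0 \<Longrightarrow> q \<ge> 0 \<Longrightarrow> q ^ n * exp (- s * q) \<le> fact n / s ^ n" for q s :: real
  using power_exp_le[of "s * q" n] by (simp add: field_simps)

lemma barrier_nonneg: "0 \<le> barrier N l s X"
  by (simp add: barrier_def)

text \<open>The exponential beats every power of the norm of the inverse, uniformly in
  \<open>X\<close>. This is what bounds the field and its derivative although the inverse itself is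
  unbounded.\<close>

lemma barrier_qn_le:
  assumes "msupp N X" "msym X" "s > 0"
  shows "qn N l (minv N X) ^ n * barrier N l s X \<le> fact n / s ^ n"
proof (cases "mdet N X = 0")
  case False
  then have "0 \<le> qn N l (minv N X)"
    by (intro qn_nonneg msupp_minv msym_minv assms)
  then show ?thesis using power_exp_le'[OF assms(3)] False by (simp add: barrier_def)
qed (use assms in \<open>simp add: barrier_def\<close>)

lemma barrier_le_1:
  assumes "msupp N X" "msym X" "s > 0"
  shows "barrier N l s X \<le> 1"
  using barrier_qn_le[OF assms, of l 0] by simp

lemma minv_entry_le_qn:
  assumes "msupp N X" "msym X" "mdet N X \<noteq> 0" "l > 0"
  shows "\<bar>minv N X a b\<bar> \<le> qn N l (minv N X)"
  using mpow_entry_le_qn[OF msupp_minv msym_minv[OF assms(1-3)] assms(4), of "Suc 0" a b]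
  by (simp add: mpow_1[OF msupp_minv] del: mpow.simps)

lemma abs_field_comp_le:
  assumes X: "msupp N X" "msym X" and l: "l > 0"
  shows "\<bar>field_comp N l s C X\<bar> \<le> msum1 N C * (qn N l (minv N X) * barrier N l s X)"
proof (cases "mdet N X = 0")
  case False
  have "\<bar>tr N (mmul N C (minv N X))\<bar> \<le> msum1 N C * qn N l (minv N X)"
    by (intro abs_tr_mmul_le minv_entry_le_qn X False l)
  then have "barrier N l s X * \<bar>tr N (mmul N C (minv N X))\<bar>
      \<le> barrier N l s X * (msum1 N C * qn N l (minv N X))"
    by (intro mult_left_mono barrier_nonneg)
  then show ?thesis by (simp add: field_comp_def abs_mult barrier_nonneg mult_ac)
qed (simp add: field_comp_def barrier_def)

lemma abs_field_deriv_le: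
  assumes N: "N > 0" and X: "msupp N X" "msym X" and l: "l > 0" and s: "s > 0"
  shows "\<bar>field_deriv N l s C X\<bar> \<le> (msum1 N C)\<^sup>2 *
     (s * (qn N l (minv N X) ^ 3 * barrier N l s X) + (qn N l (minv N X))\<^sup>2 * barrier N l s X)"
proof (cases "mdet N X = 0")
  case False
  let ?G = "minv N X"
  let ?q = "qn N l ?G"
  let ?S = "msum1 N C"
  have G: "msupp N ?G" "msym ?G" using msupp_minv msym_minv[OF X False] by auto
  have q: "?q > 0" by (intro qn_minv_pos N X l False)
  have t1: "\<bar>tr N (mmul N (mpow N ?G (Suc (l + l))) C)\<bar> \<le> ?S * ?q ^ Suc (l + l)"
    by (subst tr_mmul_comm) (intro abs_tr_mmul_le mpow_entry_le_qn G l)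
  have t2: "\<bar>tr N (mmul N C ?G)\<bar> \<le> ?S * ?q"
    by (intro abs_tr_mmul_le minv_entry_le_qn X False l)
  have t3: "\<bar>tr N (mmul N C (mmul N ?G (mmul N C ?G)))\<bar> \<le> ?S * (?q * (?S * ?q))"
    by (intro abs_tr_mmul_le abs_mmul_mmul_le minv_entry_le_qn X False l)
  have "\<bar>s * tr N (mmul N (mpow N ?G (Suc (l + l))) C) / ?q ^ (l + l - 1) * tr N (mmul N C ?G)\<bar>
      \<le> s * (?S * ?q ^ Suc (l + l)) / ?q ^ (l + l - 1) * (?S * ?q)"
    using t1 t2 s q
    by (auto simp: abs_mult intro!: mult_mono divide_right_mono mult_left_mono mult_nonneg_nonneg
        msum1_nonneg divide_nonneg_pos)
  also have "?q ^ Suc (l + l) = ?q ^ (l + l - 1) * ?q\<^sup>2"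
    using l by (simp add: power_add[symmetric])
  finally have "\<bar>s * tr N (mmul N (mpow N ?G (Suc (l + l))) C) / ?q ^ (l + l - 1) * tr N (mmul N C ?G)\<bar>
      \<le> ?S\<^sup>2 * (s * ?q ^ 3)"
    using q by (simp add: field_simps power2_eq_square power3_eq_cube)
  then have "\<bar>s * tr N (mmul N (mpow N ?G (Suc (l + l))) C) / ?q ^ (l + l - 1) * tr N (mmul N C ?G)
      - tr N (mmul N C (mmul N ?G (mmul N C ?G)))\<bar> \<le> ?S\<^sup>2 * (s * ?q ^ 3 + ?q\<^sup>2)"
    by (rule order.trans[OF abs_triangle_ineq4 order.trans[OF add_mono[OF _ t3]]])
      (simp add: algebra_simps power2_eq_square)
  then have "barrier N l s X * \<bar>s * tr N (mmul N (mpow N ?G (Suc (l + l))) C) / ?q ^ (l + l - 1) * tr N (mmul N C ?G)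
      - tr N (mmul N C (mmul N ?G (mmul N C ?G)))\<bar> \<le> barrier N l s X * (?S\<^sup>2 * (s * ?q ^ 3 + ?q\<^sup>2))"
    by (intro mult_left_mono barrier_nonneg)
  then show ?thesis
    by (simp only: field_deriv_def abs_mult[of "barrier N l s X"] abs_of_nonneg[OF barrier_nonneg])
      (simp only: algebra_simps)
qed (simp add: field_deriv_def barrier_def)

lemma field_comp_bounded:
  assumes N: "N > 0" and l: "l > 0" and s: "s > 0"
  obtains K where "\<And>X. msupp N X \<Longrightarrow> msym X \<Longrightarrow> \<bar>field_comp N l s C X\<bar> \<le> K"
    and "\<And>X. msupp N X \<Longrightarrow> msym X \<Longrightarrow> \<bar>field_deriv N l s C X\<bar> \<le> K"
proof
  let ?K1 = "msum1 N C * (fact 1 / s ^ 1)"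
  let ?K2 = "(msum1 N C)\<^sup>2 * (s * (fact 3 / s ^ 3) + fact 2 / s\<^sup>2)"
  fix X assume X: "msupp N X" "msym X"
  have "\<bar>field_comp N l s C X\<bar> \<le> ?K1"
    using barrier_qn_le[OF X s, of l 1] msum1_nonneg[of N C]
    by (intro order.trans[OF abs_field_comp_le[OF X l]] mult_left_mono) auto
  then show "\<bar>field_comp N l s C X\<bar> \<le> max ?K1 ?K2" by (simp add: max.coboundedI1)
  have "\<bar>field_deriv N l s C X\<bar> \<le> ?K2"
    using barrier_qn_le[OF X s, of l 2] barrier_qn_le[OF X s, of l 3] s
    by (intro order.trans[OF abs_field_deriv_le[OF N X l s]] mult_left_mono add_mono) auto
  then show "\<bar>field_deriv N l s C X\<bar> \<le> max ?K1 ?K2" by (simp add: max.coboundedI2)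
qed

text \<open>Near a singular matrix the inverse has norm of order at least \<open>1 / \<bar>t\<bar>\<close>, so the exponential
  factor makes the field vanish to second order there.\<close>

lemma DERIV_field_comp_singular:
  assumes l: "l > 0" and s: "s > 0" and X: "msupp N X" "msym X" "mdet N X = 0"
    and C: "msupp N C" "msym C"
  shows "((\<lambda>t. field_comp N l s C (mline X C t)) has_real_derivative 0) (at 0)"
proof -
  define F where "F = (\<Sum>a<N. \<Sum>b<N. (C a b)\<^sup>2)"
  define K where "K = msum1 N C * (6 / s ^ 3 * F)"
  have F: "F \<ge> 0" unfolding F_def by (intro sum_nonneg) auto
  have K: "K \<ge> 0" unfolding K_def using F s msum1_nonneg by auto
  have bd: "\<bar>field_comp N l s C (mline X C t)\<bar> \<le> K * t\<^sup>2" for t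
  proof (cases "mdet N (mline X C t) = 0")
    case True
    then show ?thesis using K by (simp add: field_comp_def barrier_def)
  next
    case False
    let ?X = "mline X C t"
    let ?G = "minv N ?X"
    let ?q = "qn N l ?G"
    have sX: "msupp N ?X" "msym ?X" using msupp_mline msym_mline X C by auto
    have G: "msupp N ?G" "msym ?G" using msupp_minv msym_minv[OF sX False] by auto
    obtain v where v: "nrm2 N v \<noteq> 0" "\<And>a. a < N \<Longrightarrow> mv N X v a = 0"
      using mdet_zero_kernel[OF X(3)] by blast
    have Xv: "mv N ?X v a = t * mv N C v a" if "a < N" for a
      using v(2)[OF that] by (simp add: mv_def mline_def sum.distrib sum_distrib_left algebra_simps)
    have "nrm2 N v = nrm2 N (mv N (mmul N ?G ?X) v)"
      using mmul_minv(2)[OF sX(1) False] by (simp add: nrm2_mv_idm)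
    also have "\<dots> \<le> ?q\<^sup>2 * nrm2 N (mv N ?X v)"
      unfolding mv_mmul by (intro nrm2_mv_le_qn G l)
    also have "nrm2 N (mv N ?X v) = t\<^sup>2 * nrm2 N (mv N C v)"
      by (simp add: nrm2_def Xv power_mult_distrib sum_distrib_left)
    also have "?q\<^sup>2 * \<dots> \<le> ?q\<^sup>2 * (t\<^sup>2 * (F * nrm2 N v))"
      unfolding F_def by (intro mult_left_mono nrm2_mv_le_frobenius) auto
    finally have "1 * nrm2 N v \<le> (?q\<^sup>2 * t\<^sup>2 * F) * nrm2 N v" by (simp add: mult_ac)
    then have one: "1 \<le> ?q\<^sup>2 * t\<^sup>2 * F"
      using v(1) nrm2_nonneg[of N v] by (simp add: mult_le_cancel_right)
    have q: "?q \<ge> 0" using qn_nonneg[OF G] .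
    \<comment> \<open>A kernel vector of \<open>X\<close> has shown
      \<open>q^2 t^2 F \<ge> 1\<close>. Multiplying by it trades two further powers of
      \<open>q\<close>, which the barrier absorbs, for the factor \<open>t^2\<close>.\<close>
    have "?q * barrier N l s ?X * 1 \<le> ?q * barrier N l s ?X * (?q\<^sup>2 * t\<^sup>2 * F)"
      using one q by (intro mult_left_mono) (auto simp: barrier_nonneg)
    also have "\<dots> = (?q ^ 3 * barrier N l s ?X) * (t\<^sup>2 * F)"
      by (simp add: power2_eq_square power3_eq_cube mult_ac)
    also have "\<dots> \<le> (fact 3 / s ^ 3) * (t\<^sup>2 * F)"
      using barrier_qn_le[OF sX s, of l 3] F by (intro mult_right_mono) auto
    finally have "?q * barrier N l s ?X \<le> 6 / s ^ 3 * F * t\<^sup>2"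
      by (simp add: fact_numeral mult_ac)
    then have "msum1 N C * (?q * barrier N l s ?X) \<le> K * t\<^sup>2"
      using mult_left_mono[OF _ msum1_nonneg[of N C]] unfolding K_def mult.assoc by blast
    then show ?thesis using abs_field_comp_le[OF sX l, of s C] by linarith
  qed
  have "((\<lambda>t. field_comp N l s C (mline X C t) / t) \<longlongrightarrow> 0) (at 0)"
  proof (rule Lim_null_comparison)
    show "\<forall>\<^sub>F t in at 0. norm (field_comp N l s C (mline X C t) / t) \<le> K * \<bar>t\<bar>"
      unfolding eventually_at_filter
    proof (intro always_eventually allI impI)
      fix t :: real assume "t \<noteq> 0"
      then show "norm (field_comp N l s C (mline X C t) / t) \<le> K * \<bar>t\<bar>"
        using bd[of t] by (simp add: abs_divide divide_le_eq power2_eq_square mult.assoc)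
    qed
    show "((\<lambda>t. K * \<bar>t\<bar>) \<longlongrightarrow> 0) (at 0)"
      by (auto intro!: tendsto_eq_intros)
  qed
  then show ?thesis
    using bd[of 0] by (simp add: DERIV_def)
qed

text \<open>When a coupling varies, its line may cross the singular set, so integration by parts
  asks for the derivative at every point. Additivity of \<open>mline\<close> moves the base point to
  0.\<close>

lemma DERIV_field_comp:
  assumes N: "N > 0" and l: "l > 0" and s: "s > 0" and X: "msupp N X" "msym X"
    and C: "msupp N C" "msym C"
  shows "((\<lambda>t. field_comp N l s C (mline X C t)) has_real_derivative
    field_deriv N l s C (mline X C t)) (at t)"
proof -
  let ?Y = "mline X C t"
  have Y: "msupp N ?Y" "msym ?Y" using msupp_mline msym_mline X C by auto
  have "((\<lambda>h. field_comp N l s C (mline ?Y C h)) has_real_derivative field_deriv N l s C ?Y) (at 0)"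
  proof (cases "mdet N ?Y = 0")
    case True
    then show ?thesis
      using DERIV_field_comp_singular[OF l s Y True C] by (simp add: field_deriv_def barrier_def)
  next
    case False
    then show ?thesis by (intro DERIV_field_comp_regular N l Y C)
  qed
  then show ?thesis
    unfolding mline_add by (subst (asm) DERIV_shift[symmetric]) simp
qed

lemma measurable_field_comp:
  assumes "\<And>a b. (\<lambda>x. X x a b) \<in> borel_measurable M"
  shows "(\<lambda>x. barrier N l s (X x)) \<in> borel_measurable M"
    and "(\<lambda>x. field_comp N l s C (X x)) \<in> borel_measurable M"
    and "(\<lambda>x. field_deriv N l s C (X x)) \<in> borel_measurable M"
proof -
  note [measurable] = measurable_mdet[OF assms] measurable_minv[OF assms]
  have mm: "(\<lambda>x. mmul N (A x) (B x) a b) \<in> borel_measurable M"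
    if "\<And>a b. (\<lambda>x. A x a b) \<in> borel_measurable M" "\<And>a b. (\<lambda>x. B x a b) \<in> borel_measurable M"
    for A B a b
    unfolding mmul_def using that by measurable
  have mp [measurable]: "(\<lambda>x. mpow N (minv N (X x)) n a b) \<in> borel_measurable M" for n a b
    by (induction n arbitrary: a b) (auto intro!: mm measurable_minv assms)
  have [measurable]: "root n \<in> borel_measurable borel" for n
    by (intro borel_measurable_continuous_onI continuous_on_real_root continuous_on_id)
  have [measurable]: "(\<lambda>x. qn N l (minv N (X x))) \<in> borel_measurable M"
    unfolding qn_def tr_def by measurable
  show b [measurable]: "(\<lambda>x. barrier N l s (X x)) \<in> borel_measurable M"
    unfolding barrier_def by measurable
  have [measurable]: "(\<lambda>x. mmul N C (minv N (X x)) a b) \<in> borel_measurable M" for a b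
    by (intro mm) auto
  show "(\<lambda>x. field_comp N l s C (X x)) \<in> borel_measurable M"
    unfolding field_comp_def tr_def by measurable
  have [measurable]: "(\<lambda>x. mmul N (mpow N (minv N (X x)) (Suc (l + l))) C a b) \<in> borel_measurable M" for a b
    by (intro mm mp) auto
  have [measurable]: "(\<lambda>x. mmul N C (mmul N (minv N (X x)) (mmul N C (minv N (X x)))) a b) \<in> borel_measurable M" for a b
    by (intro mm) auto
  show "(\<lambda>x. field_deriv N l s C (X x)) \<in> borel_measurable M"
    unfolding field_deriv_def tr_def by measurable
qed

section \<open>Gaussian integration by parts\<close>

definition gaussian :: "real measure" where
  "gaussian = density lborel std_normal_density"

lemma prob_space_gaussian: "prob_space gaussian"
  unfolding gaussian_def by (rule prob_space_normal_density) simp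

lemma sets_gaussian [measurable_cong, simp]: "sets gaussian = sets borel"
  unfolding gaussian_def by simp

lemma space_gaussian [simp]: "space gaussian = UNIV"
  unfolding gaussian_def by simp

lemma has_derivative_std_normal_density:
  "(std_normal_density has_real_derivative - x * std_normal_density x) (at x)"
  unfolding std_normal_density_def
  by (auto intro!: derivative_eq_intros simp: field_simps power2_eq_square)

lemma integrable_std_normal_abs_moment: "integrable lborel (\<lambda>x. std_normal_density x * \<bar>x\<bar>)"
  using integrable_std_normal_moment_abs[of 1] by simp

lemma integrable_gaussian_abs: "integrable gaussian (\<lambda>x. x)"
  unfolding gaussian_def
  using integrable_std_normal_moment[of 1]
  by (subst integrable_density) auto

lemma std_normal_density_tendsto:
  "(std_normal_density \<longlongrightarrow> 0) at_top" "(std_normal_density \<longlongrightarrow> 0) at_bot"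
  unfolding std_normal_density_def by real_asymp+

text \<open>Stein's identity. The function \<open>h\<close> is the derivative of the density times
  \<open>f\<close>, so its integral over \<open>[- n, n]\<close> is a boundary term; the bound on
  \<open>f\<close> sends it to 0 and dominated convergence gives the integral over the line.\<close>

lemma gaussian_integration_by_parts:
  fixes f f' :: "real \<Rightarrow> real"
  assumes der: "\<And>x. (f has_real_derivative f' x) (at x)"
    and bf: "\<And>x. \<bar>f x\<bar> \<le> K" and bf': "\<And>x. \<bar>f' x\<bar> \<le> K"
    and meas: "f' \<in> borel_measurable borel"
  shows "(\<integral>x. x * f x \<partial>gaussian) = (\<integral>x. f' x \<partial>gaussian)"
proof -
  let ?g = std_normal_density
  have K: "K \<ge> 0" using bf[of 0] by linarith
  have contf: "continuous_on UNIV f"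
    using der by (meson DERIV_isCont continuous_at_imp_continuous_on)
  then have mf [measurable]: "f \<in> borel_measurable borel"
    by (rule borel_measurable_continuous_onI)
  note meas [measurable]
  define h where "h x = ?g x * f' x - ?g x * (x * f x)" for x
  have i1: "integrable lborel (\<lambda>x. ?g x * f' x)"
  proof (rule Bochner_Integration.integrable_bound[of _ "\<lambda>x. K * ?g x"])
    show "integrable lborel (\<lambda>x. K * ?g x)"
      by (intro integrable_mult_right integrable_normal_density) simp
    show "AE x in lborel. norm (?g x * f' x) \<le> norm (K * ?g x)"
      using bf' K by (auto simp: abs_mult mult.commute intro!: mult_mono)
  qed simp
  have i2: "integrable lborel (\<lambda>x. ?g x * (x * f x))"
  proof (rule Bochner_Integration.integrable_bound[of _ "\<lambda>x. K * (?g x * \<bar>x\<bar>)"])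
    show "integrable lborel (\<lambda>x. K * (?g x * \<bar>x\<bar>))"
      by (intro integrable_mult_right integrable_std_normal_abs_moment)
    show "AE x in lborel. norm (?g x * (x * f x)) \<le> norm (K * (?g x * \<bar>x\<bar>))"
    proof (intro AE_I2)
      fix x :: real
      have "(?g x * \<bar>x\<bar>) * \<bar>f x\<bar> \<le> (?g x * \<bar>x\<bar>) * K"
        by (intro mult_left_mono bf) auto
      then show "norm (?g x * (x * f x)) \<le> norm (K * (?g x * \<bar>x\<bar>))"
        using K by (simp add: abs_mult mult_ac)
    qed
  qed simp
  have ih: "integrable lborel h"
    unfolding h_def by (intro Bochner_Integration.integrable_diff i1 i2)
  have derh: "((\<lambda>x. ?g x * f x) has_real_derivative h x) (at x)" for x
    unfolding h_def
    by (auto intro!: derivative_eq_intros has_derivative_std_normal_density der simp: algebra_simps)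
  have hI: "(h has_integral (?g (real n) * f (real n) - ?g (- real n) * f (- real n)))
      {- real n..real n}" for n
    using derh
    by (intro fundamental_theorem_of_calculus)
      (auto simp: has_real_derivative_iff_has_vector_derivative[symmetric]
        intro: has_field_derivative_at_within)
  have setint: "(\<integral>x. indicator {- real n..real n} x * h x \<partial>lborel)
      = ?g (real n) * f (real n) - ?g (- real n) * f (- real n)" for n
  proof -
    have "set_integrable lborel {- real n..real n} h"
      unfolding set_integrable_def using ih by (intro integrable_mult_indicator) auto
    from set_borel_integral_eq_integral(2)[OF this] show ?thesis
      using hI[of n] by (simp add: set_lebesgue_integral_def integral_unique)
  qed
  have lim1: "(\<lambda>n. \<integral>x. indicator {- real n..real n} x * h x \<partial>lborel) \<longlonglongrightarrow> (\<integral>x. h x \<partial>lborel)"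
  proof (rule integral_dominated_convergence[where w = "\<lambda>x. \<bar>h x\<bar>"])
    show "h \<in> borel_measurable lborel" using ih by auto
    then show "\<And>n. (\<lambda>x. indicator {- real n..real n} x * h x) \<in> borel_measurable lborel" by simp
    show "integrable lborel (\<lambda>x. \<bar>h x\<bar>)" using ih by auto
    show "AE x in lborel. (\<lambda>n. indicator {- real n..real n} x * h x) \<longlonglongrightarrow> h x"
    proof (intro AE_I2 tendsto_eventually)
      fix x :: real
      obtain m where m: "\<bar>x\<bar> \<le> real m" using real_arch_simple by blast
      show "\<forall>\<^sub>F n in sequentially. indicator {- real n..real n} x * h x = h x"
        using eventually_ge_at_top[of m]
        by eventually_elim (use m in \<open>auto simp: indicator_def\<close>)
    qed
    show "\<And>n. AE x in lborel. norm (indicator {- real n..real n} x * h x) \<le> \<bar>h x\<bar>"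
      by (auto simp: indicator_def)
  qed
  have b0: "(\<lambda>n. u (real n) * f (v (real n))) \<longlonglongrightarrow> 0" if u: "(\<lambda>n. u (real n)) \<longlonglongrightarrow> 0" for u v
  proof (rule Lim_null_comparison)
    show "\<forall>\<^sub>F n in sequentially. norm (u (real n) * f (v (real n))) \<le> \<bar>u (real n)\<bar> * K"
      using bf by (intro always_eventually allI) (auto simp: abs_mult intro!: mult_left_mono)
    show "(\<lambda>n. \<bar>u (real n)\<bar> * K) \<longlonglongrightarrow> 0"
      using tendsto_mult_right[OF tendsto_rabs[OF u], of K] by (simp add: mult.commute)
  qed
  have g1: "(\<lambda>n. ?g (real n)) \<longlonglongrightarrow> 0"
    by (rule filterlim_compose[OF std_normal_density_tendsto(1) filterlim_real_sequentially])
  then have g2: "(\<lambda>n. ?g (- real n)) \<longlonglongrightarrow> 0"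
    by (simp add: std_normal_density_def)
  have "(\<lambda>n. ?g (real n) * f (real n) - ?g (- real n) * f (- real n)) \<longlonglongrightarrow> 0 - 0"
    by (intro tendsto_diff b0[of ?g "\<lambda>x. x", OF g1] b0[of "\<lambda>x. ?g (- x)" "\<lambda>x. - x", OF g2])
  then have "(\<integral>x. h x \<partial>lborel) = 0"
    using LIMSEQ_unique[OF lim1] setint by simp
  then have "(\<integral>x. ?g x * f' x \<partial>lborel) = (\<integral>x. ?g x * (x * f x) \<partial>lborel)"
    unfolding h_def using i1 i2 by simp
  then show ?thesis
    unfolding gaussian_def by (simp add: integral_density)
qed

section \<open>Integration by parts for independent Gaussians\<close>

abbreviation gaussian_product :: "'i set \<Rightarrow> ('i \<Rightarrow> real) measure" where
  "gaussian_product I \<equiv> Pi\<^sub>M I (\<lambda>_. gaussian)"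

text \<open>Stein's identity in coordinate \<open>i\<close> with the others frozen, integrated over
  these by Fubini. The uniform bound \<open>K\<close> supplies integrability on both sides.\<close>

lemma product_gaussian_integration_by_parts:
  fixes F F' :: "('i \<Rightarrow> real) \<Rightarrow> real"
  assumes I: "finite I" "i \<in> I"
    and der: "\<And>j t. j \<in> space (gaussian_product I) \<Longrightarrow>
      ((\<lambda>t. F (j(i := t))) has_real_derivative F' (j(i := t))) (at t)"
    and bF: "\<And>j. \<bar>F j\<bar> \<le> K" and bF': "\<And>j. \<bar>F' j\<bar> \<le> K"
    and mF: "F \<in> borel_measurable (gaussian_product I)"
    and mF': "F' \<in> borel_measurable (gaussian_product I)"
  shows "integrable (gaussian_product I) (\<lambda>j. j i * F j)"
    and "integrable (gaussian_product I) F'"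
    and "(\<integral>j. j i * F j \<partial>gaussian_product I) = (\<integral>j. F' j \<partial>gaussian_product I)"
proof -
  interpret G: prob_space gaussian by (rule prob_space_gaussian)
  interpret P: product_prob_space "\<lambda>_. gaussian" I by unfold_locales
  interpret S: product_sigma_finite "\<lambda>_. gaussian" by unfold_locales
  let ?P = "gaussian_product I"
  define I' where "I' = I - {i}"
  have I': "insert i I' = I" "finite I'" "i \<notin> I'" using I by (auto simp: I'_def)
  have mi: "(\<lambda>j. j i) \<in> borel_measurable ?P"
    using measurable_component_singleton[OF I(2), of "\<lambda>_. gaussian"]
    by (simp only: measurable_cong_sets[OF refl sets_gaussian])
  have "integrable (distr ?P gaussian (\<lambda>j. j i)) (\<lambda>x. x)"
    using integrable_gaussian_abs by (simp add: P.PiM_component[OF I(2)])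
  then have ii: "integrable ?P (\<lambda>j. j i)"
    by (subst (asm) integrable_distr_eq) (use measurable_component_singleton[OF I(2)] in auto)
  show int1: "integrable ?P (\<lambda>j. j i * F j)"
  proof (rule Bochner_Integration.integrable_bound[of _ "\<lambda>j. K * j i"])
    show "integrable ?P (\<lambda>j. K * j i)" using ii by simp
    show "(\<lambda>j. j i * F j) \<in> borel_measurable ?P" using mi mF by simp
    have "\<bar>F j\<bar> * \<bar>j i\<bar> \<le> \<bar>K\<bar> * \<bar>j i\<bar>" for j
      using bF[of j] by (intro mult_right_mono) auto
    then show "AE j in ?P. norm (j i * F j) \<le> norm (K * j i)"
      by (auto simp: abs_mult mult.commute)
  qed
  show int2: "integrable ?P F'"
    using bF' mF' by (intro P.P.integrable_const_bound[of _ K]) auto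
  have upd: "j(i := t) \<in> space ?P" if "j \<in> space (Pi\<^sub>M I' (\<lambda>_. gaussian))" for j t
    using that I' by (auto simp: space_PiM PiE_def extensional_def)
  have inner: "(\<integral>t. t * F (j(i := t)) \<partial>gaussian) = (\<integral>t. F' (j(i := t)) \<partial>gaussian)"
    if j: "j \<in> space (Pi\<^sub>M I' (\<lambda>_. gaussian))" for j
  proof (rule gaussian_integration_by_parts[of "\<lambda>t. F (j(i := t))" "\<lambda>t. F' (j(i := t))" K])
    show "((\<lambda>t. F (j(i := t))) has_real_derivative F' (j(i := x))) (at x)" for x
      using der[OF upd[OF j, of 0], of x] by simp
    have "(\<lambda>t. j(i := t)) \<in> gaussian \<rightarrow>\<^sub>M ?P"
      using j I' measurable_component_update[of j I' "\<lambda>_. gaussian" i] by simp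
    from measurable_compose[OF this mF']
    show "(\<lambda>t. F' (j(i := t))) \<in> borel_measurable borel"
      by (simp cong: measurable_cong_sets)
  qed (use bF bF' in auto)
  have "(\<integral>j. j i * F j \<partial>?P) = (\<integral>j. \<integral>t. t * F (j(i := t)) \<partial>gaussian \<partial>Pi\<^sub>M I' (\<lambda>_. gaussian))"
    using S.product_integral_insert[OF I'(2,3), of "\<lambda>j. j i * F j"] int1 by (simp add: I'(1))
  also have "\<dots> = (\<integral>j. \<integral>t. F' (j(i := t)) \<partial>gaussian \<partial>Pi\<^sub>M I' (\<lambda>_. gaussian))"
    by (intro Bochner_Integration.integral_cong inner refl)
  also have "\<dots> = (\<integral>j. F' j \<partial>?P)"
    using S.product_integral_insert[OF I'(2,3), of F'] int2 by (simp add: I'(1))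
  finally show "(\<integral>j. j i * F j \<partial>?P) = (\<integral>j. F' j \<partial>?P)" .
qed

section \<open>Spectral gaps of a tangential GOE\<close>

text \<open>The orthogonal projection onto the complement of \<open>x\<close> once \<open>x\<close>
  has squared norm \<open>N\<close>. The cut-off is explicit because \<open>x\<close> may be nonzero
  at indices from \<open>N\<close> on.\<close>

definition mproj :: "nat \<Rightarrow> (nat \<Rightarrow> real) \<Rightarrow> nat \<Rightarrow> nat \<Rightarrow> real" where
  "mproj N x = (\<lambda>a b. if a < N \<and> b < N then idm N a b - x a * x b / real N else 0)"

lemma msupp_mproj: "msupp N (mproj N x)"
  by (simp add: msupp_def mproj_def)

lemma msym_mproj: "msym (mproj N x)"
  by (auto simp: msym_def mproj_def idm_def)

lemma mmul_mproj_right: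
  assumes "msupp N A"
  shows "mmul N A (mproj N x) a b = A a b - (if b < N then mv N A x a * x b / real N else 0)"
proof (cases "b < N")
  case True
  have "mmul N A (mproj N x) a b = (\<Sum>c<N. A a c * idm N c b - A a c * x c * x b / real N)"
    using True by (auto simp: mmul_def mproj_def algebra_simps intro!: sum.cong)
  also have "\<dots> = mmul N A (idm N) a b - mv N A x a * x b / real N"
    by (simp add: sum_subtractf mmul_def mv_def sum_distrib_right sum_divide_distrib)
  finally show ?thesis using True by (simp add: mmul_idm_right[OF assms])
next
  case False
  then show ?thesis using assms by (simp add: mmul_def mproj_def msupp_def)
qed

lemma tr_mmul_mproj:
  assumes "msupp N A"
  shows "tr N (mmul N A (mproj N x)) = tr N A - (\<Sum>a<N. mv N A x a * x a) / real N"
  unfolding tr_def mmul_mproj_right[OF assms]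
  by (simp add: sum_subtractf sum_divide_distrib)

lemma mmul_mproj_eq_self:
  assumes "msupp N A" "\<And>a. a < N \<Longrightarrow> mv N A x a = 0"
  shows "mmul N A (mproj N x) = A"
proof (intro ext)
  fix a b
  show "mmul N A (mproj N x) a b = A a b"
  proof (cases "a < N")
    case True
    then show ?thesis by (simp add: mmul_mproj_right[OF assms(1)] assms(2))
  next
    case False
    then show ?thesis using assms(1) by (simp add: mmul_def msupp_def)
  qed
qed

lemma mproj_kernel:
  assumes "(\<Sum>a<N. (x a)\<^sup>2) = real N" "a < N"
  shows "mv N (mproj N x) x a = 0"
proof -
  have "mv N (mproj N x) x a = (\<Sum>b<N. idm N a b * x b - x a * (x b)\<^sup>2 / real N)"
    using assms(2) by (auto simp: mv_def mproj_def algebra_simps power2_eq_square intro!: sum.cong)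
  also have "\<dots> = mv N (idm N) x a - x a * (\<Sum>b<N. (x b)\<^sup>2) / real N"
    by (simp add: sum_subtractf mv_def sum_distrib_left sum_divide_distrib)
  also have "\<dots> = 0" using assms by (simp add: mv_idm)
  finally show ?thesis .
qed

lemma mproj_idem:
  assumes "(\<Sum>a<N. (x a)\<^sup>2) = real N"
  shows "mmul N (mproj N x) (mproj N x) = mproj N x"
  by (intro mmul_mproj_eq_self msupp_mproj mproj_kernel assms)

text \<open>The covariance of the entries of a symmetric Gaussian matrix that is a multiple of the GOE
  on the orthogonal complement of \<open>x\<close> and vanishes on \<open>x\<close>.\<close>

locale tangent_goe =
  fixes N :: nat and I :: "'i set" and C :: "'i \<Rightarrow> nat \<Rightarrow> nat \<Rightarrow> real"
    and x :: "nat \<Rightarrow> real" and v b :: real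
  assumes N: "N > 0" and I: "finite I"
    and C: "\<And>i. i \<in> I \<Longrightarrow> msupp N (C i)" "\<And>i. i \<in> I \<Longrightarrow> msym (C i)"
    and x: "(\<Sum>a<N. (x a)\<^sup>2) = real N"
    and Cx: "\<And>i a. i \<in> I \<Longrightarrow> a < N \<Longrightarrow> mv N (C i) x a = 0"
    and cov: "\<And>a b c d. a < N \<Longrightarrow> b < N \<Longrightarrow> c < N \<Longrightarrow> d < N \<Longrightarrow>
      (\<Sum>i\<in>I. C i a b * C i c d) = v * (mproj N x a c * mproj N x b d + mproj N x a d * mproj N x b c)"
    and v: "v > 0" and b: "b \<noteq> 0"
begin

abbreviation P where "P \<equiv> mproj N x"

text \<open>The shift moves the centre \<open>- b\<close> of a window to 0. On \<open>x\<close> this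
  matrix acts as multiplication by \<open>b \<noteq> 0\<close>, so it can be inverted on the whole
  space and no basis of the tangent space has to be chosen.\<close>

definition X :: "('i \<Rightarrow> real) \<Rightarrow> nat \<Rightarrow> nat \<Rightarrow> real" where
  "X j = (\<lambda>a c. b * idm N a c + (\<Sum>i\<in>I. j i * C i a c))"

lemma X: "msupp N (X j)" "msym (X j)"
  using C msupp_idm[of N] by (auto simp: X_def msupp_def msym_def idm_def)

lemma X_upd:
  assumes "i \<in> I" shows "X (j(i := t)) = mline (X (j(i := 0))) (C i) t"
  using I assms by (intro ext) (simp add: X_def mline_def sum.remove[of I i])

section \<open>Contractions with the covariance\<close>

lemma cov_sum:
  "(\<Sum>i\<in>I. \<Sum>a<N. \<Sum>c<N. \<Sum>d<N. \<Sum>e<N. C i a c * C i d e * K a c d e)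
    = v * (\<Sum>a<N. \<Sum>c<N. \<Sum>d<N. \<Sum>e<N. (P a d * P c e + P a e * P c d) * K a c d e)"
proof -
  have "(\<Sum>i\<in>I. \<Sum>a<N. \<Sum>c<N. \<Sum>d<N. \<Sum>e<N. C i a c * C i d e * K a c d e)
      = (\<Sum>a<N. \<Sum>c<N. \<Sum>d<N. \<Sum>e<N. (\<Sum>i\<in>I. C i a c * C i d e) * K a c d e)"
    by (simp only: sum.swap[of _ "{..<N}" I] sum_distrib_right)
  also have "\<dots> = (\<Sum>a<N. \<Sum>c<N. \<Sum>d<N. \<Sum>e<N. v * ((P a d * P c e + P a e * P c d) * K a c d e))"
    by (intro sum.cong refl) (simp add: cov)
  finally show ?thesis by (simp add: sum_distrib_left)
qed

text \<open>Both pairings in the covariance give the same trace because \<open>B\<close> is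
  symmetric; hence the factor 2. It is applied with \<open>A\<close> the power
  \<open>2 l + 1\<close> of the inverse and \<open>B\<close> the inverse, the pairing created by
  differentiating the barrier.\<close>

lemma sum_tr_tr:
  assumes "msym A" "msym B"
  shows "(\<Sum>i\<in>I. tr N (mmul N A (C i)) * tr N (mmul N (C i) B))
    = 2 * v * tr N (mmul N A (mmul N P (mmul N B P)))"
proof -
  have As: "A a c = A c a" and Bs: "B a c = B c a" and Ps: "P a c = P c a" for a c
    using assms msym_mproj[of N x] unfolding msym_def by blast+
  have e1: "tr N (mmul N A (C i)) * tr N (mmul N (C i) B)
      = (\<Sum>a<N. \<Sum>c<N. \<Sum>d<N. \<Sum>e<N. C i a c * C i d e * (A c a * B e d))" for i
  proof -
    have "tr N (mmul N A (C i)) * tr N (mmul N (C i) B)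
        = (\<Sum>a<N. \<Sum>c<N. C i a c * A c a) * (\<Sum>d<N. \<Sum>e<N. C i d e * B e d)"
      by (subst tr_mmul_comm) (simp add: tr_def mmul_def)
    also have "\<dots> = (\<Sum>a<N. \<Sum>c<N. \<Sum>d<N. \<Sum>e<N. C i a c * A c a * (C i d e * B e d))"
      by (simp only: sum_distrib_right) (simp only: sum_distrib_left)
    finally show ?thesis by (simp add: mult_ac)
  qed
  have t: "tr N (mmul N A (mmul N P (mmul N B P)))
      = (\<Sum>a<N. \<Sum>c<N. \<Sum>d<N. \<Sum>e<N. A c a * P a d * B d e * P e c)"
    unfolding tr_def mmul_def sum_distrib_left
    by (subst sum.swap) (simp add: mult_ac)
  have r1: "A c a * P a e * B e d * P d c = P a e * P c d * (A c a * B e d)" for a c d e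
    by (simp add: Ps[of d c] mult_ac)
  have r2: "A c a * P a d * B d e * P e c = P a d * P c e * (A c a * B e d)" for a c d e
    by (simp add: Ps[of e c] Bs[of d e] mult_ac)
  have t': "(\<Sum>a<N. \<Sum>c<N. \<Sum>d<N. \<Sum>e<N. A c a * P a d * B d e * P e c)
      = (\<Sum>a<N. \<Sum>c<N. \<Sum>d<N. \<Sum>e<N. P a e * P c d * (A c a * B e d))"
  proof -
    have "(\<Sum>a<N. \<Sum>c<N. \<Sum>d<N. \<Sum>e<N. A c a * P a d * B d e * P e c)
        = (\<Sum>a<N. \<Sum>c<N. \<Sum>d<N. \<Sum>e<N. A c a * P a e * B e d * P d c)"
      by (rule sum.cong[OF refl], rule sum.cong[OF refl], rule sum.swap)
    also have "\<dots> = (\<Sum>a<N. \<Sum>c<N. \<Sum>d<N. \<Sum>e<N. P a e * P c d * (A c a * B e d))"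
      by (intro sum.cong refl) (rule r1)
    finally show ?thesis .
  qed
  have t'': "(\<Sum>a<N. \<Sum>c<N. \<Sum>d<N. \<Sum>e<N. A c a * P a d * B d e * P e c)
      = (\<Sum>a<N. \<Sum>c<N. \<Sum>d<N. \<Sum>e<N. P a d * P c e * (A c a * B e d))"
    by (intro sum.cong refl) (rule r2)
  show ?thesis
    unfolding e1 cov_sum t distrib_right sum.distrib t'[symmetric] t''[symmetric] by simp
qed

text \<open>Here the two pairings differ. The squared trace is of leading order and becomes the
  \<open>v t^2\<close> of the quadratic; the other trace is nonnegative for the resolvent and has
  the favourable sign.\<close>

lemma sum_tr_square:
  assumes "msym A"
  shows "(\<Sum>i\<in>I. tr N (mmul N (C i) (mmul N A (mmul N (C i) A))))
    = v * (tr N (mmul N (mmul N P A) (mmul N P A)) + (tr N (mmul N A P))\<^sup>2)"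
proof -
  have As: "A a c = A c a" and Ps: "P a c = P c a" for a c
    using assms msym_mproj[of N x] unfolding msym_def by blast+
  have r1: "P a d * A d c * P c e * A e a = P a d * P c e * (A c d * A e a)" for a c d e
    by (simp add: As[of d c] mult_ac)
  have r2: "A e a * P a e * (A c d * P d c) = P a e * P c d * (A c d * A e a)" for a c d e
    by (simp add: Ps[of d c] mult_ac)
  have r3: "(\<Sum>e<N. A e a * P a e) * (A c d * P d c) = (\<Sum>e<N. P a e * P c d * (A c d * A e a))" for a c d
  proof -
    have "(\<Sum>e<N. A e a * P a e) * (A c d * P d c) = (\<Sum>e<N. A e a * P a e * (A c d * P d c))"
      by (rule sum_distrib_right)
    then show ?thesis by (simp only: r2)
  qed
  have e1: "tr N (mmul N (C i) (mmul N A (mmul N (C i) A)))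
      = (\<Sum>a<N. \<Sum>c<N. \<Sum>d<N. \<Sum>e<N. C i a c * C i d e * (A c d * A e a))" for i
    by (simp add: tr_def mmul_def sum_distrib_left sum_distrib_right mult_ac)
  have t1: "tr N (mmul N (mmul N P A) (mmul N P A))
      = (\<Sum>a<N. \<Sum>c<N. \<Sum>d<N. \<Sum>e<N. P a d * P c e * (A c d * A e a))"
  proof -
    have "tr N (mmul N (mmul N P A) (mmul N P A))
        = (\<Sum>a<N. \<Sum>d<N. \<Sum>c<N. \<Sum>e<N. P a d * A d c * P c e * A e a)"
      unfolding mmul_assoc
      by (simp add: tr_def mmul_def sum_distrib_left sum_distrib_right mult_ac)
    also have "\<dots> = (\<Sum>a<N. \<Sum>c<N. \<Sum>d<N. \<Sum>e<N. P a d * A d c * P c e * A e a)"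
      by (intro sum.cong refl sum.swap)
    also have "\<dots> = (\<Sum>a<N. \<Sum>c<N. \<Sum>d<N. \<Sum>e<N. P a d * P c e * (A c d * A e a))"
      by (intro sum.cong refl) (rule r1)
    finally show ?thesis .
  qed
  have t2: "(tr N (mmul N A P))\<^sup>2
      = (\<Sum>a<N. \<Sum>c<N. \<Sum>d<N. \<Sum>e<N. P a e * P c d * (A c d * A e a))"
  proof -
    have split: "(\<Sum>a<N. f a) * (\<Sum>c<N. \<Sum>d<N. g c d) = (\<Sum>a<N. \<Sum>c<N. \<Sum>d<N. f a * g c d)"
      for f :: "nat \<Rightarrow> real" and g
      by (simp only: sum_distrib_right) (simp only: sum_distrib_left)
    define Y where "Y = (\<Sum>c<N. \<Sum>d<N. A c d * P d c)"
    have t: "tr N (mmul N A P) = Y" by (simp add: tr_def mmul_def Y_def)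
    have Y': "Y = (\<Sum>a<N. \<Sum>e<N. A e a * P a e)"
      unfolding Y_def by (rule sum.swap)
    have "Y * (\<Sum>c<N. \<Sum>d<N. A c d * P d c)
        = (\<Sum>a<N. \<Sum>c<N. \<Sum>d<N. (\<Sum>e<N. A e a * P a e) * (A c d * P d c))"
      unfolding Y' by (rule split)
    then have "Y * Y = (\<Sum>a<N. \<Sum>c<N. \<Sum>d<N. \<Sum>e<N. P a e * P c d * (A c d * A e a))"
      unfolding Y_def[symmetric] r3 .
    then show ?thesis by (simp only: t power2_eq_square)
  qed
  show ?thesis
    unfolding e1 cov_sum t1 t2 distrib_right sum.distrib by simp
qed

section \<open>The resolvent and the direction \<open>x\<close>\<close>

lemma mv_X: "a < N \<Longrightarrow> mv N (X j) x a = b * x a"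
proof -
  assume a: "a < N"
  have "mv N (X j) x a = b * mv N (idm N) x a + (\<Sum>c<N. \<Sum>i\<in>I. j i * C i a c * x c)"
    by (simp add: mv_def X_def distrib_right sum.distrib sum_distrib_left sum_distrib_right mult.assoc)
  also have "(\<Sum>c<N. \<Sum>i\<in>I. j i * C i a c * x c) = (\<Sum>i\<in>I. j i * mv N (C i) x a)"
    by (subst sum.swap) (simp add: mv_def sum_distrib_left mult.assoc)
  also have "\<dots> = 0" using Cx a by simp
  finally show ?thesis using a by (simp add: mv_idm)
qed

lemma X_mproj_comm: "mmul N (X j) P = mmul N P (X j)"
proof (intro ext)
  fix a c
  have l: "mmul N (X j) P a c = X j a c - (if a < N \<and> c < N then b * x a * x c / real N else 0)" for a c
    using X(1)[of j] mmul_mproj_right[OF X(1), of j x a c] mv_X[of a j]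
    by (cases "a < N") (auto simp: msupp_def mmul_def)
  have "mmul N P (X j) a c = mmul N (X j) P c a"
    by (rule msym_mmul_swap[OF msym_mproj X(2)])
  also have "\<dots> = mmul N (X j) P a c"
    unfolding l using X(2)[of j] by (auto simp: msym_def)
  finally show "mmul N (X j) P a c = mmul N P (X j) a c" by simp
qed

context
  fixes j assumes reg: "mdet N (X j) \<noteq> 0"
begin

abbreviation "G \<equiv> minv N (X j)"

lemma G: "msupp N G" "msym G"
  using msupp_minv msym_minv[OF X reg] by auto

lemma G_mproj_comm: "mmul N G P = mmul N P G"
proof -
  have "mmul N G P = mmul N G (mmul N P (mmul N (X j) G))"
    by (simp add: mmul_minv(1)[OF X(1) reg] mmul_idm_right msupp_mproj)
  also have "\<dots> = mmul N G (mmul N (mmul N (X j) P) G)"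
    by (simp only: X_mproj_comm mmul_assoc)
  also have "\<dots> = mmul N (mmul N G (X j)) (mmul N P G)"
    by (simp only: mmul_assoc)
  also have "\<dots> = mmul N P G"
    by (simp add: mmul_minv(2)[OF X(1) reg] mmul_idm_left msupp_mmul msupp_mproj msupp_minv)
  finally show ?thesis .
qed

lemma mv_G: "a < N \<Longrightarrow> mv N G x a = x a / b"
proof -
  assume a: "a < N"
  have "x a = mv N (mmul N G (X j)) x a"
    using a by (simp add: mmul_minv(2)[OF X(1) reg] mv_idm)
  also have "\<dots> = (\<Sum>c<N. G a c * (b * x c))"
    unfolding mv_mmul by (subst mv_def) (simp add: mv_X)
  also have "\<dots> = b * mv N G x a"
    by (simp add: mv_def sum_distrib_left mult_ac)
  finally show ?thesis using b by (simp add: field_simps)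
qed

text \<open>The direction \<open>x\<close> carries the artificial eigenvalue \<open>1 / b\<close> of
  the inverse. Removing it turns \<open>N - b tr G\<close> into \<open>N - 1 - b t\<close>.\<close>

lemma tr_G_mproj: "tr N (mmul N G P) = tr N G - 1 / b"
proof -
  have "(\<Sum>a<N. mv N G x a * x a) = (\<Sum>a<N. (x a)\<^sup>2) / b"
    by (simp add: mv_G power2_eq_square sum_divide_distrib)
  then show ?thesis
    using N x by (simp add: tr_mmul_mproj[OF G(1)])
qed

text \<open>The factors commute, so their product is symmetric and the trace of its square is a sum
  of squares.\<close>

lemma tr_PGPG_nonneg: "0 \<le> tr N (mmul N (mmul N P G) (mmul N P G))"
proof -
  have "mmul N P G a c = mmul N P G c a" for a c
    using msym_mmul_swap[OF msym_mproj[of N x] G(2), where N = N and a = a and b = c] by (simp add: G_mproj_comm)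
  then have "tr N (mmul N (mmul N P G) (mmul N P G)) = (\<Sum>a<N. \<Sum>c<N. (mmul N P G a c)\<^sup>2)"
    unfolding tr_def mmul_def[of N "mmul N P G"] power2_eq_square by (intro sum.cong refl) simp
  then show ?thesis by (simp add: sum_nonneg)
qed

text \<open>Since \<open>P\<close> commutes with \<open>G\<close>, the trace is that of the even
  power \<open>2 l + 2\<close> of \<open>G\<close> times \<open>P\<close>. Dropping \<open>P\<close>
  only adds the squared norm of \<open>G^(l + 1) x\<close>, divided by \<open>N\<close>.\<close>

lemma tr_power_mproj_le:
  assumes "l > 0"
  shows "tr N (mmul N (mpow N G (Suc (l + l))) (mmul N P (mmul N G P))) \<le> qn N l G ^ (Suc l + Suc l)"
proof -
  let ?H = "mpow N G (Suc l + Suc l)"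
  have "mmul N P (mmul N G P) = mmul N G P"
    by (simp add: G_mproj_comm mmul_assoc[symmetric] mproj_idem[OF x])
  then have "tr N (mmul N (mpow N G (Suc (l + l))) (mmul N P (mmul N G P))) = tr N (mmul N ?H P)"
    by (simp add: mmul_assoc)
  also have "\<dots> = tr N ?H - (\<Sum>a<N. mv N ?H x a * x a) / real N"
    by (rule tr_mmul_mproj[OF msupp_mpow[OF G(1)]])
  also have "(\<Sum>a<N. mv N ?H x a * x a) = (\<Sum>a<N. (mv N (mpow N G (Suc l)) x a)\<^sup>2)"
  proof -
    have "mv N ?H x = mv N (mpow N G (Suc l)) (mv N (mpow N G (Suc l)) x)"
      by (simp only: mv_mmul[symmetric] mpow_add[OF G(1)])
    then show ?thesis
      by (simp add: msym_mv_adjoint[OF msym_mpow[OF G, of "Suc l"]] power2_eq_square del: mpow.simps)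
  qed
  also have "tr N ?H - (\<Sum>a<N. (mv N (mpow N G (Suc l)) x a)\<^sup>2) / real N \<le> tr N ?H"
    by (simp add: sum_nonneg)
  also have "\<dots> \<le> qn N l G ^ (Suc l + Suc l)" by (rule tr_mpow_le_qn[OF G assms])
  finally show ?thesis .
qed

text \<open>Expand \<open>tr (X G) = N\<close> in the couplings; this is the part of the divergence
  identity where \<open>j\<close> multiplies the field.\<close>

lemma sum_j_tr: "(\<Sum>i\<in>I. j i * tr N (mmul N (C i) G)) = real N - b * tr N G"
proof -
  have "real N = tr N (mmul N (X j) G)"
    by (simp add: mmul_minv(1)[OF X(1) reg] tr_def idm_def)
  also have "\<dots> = (\<Sum>a<N. \<Sum>c<N. b * (idm N a c * G c a) + (\<Sum>i\<in>I. j i * (C i a c * G c a)))"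
    by (simp add: tr_def mmul_def X_def distrib_right sum_distrib_right mult.assoc)
  also have "\<dots> = b * tr N (mmul N (idm N) G) + (\<Sum>i\<in>I. j i * tr N (mmul N (C i) G))"
    unfolding tr_def mmul_def sum.distrib sum_distrib_left
    by (simp only: sum.swap[of _ "{..<N}" I])
  finally show ?thesis by (simp add: mmul_idm_left[OF G(1)])
qed

end

text \<open>With \<open>t = tr (P G)\<close> the left-hand side contains \<open>- (N - 1 - b t + v t\<^sup>2)\<close>: the quadratic
  of the semicircle law, which has no real root for \<open>b\<^sup>2 < 4 v (N - 1)\<close>.\<close>

lemma divergence_le:
  assumes l: "l > 0" and s: "s > 0" and m: "m \<le> real N - 1 - b\<^sup>2 / (4 * v)"
  shows "(\<Sum>i\<in>I. field_deriv N l s (C i) (X j)) - (\<Sum>i\<in>I. j i * field_comp N l s (C i) (X j))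
    \<le> barrier N l s (X j) * (2 * v * s * qn N l (minv N (X j)) ^ 3 - m)"
proof (cases "mdet N (X j) = 0")
  case True
  then show ?thesis by (simp add: field_deriv_def field_comp_def barrier_def)
next
  case reg: False
  let ?G = "minv N (X j)"
  let ?q = "qn N l ?G"
  let ?t = "tr N (mmul N ?G P)"
  have q: "?q > 0" by (intro qn_minv_pos N X l reg)
  have G: "msupp N ?G" "msym ?G" by (rule G[OF reg])+
  have s1: "(\<Sum>i\<in>I. tr N (mmul N (mpow N ?G (Suc (l + l))) (C i)) * tr N (mmul N (C i) ?G))
      \<le> 2 * v * ?q ^ (Suc l + Suc l)"
    unfolding sum_tr_tr[OF msym_mpow[OF G] G(2)]
    using tr_power_mproj_le[OF reg l] v by (intro mult_left_mono) auto
  have s2: "(\<Sum>i\<in>I. tr N (mmul N (C i) (mmul N ?G (mmul N (C i) ?G)))) \<ge> v * ?t\<^sup>2"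
    unfolding sum_tr_square[OF G(2)]
    using tr_PGPG_nonneg[OF reg] v by (intro mult_left_mono) auto
  have s3: "(\<Sum>i\<in>I. j i * tr N (mmul N (C i) ?G)) = real N - 1 - b * ?t"
    using b by (simp add: sum_j_tr[OF reg] tr_G_mproj[OF reg] algebra_simps)
  \<comment> \<open>Completing the square at \<open>t = b / (2 v)\<close>: the bound is the maximum
    over all real \<open>t\<close>, so the value of \<open>t\<close> never has to be known.\<close>
  have quad: "- v * ?t\<^sup>2 + b * ?t \<le> b\<^sup>2 / (4 * v)"
  proof -
    have "0 \<le> v * (?t - b / (2 * v))\<^sup>2" using v by simp
    also have "\<dots> = v * ?t\<^sup>2 - b * ?t + b\<^sup>2 / (4 * v)"
      using v by (simp add: power2_eq_square field_simps)
    finally show ?thesis by simp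
  qed
  \<comment> \<open>The origin of the cube: \<open>(2 l + 2) - (2 l - 1) = 3\<close>, whatever
    \<open>l\<close> is.\<close>
  have e1: "?q ^ (Suc l + Suc l) / ?q ^ (l + l - 1) = ?q ^ 3"
  proof -
    have "Suc l + Suc l = (l + l - 1) + 3" using l by simp
    then show ?thesis using q by (simp only: power_add) simp
  qed
  define S1 where "S1 = (\<Sum>i\<in>I. tr N (mmul N (mpow N ?G (Suc (l + l))) (C i)) * tr N (mmul N (C i) ?G))"
  define S2 where "S2 = (\<Sum>i\<in>I. tr N (mmul N (C i) (mmul N ?G (mmul N (C i) ?G))))"
  define Q where "Q = ?q ^ (l + l - 1)"
  have Q: "Q > 0" using q by (simp add: Q_def)
  have "(\<Sum>i\<in>I. field_deriv N l s (C i) (X j)) = (\<Sum>i\<in>I. barrier N l s (X j) *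
      (s / Q * (tr N (mmul N (mpow N ?G (Suc (l + l))) (C i)) * tr N (mmul N (C i) ?G))
       - tr N (mmul N (C i) (mmul N ?G (mmul N (C i) ?G)))))"
    by (intro sum.cong refl) (simp only: field_deriv_def Q_def times_divide_eq_left mult.assoc)
  also have "\<dots> = barrier N l s (X j) * (s / Q * S1 - S2)"
    unfolding S1_def S2_def by (simp only: sum_distrib_left[symmetric] sum_subtractf)
  finally have e2: "(\<Sum>i\<in>I. field_deriv N l s (C i) (X j)) = barrier N l s (X j) * (s / Q * S1 - S2)" .
  have "(\<Sum>i\<in>I. j i * field_comp N l s (C i) (X j))
      = (\<Sum>i\<in>I. barrier N l s (X j) * (j i * tr N (mmul N (C i) ?G)))"
    by (intro sum.cong refl) (simp only: field_comp_def mult.left_commute)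
  also have "\<dots> = barrier N l s (X j) * (real N - 1 - b * ?t)"
    by (simp only: sum_distrib_left[symmetric] s3)
  finally have e3: "(\<Sum>i\<in>I. j i * field_comp N l s (C i) (X j)) = barrier N l s (X j) * (real N - 1 - b * ?t)" .
  have "s / Q * S1 \<le> s / Q * (2 * v * ?q ^ (Suc l + Suc l))"
    using s1 s Q unfolding S1_def by (intro mult_left_mono) auto
  also have "\<dots> = 2 * v * s * (?q ^ (Suc l + Suc l) / Q)" by (simp only: times_divide_eq_left times_divide_eq_right mult_ac)
  also have "\<dots> = 2 * v * s * ?q ^ 3" by (simp only: Q_def e1)
  finally have "s / Q * S1 - S2 - (real N - 1 - b * ?t) \<le> 2 * v * s * ?q ^ 3 - m"
    using s2 quad m unfolding S2_def[symmetric] by linarith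
  then have "barrier N l s (X j) * (s / Q * S1 - S2 - (real N - 1 - b * ?t))
      \<le> barrier N l s (X j) * (2 * v * s * ?q ^ 3 - m)"
    by (intro mult_left_mono barrier_nonneg)
  then show ?thesis
    unfolding e2 e3 right_diff_distrib[symmetric] .
qed

text \<open>Up to the cutoff \<open>2 q0\<close> the cubic term is at most \<open>m / 2\<close> and
  is absorbed. Beyond it, one unit of \<open>s\<close> is set aside so that \<open>exp (- q)\<close>
  controls \<open>q^3\<close>, and the remaining \<open>s - 1\<close> units give the small error.
  The cutoff is \<open>2 q0\<close> rather than \<open>q0\<close> so that the error has twice the
  exponent of the level \<open>exp (- s q0)\<close> used later.\<close>

lemma divergence_split_le:
  assumes l: "l > 0" and s: "s \<ge> 1" and q0: "q0 \<ge> 0" and m: "m \<ge> 0" "4 * v * s * (2 * q0) ^ 3 \<le> m"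
  shows "barrier N l s (X j) * (2 * v * s * qn N l (minv N (X j)) ^ 3 - m)
    \<le> 12 * v * s * exp (- 2 * (s - 1) * q0) - m / 2 * barrier N l s (X j)"
proof (cases "mdet N (X j) = 0")
  case True
  then show ?thesis using v s by (simp add: barrier_def)
next
  case reg: False
  let ?q = "qn N l (minv N (X j))"
  have q: "?q \<ge> 0" by (intro qn_nonneg G[OF reg])
  show ?thesis
  proof (cases "?q \<le> 2 * q0")
    case True
    have "4 * v * s * ?q ^ 3 \<le> 4 * v * s * (2 * q0) ^ 3"
      using True v s q by (intro mult_left_mono power_mono) auto
    then have "2 * v * s * ?q ^ 3 - m \<le> - (m / 2)" using m(2) by linarith
    then have "barrier N l s (X j) * (2 * v * s * ?q ^ 3 - m) \<le> barrier N l s (X j) * (- (m / 2))"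
      by (intro mult_left_mono barrier_nonneg)
    moreover have "0 \<le> 12 * v * s * exp (- 2 * (s - 1) * q0)" using v s by simp
    ultimately show ?thesis by (simp add: algebra_simps)
  next
    case False
    have "?q ^ 3 * barrier N l s (X j) = (?q ^ 3 * exp (- ?q)) * exp (- (s - 1) * ?q)"
    proof -
      have "exp (- s * ?q) = exp (- ?q) * exp (- (s - 1) * ?q)"
        by (subst exp_add[symmetric]) (simp add: left_diff_distrib)
      then show ?thesis using reg by (simp only: barrier_def if_False mult.assoc)
    qed
    also have "\<dots> \<le> fact 3 * exp (- 2 * (s - 1) * q0)"
    proof (intro mult_mono power_exp_le q)
      have "(s - 1) * (2 * q0) \<le> (s - 1) * ?q" using False s by (intro mult_left_mono) auto
      then show "exp (- (s - 1) * ?q) \<le> exp (- 2 * (s - 1) * q0)" by (simp add: algebra_simps)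
    qed auto
    finally have "2 * v * s * (?q ^ 3 * barrier N l s (X j)) \<le> 2 * v * s * (fact 3 * exp (- 2 * (s - 1) * q0))"
      using v s by (intro mult_left_mono) auto
    also have "\<dots> = 12 * v * s * exp (- 2 * (s - 1) * q0)"
      by (simp add: fact_numeral)
    finally have b1: "2 * v * s * (?q ^ 3 * barrier N l s (X j)) \<le> 12 * v * s * exp (- 2 * (s - 1) * q0)" .
    have b2: "m / 2 * barrier N l s (X j) \<le> m * barrier N l s (X j)"
      using m barrier_nonneg by (intro mult_right_mono) auto
    have "barrier N l s (X j) * (2 * v * s * ?q ^ 3 - m)
        = 2 * v * s * (?q ^ 3 * barrier N l s (X j)) - m * barrier N l s (X j)"
      by (simp only: right_diff_distrib mult_ac)
    with b1 b2 show ?thesis by linarith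
  qed
qed

lemma measurable_X:
  "(\<lambda>j. X j a c) \<in> borel_measurable (gaussian_product I)"
proof -
  have "(\<lambda>j. j i) \<in> borel_measurable (gaussian_product I)" if "i \<in> I" for i
    using measurable_component_singleton[OF that, of "\<lambda>_. gaussian"]
    by (simp only: measurable_cong_sets[OF refl sets_gaussian])
  then show ?thesis unfolding X_def by measurable
qed

text \<open>By integration by parts the divergence has mean zero, so the split bound makes the mean
  of the barrier at most a constant times \<open>exp (- 2 (s - 1) q0)\<close>. Markov's inequality
  at level \<open>exp (- s q0)\<close> gives back half of the exponent and keeps the other
  half.\<close>

lemma barrier_prob_le:
  assumes l: "l > 0" and s: "s \<ge> 1" and q0: "q0 \<ge> 0" and m: "m > 0" "4 * v * s * (2 * q0) ^ 3 \<le> m"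
    "m \<le> real N - 1 - b\<^sup>2 / (4 * v)"
  shows "measure (gaussian_product I)
      {j \<in> space (gaussian_product I). exp (- s * q0) \<le> barrier N l s (X j)}
    \<le> 24 * v * s / m * exp (2 * q0) * exp (- s * q0)"
proof -
  let ?P = "gaussian_product I"
  interpret prob_space ?P by (intro prob_space_PiM prob_space_gaussian)
  have s0: "s > 0" using s by simp
  have ibp: "integrable ?P (\<lambda>j. j i * field_comp N l s (C i) (X j))"
      "integrable ?P (\<lambda>j. field_deriv N l s (C i) (X j))"
      "(\<integral>j. j i * field_comp N l s (C i) (X j) \<partial>?P) = (\<integral>j. field_deriv N l s (C i) (X j) \<partial>?P)"
    if i: "i \<in> I" for i
  proof -
    obtain K where K: "\<And>X. msupp N X \<Longrightarrow> msym X \<Longrightarrow> \<bar>field_comp N l s (C i) X\<bar> \<le> K"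
      "\<And>X. msupp N X \<Longrightarrow> msym X \<Longrightarrow> \<bar>field_deriv N l s (C i) X\<bar> \<le> K"
      using field_comp_bounded[OF N l s0] by metis
    have d: "((\<lambda>t. field_comp N l s (C i) (X (j(i := t)))) has_real_derivative
        field_deriv N l s (C i) (X (j(i := t)))) (at t)" for j t
    proof -
      define X0 where "X0 = X (j(i := 0))"
      have "X (j(i := t)) = mline X0 (C i) t" for t
        unfolding X0_def by (rule X_upd[OF i])
      moreover have "msupp N X0" "msym X0" unfolding X0_def by (rule X)+
      ultimately show ?thesis using DERIV_field_comp[OF N l s0 _ _ C[OF i], of X0] by presburger
    qed
    note * = product_gaussian_integration_by_parts[OF I i, of
        "\<lambda>j. field_comp N l s (C i) (X j)" "\<lambda>j. field_deriv N l s (C i) (X j)" K,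
        OF d K(1)[OF X] K(2)[OF X] measurable_field_comp(2,3)[OF measurable_X]]
    show "integrable ?P (\<lambda>j. j i * field_comp N l s (C i) (X j))"
      "integrable ?P (\<lambda>j. field_deriv N l s (C i) (X j))"
      "(\<integral>j. j i * field_comp N l s (C i) (X j) \<partial>?P) = (\<integral>j. field_deriv N l s (C i) (X j) \<partial>?P)"
      by (rule *)+
  qed
  define E where "E = exp (- 2 * (s - 1) * q0)"
  have ib: "integrable ?P (\<lambda>j. barrier N l s (X j))"
    using barrier_le_1[OF X s0] barrier_nonneg measurable_field_comp(1)[OF measurable_X]
    by (intro integrable_const_bound[of _ 1]) auto
  have "0 = (\<integral>j. (\<Sum>i\<in>I. field_deriv N l s (C i) (X j)) - (\<Sum>i\<in>I. j i * field_comp N l s (C i) (X j)) \<partial>?P)"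
  proof -
    have "(\<integral>j. (\<Sum>i\<in>I. field_deriv N l s (C i) (X j)) - (\<Sum>i\<in>I. j i * field_comp N l s (C i) (X j)) \<partial>?P)
        = (\<integral>j. (\<Sum>i\<in>I. field_deriv N l s (C i) (X j)) \<partial>?P) - (\<integral>j. (\<Sum>i\<in>I. j i * field_comp N l s (C i) (X j)) \<partial>?P)"
      by (intro Bochner_Integration.integral_diff Bochner_Integration.integrable_sum ibp)
    also have "(\<integral>j. (\<Sum>i\<in>I. field_deriv N l s (C i) (X j)) \<partial>?P) = (\<Sum>i\<in>I. \<integral>j. field_deriv N l s (C i) (X j) \<partial>?P)"
      by (intro Bochner_Integration.integral_sum ibp)
    also have "(\<integral>j. (\<Sum>i\<in>I. j i * field_comp N l s (C i) (X j)) \<partial>?P) = (\<Sum>i\<in>I. \<integral>j. j i * field_comp N l s (C i) (X j) \<partial>?P)"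
      by (intro Bochner_Integration.integral_sum ibp)
    also have "\<dots> = (\<Sum>i\<in>I. \<integral>j. field_deriv N l s (C i) (X j) \<partial>?P)"
      by (intro sum.cong refl ibp)
    finally show ?thesis by simp
  qed
  also have "\<dots> \<le> (\<integral>j. 12 * v * s * E - m / 2 * barrier N l s (X j) \<partial>?P)"
  proof (rule integral_mono)
    show "integrable ?P (\<lambda>j. (\<Sum>i\<in>I. field_deriv N l s (C i) (X j)) - (\<Sum>i\<in>I. j i * field_comp N l s (C i) (X j)))"
      by (intro Bochner_Integration.integrable_diff Bochner_Integration.integrable_sum ibp)
    show "integrable ?P (\<lambda>j. 12 * v * s * E - m / 2 * barrier N l s (X j))"
      using ib by simp
    show "(\<Sum>i\<in>I. field_deriv N l s (C i) (X j)) - (\<Sum>i\<in>I. j i * field_comp N l s (C i) (X j))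
        \<le> 12 * v * s * E - m / 2 * barrier N l s (X j)" for j
      unfolding E_def using m(1)
      by (intro order.trans[OF divergence_le[OF l s0 m(3)] divergence_split_le[OF l s q0 _ m(2)]]) simp
  qed
  also have "\<dots> = 12 * v * s * E - m / 2 * (\<integral>j. barrier N l s (X j) \<partial>?P)"
    using ib by (simp add: prob_space)
  finally have "(\<integral>j. barrier N l s (X j) \<partial>?P) \<le> 24 * v * s / m * E"
    using m(1) by (simp add: field_simps)
  moreover have "measure ?P {j \<in> space ?P. exp (- s * q0) \<le> barrier N l s (X j)}
      \<le> (\<integral>j. barrier N l s (X j) \<partial>?P) / exp (- s * q0)"
    using integral_Markov_inequality_measure[OF ib sets.top, of "exp (- s * q0)"] barrier_nonneg
    by auto
  ultimately have "measure ?P {j \<in> space ?P. exp (- s * q0) \<le> barrier N l s (X j)}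
      \<le> 24 * v * s / m * E / exp (- s * q0)"
    by (meson divide_right_mono exp_ge_zero order.trans)
  also have "\<dots> = 24 * v * s / m * exp (- 2 * (s - 1) * q0 - - s * q0)"
    by (simp only: E_def exp_diff times_divide_eq_right)
  also have "- 2 * (s - 1) * q0 - - s * q0 = 2 * q0 + - s * q0"
    by (simp add: algebra_simps)
  also have "24 * v * s / m * exp (2 * q0 + - s * q0) = 24 * v * s / m * exp (2 * q0) * exp (- s * q0)"
    by (simp only: exp_add mult.assoc)
  finally show ?thesis .
qed

end

section \<open>Covariance of the tangential Hessian\<close>

text \<open>The ordered pairs of factors hit by two derivatives of a product of \<open>p\<close>
  factors. Their number \<open>p (p - 1)\<close> is the constant in the variance.\<close>

definition slot_pairs :: "nat \<Rightarrow> (nat \<times> nat) set" where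
  "slot_pairs p = {(l, l'). l < p \<and> l' < p \<and> l \<noteq> l'}"

lemma slot_pairs_Sigma: "slot_pairs p = (SIGMA l:{..<p}. {..<p} - {l})"
  by (auto simp: slot_pairs_def)

lemma finite_slot_pairs: "finite (slot_pairs p)"
  unfolding slot_pairs_Sigma by (intro finite_SigmaI) auto

lemma card_slot_pairs: "card (slot_pairs p) = p * (p - 1)"
  unfolding slot_pairs_Sigma by (subst card_SigmaI) auto

lemma prod_two_slots:
  fixes h :: "nat \<Rightarrow> real"
  assumes "(l, l') \<in> slot_pairs p"
  shows "(\<Prod>r<p. if r = l then A r else if r = l' then B r else h r)
    = A l * B l' * (\<Prod>r\<in>{..<p} - {l, l'}. h r)"
proof -
  have l: "l < p" "l' < p" "l \<noteq> l'" using assms by (auto simp: slot_pairs_def)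
  let ?f = "\<lambda>r. if r = l then A r else if r = l' then B r else h r"
  have "(\<Prod>r<p. ?f r) = ?f l * (\<Prod>r\<in>{..<p} - {l}. ?f r)"
    using l by (intro prod.remove) auto
  also have "(\<Prod>r\<in>{..<p} - {l}. ?f r) = ?f l' * (\<Prod>r\<in>{..<p} - {l} - {l'}. ?f r)"
    using l by (intro prod.remove) auto
  also have "(\<Prod>r\<in>{..<p} - {l} - {l'}. ?f r) = (\<Prod>r\<in>{..<p} - {l, l'}. h r)"
    by (intro prod.cong) auto
  finally show ?thesis using l by simp
qed

abbreviation multi_indices :: "nat \<Rightarrow> nat \<Rightarrow> (nat \<Rightarrow> nat) set" where
  "multi_indices p N \<equiv> {..<p} \<rightarrow>\<^sub>E {..<N}"

definition spin_scale :: "nat \<Rightarrow> nat \<Rightarrow> real" where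
  "spin_scale p N = 1 / real N powr ((real p - 1) / 2)"

lemma spin_scale_square: "N > 0 \<Longrightarrow> p \<ge> 1 \<Longrightarrow> (spin_scale p N)\<^sup>2 = 1 / real N ^ (p - 1)"
proof -
  assume a: "N > 0" "p \<ge> 1"
  have "(real N powr ((real p - 1) / 2))\<^sup>2 = real N powr (real p - 1)"
    using a by (simp add: power2_eq_square powr_add[symmetric])
  also have "\<dots> = real N ^ (p - 1)"
    using a by (simp add: powr_realpow[symmetric] of_nat_diff)
  finally show ?thesis by (simp add: spin_scale_def power_divide)
qed

text \<open>The coefficient of a single coupling in the compressed second differential
  \<open>P D^2 H P\<close>: two slots carry the projection, the others are evaluated at
  \<open>x\<close>.\<close>

definition hess_coeff ::
    "nat \<Rightarrow> nat \<Rightarrow> (nat \<Rightarrow> real) \<Rightarrow> (nat \<Rightarrow> nat) \<Rightarrow> nat \<Rightarrow> nat \<Rightarrow> real" where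
  "hess_coeff N p x i a b = spin_scale p N * (\<Sum>z\<in>slot_pairs p.
     mproj N x a (i (fst z)) * mproj N x b (i (snd z)) * (\<Prod>r\<in>{..<p} - {fst z, snd z}. x (i r)))"

lemma msupp_hess_coeff: "msupp N (hess_coeff N p x i)"
  by (auto simp: msupp_def hess_coeff_def mproj_def)

lemma slot_pairs_swap: "bij_betw prod.swap (slot_pairs p) (slot_pairs p)"
  by (rule bij_betwI[where g = prod.swap]) (auto simp: slot_pairs_def)

lemma msym_hess_coeff: "msym (hess_coeff N p x i)"
proof -
  have "hess_coeff N p x i a b = hess_coeff N p x i b a" for a b
    unfolding hess_coeff_def
    by (subst sum.reindex_bij_betw[OF slot_pairs_swap, symmetric]) (simp add: insert_commute mult_ac)
  then show ?thesis unfolding msym_def by blast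
qed

lemma mv_hess_coeff:
  assumes "(\<Sum>a<N. (x a)\<^sup>2) = real N" "i \<in> multi_indices p N"
  shows "mv N (hess_coeff N p x i) x a = 0"
proof -
  let ?R = "\<lambda>z. \<Prod>r\<in>{..<p} - {fst z, snd z}. x (i r)"
  have "mv N (hess_coeff N p x i) x a
      = (\<Sum>b<N. \<Sum>z\<in>slot_pairs p. spin_scale p N * mproj N x a (i (fst z)) * ?R z * (mproj N x b (i (snd z)) * x b))"
    by (simp add: mv_def hess_coeff_def sum_distrib_left sum_distrib_right mult_ac)
  also have "\<dots> = (\<Sum>z\<in>slot_pairs p. spin_scale p N * mproj N x a (i (fst z)) * ?R z * (\<Sum>b<N. mproj N x b (i (snd z)) * x b))"
    by (subst sum.swap) (simp add: sum_distrib_left)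
  also have "\<dots> = 0"
  proof (intro sum.neutral ballI)
    fix z assume "z \<in> slot_pairs p"
    then have "snd z < p" by (auto simp: slot_pairs_def)
    then have "i (snd z) < N" using assms(2) by auto
    then have "(\<Sum>b<N. mproj N x b (i (snd z)) * x b) = 0"
      using mproj_kernel[OF assms(1), of "i (snd z)"] msym_mproj[of N x]
      by (simp add: mv_def msym_def)
    then show "spin_scale p N * mproj N x a (i (fst z)) * ?R z * (\<Sum>b<N. mproj N x b (i (snd z)) * x b) = 0"
      by simp
  qed
  finally show ?thesis .
qed

text \<open>The factor in slot \<open>r\<close> as a function of its index, which absorbs the two
  distinguished slots into one uniform product over all slots.\<close>

definition slot :: "nat \<Rightarrow> (nat \<Rightarrow> real) \<Rightarrow> nat \<Rightarrow> nat \<Rightarrow> nat \<times> nat \<Rightarrow> nat \<Rightarrow> nat \<Rightarrow> real" where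
  "slot N x a b z r n = (if r = fst z then mproj N x a n else if r = snd z then mproj N x b n else x n)"

lemma hess_coeff_slot:
  "hess_coeff N p x i a b = spin_scale p N * (\<Sum>z\<in>slot_pairs p. \<Prod>r<p. slot N x a b z r (i r))"
  unfolding hess_coeff_def
proof (intro arg_cong[of _ _ "(*) _"] sum.cong refl)
  fix z assume z: "z \<in> slot_pairs p"
  show "mproj N x a (i (fst z)) * mproj N x b (i (snd z)) * (\<Prod>r\<in>{..<p} - {fst z, snd z}. x (i r))
      = (\<Prod>r<p. slot N x a b z r (i r))"
    unfolding slot_def using z by (subst prod_two_slots) auto
qed

text \<open>The sum over multi-indices of a product over slots factorises, and a slot carrying \<open>x\<close> on one
  side and a tangential factor on the other contributes zero.\<close>

lemma hess_coeff_cov: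
  assumes x: "(\<Sum>a<N. (x a)\<^sup>2) = real N" and N: "N > 0" and p: "p \<ge> 2"
    and abcd: "a < N" "b < N" "c < N" "d < N"
  shows "(\<Sum>i\<in>multi_indices p N. hess_coeff N p x i a b * hess_coeff N p x i c d)
    = (real (p * (p - 1)) / real N) *
      (mproj N x a c * mproj N x b d + mproj N x a d * mproj N x b c)"
proof -
  let ?P = "mproj N x"
  have PP: "(\<Sum>n<N. ?P a n * ?P c n) = ?P a c" for a c
  proof -
    have "(\<Sum>n<N. ?P a n * ?P c n) = mmul N ?P ?P a c"
      using msym_mproj[of N x] by (simp add: mmul_def msym_def)
    then show ?thesis by (simp add: mproj_idem[OF x])
  qed
  have Px: "(\<Sum>n<N. ?P a n * x n) = 0" if "a < N" for a
    using mproj_kernel[OF x that] by (simp add: mv_def)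
  define T where "T z w = (\<Prod>r<p. \<Sum>n<N. slot N x a b z r n * slot N x c d w r n)" for z w
  have T1: "T z z = ?P a c * ?P b d * real N ^ (p - 2)" if z: "z \<in> slot_pairs p" for z
  proof -
    have "T z z = (\<Prod>r<p. if r = fst z then ?P a c else if r = snd z then ?P b d else real N)"
      unfolding T_def slot_def using PP x
      by (intro prod.cong refl) (auto simp: power2_eq_square)
    also have "\<dots> = ?P a c * ?P b d * (\<Prod>r\<in>{..<p} - {fst z, snd z}. real N)"
      using z by (subst prod_two_slots) auto
    also have "card ({..<p} - {fst z, snd z}) = p - 2"
      using z by (subst card_Diff_subset) (auto simp: slot_pairs_def)
    then have "(\<Prod>r\<in>{..<p} - {fst z, snd z}. real N) = real N ^ (p - 2)" by simp
    finally show ?thesis .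
  qed
  have T2: "T z (prod.swap z) = ?P a d * ?P b c * real N ^ (p - 2)" if z: "z \<in> slot_pairs p" for z
  proof -
    have "fst z \<noteq> snd z" using z by (auto simp: slot_pairs_def)
    then have "T z (prod.swap z) = (\<Prod>r<p. if r = fst z then ?P a d else if r = snd z then ?P b c else real N)"
      unfolding T_def slot_def using PP x
      by (intro prod.cong refl) (auto simp: power2_eq_square)
    also have "\<dots> = ?P a d * ?P b c * (\<Prod>r\<in>{..<p} - {fst z, snd z}. real N)"
      using z by (subst prod_two_slots) auto
    also have "card ({..<p} - {fst z, snd z}) = p - 2"
      using z by (subst card_Diff_subset) (auto simp: slot_pairs_def)
    then have "(\<Prod>r\<in>{..<p} - {fst z, snd z}. real N) = real N ^ (p - 2)" by simp
    finally show ?thesis .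
  qed
  have T0: "T z w = 0" if z: "z \<in> slot_pairs p" and w: "w \<in> slot_pairs p" "w \<noteq> z" "w \<noteq> prod.swap z" for z w
  proof -
    obtain r where r: "r < p" "r = fst z \<or> r = snd z" "r \<noteq> fst w" "r \<noteq> snd w"
    proof -
      have "fst z < p" "snd z < p" "fst z \<noteq> snd z" "fst w \<noteq> snd w"
        using z w by (auto simp: slot_pairs_def)
      moreover have "\<not> (fst w = fst z \<and> snd w = snd z)" "\<not> (fst w = snd z \<and> snd w = fst z)"
        using w by (auto simp: prod_eq_iff)
      ultimately have "(fst z \<noteq> fst w \<and> fst z \<noteq> snd w) \<or> (snd z \<noteq> fst w \<and> snd z \<noteq> snd w)" by metis
      with \<open>fst z < p\<close> \<open>snd z < p\<close> that show thesis by blast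
    qed
    have "(\<Sum>n<N. slot N x a b z r n * slot N x c d w r n) = 0"
      using r Px abcd z by (cases "r = fst z") (auto simp: slot_def slot_pairs_def)
    then show ?thesis unfolding T_def using r(1) by (intro prod_zero) auto
  qed
  have sumT: "(\<Sum>w\<in>slot_pairs p. T z w) = real N ^ (p - 2) * (?P a c * ?P b d + ?P a d * ?P b c)"
    if z: "z \<in> slot_pairs p" for z
  proof -
    have "z \<noteq> prod.swap z" using z by (auto simp: slot_pairs_def)
    have "(\<Sum>w\<in>slot_pairs p. T z w) = (\<Sum>w\<in>{z, prod.swap z}. T z w)"
      using z T0[OF z] by (intro sum.mono_neutral_right finite_slot_pairs) (auto simp: slot_pairs_def)
    also have "\<dots> = T z z + T z (prod.swap z)" using \<open>z \<noteq> prod.swap z\<close> by simp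
    finally show ?thesis by (simp add: T1[OF z] T2[OF z] algebra_simps)
  qed
  have fac: "(\<Sum>i\<in>multi_indices p N. (\<Prod>r<p. slot N x a b z r (i r)) * (\<Prod>r<p. slot N x c d w r (i r))) = T z w"
    for z w
    unfolding T_def by (subst prod_sum_PiE) (auto simp: prod.distrib)
  have "(\<Sum>i\<in>multi_indices p N. hess_coeff N p x i a b * hess_coeff N p x i c d)
      = (\<Sum>i\<in>multi_indices p N. (spin_scale p N)\<^sup>2 * (\<Sum>z\<in>slot_pairs p. \<Sum>w\<in>slot_pairs p.
          (\<Prod>r<p. slot N x a b z r (i r)) * (\<Prod>r<p. slot N x c d w r (i r))))"
    unfolding hess_coeff_slot by (intro sum.cong refl) (simp add: sum_product power2_eq_square mult_ac)
  also have "\<dots> = (spin_scale p N)\<^sup>2 * (\<Sum>i\<in>multi_indices p N. \<Sum>z\<in>slot_pairs p. \<Sum>w\<in>slot_pairs p.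
          (\<Prod>r<p. slot N x a b z r (i r)) * (\<Prod>r<p. slot N x c d w r (i r)))"
    by (rule sum_distrib_left[symmetric])
  also have "\<dots> = (spin_scale p N)\<^sup>2 * (\<Sum>z\<in>slot_pairs p. \<Sum>w\<in>slot_pairs p. T z w)"
    by (simp only: sum.swap[of _ "slot_pairs p" "multi_indices p N"] fac)
  \<comment> \<open>The \<open>p - 2\<close> undifferentiated slots each contribute
    \<open>|x|^2 = N\<close>. Against the normalisation \<open>N^(p - 1)\<close> this leaves one
    factor \<open>1 / N\<close>, the GOE scaling.\<close>
  also have "\<dots> = (1 / real N ^ (p - 1)) * (real (p * (p - 1)) * (real N ^ (p - 2) * (?P a c * ?P b d + ?P a d * ?P b c)))"
    using N p by (simp add: sumT spin_scale_square card_slot_pairs)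
  also have "real N ^ (p - 1) = real N * real N ^ (p - 2)"
  proof -
    have "p - 1 = Suc (p - 2)" using p by simp
    then show ?thesis by (simp only: power_Suc)
  qed
  finally show ?thesis using N by simp
qed

lemma tangent_goe_hess_coeff:
  assumes "(\<Sum>a<N. (x a)\<^sup>2) = real N" "N > 0" "p \<ge> 2" "b \<noteq> 0"
  shows "tangent_goe N (multi_indices p N) (hess_coeff N p x) x (real (p * (p - 1)) / real N) b"
  using assms
  by unfold_locales
    (auto simp: finite_PiE msupp_hess_coeff msym_hess_coeff mv_hess_coeff hess_coeff_cov)

section \<open>Eigenvalues and derivatives of the Hamiltonian\<close>

text \<open>Positive semidefinite and nonsingular implies uniformly positive. Testing the form at
  \<open>v - T v / F\<close> bounds \<open>|T v|^2\<close> by \<open>F\<close> times the form at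
  \<open>v\<close>, and the inverse bounds \<open>v\<close> by \<open>T v\<close>.\<close>

lemma rayleigh_bound:
  assumes T: "msupp N T" "msym T" "mdet N T \<noteq> 0" and psd: "\<And>v. 0 \<le> (\<Sum>a<N. v a * mv N T v a)"
  obtains D where "D > 0" "\<And>v. nrm2 N v \<le> D * (\<Sum>a<N. v a * mv N T v a)"
proof -
  define Q where "Q v = (\<Sum>a<N. v a * mv N T v a)" for v
  \<comment> \<open>One more than the squared Frobenius norm: a positive divisor that still bounds
    the quadratic form by \<open>F |w|^2\<close>.\<close>
  define F where "F = 1 + (\<Sum>a<N. \<Sum>b<N. (T a b)\<^sup>2)"
  define K where "K = (\<Sum>a<N. \<Sum>b<N. (minv N T a b)\<^sup>2)"
  have F: "F \<ge> 1" unfolding F_def by (simp add: sum_nonneg)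
  have K: "K \<ge> 0" unfolding K_def by (simp add: sum_nonneg)
  have QF: "Q w \<le> F * nrm2 N w" for w
  proof -
    have "Q w \<le> (\<Sum>a<N. ((w a)\<^sup>2 + (mv N T w a)\<^sup>2) / 2)"
      unfolding Q_def
    proof (intro sum_mono)
      fix a
      have "0 \<le> (w a - mv N T w a)\<^sup>2" by simp
      then show "w a * mv N T w a \<le> ((w a)\<^sup>2 + (mv N T w a)\<^sup>2) / 2"
        by (simp add: power2_eq_square algebra_simps)
    qed
    also have "\<dots> = (nrm2 N w + nrm2 N (mv N T w)) / 2"
      by (simp add: nrm2_def sum.distrib sum_divide_distrib add_divide_distrib)
    also have "\<dots> \<le> (nrm2 N w + (F - 1) * nrm2 N w) / 2"
      using nrm2_mv_le_frobenius[of N T w] by (simp add: F_def)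
    also have "\<dots> \<le> F * nrm2 N w"
      using F nrm2_nonneg[of N w] by (simp add: algebra_simps)
    finally show ?thesis .
  qed
  have TQ: "nrm2 N (mv N T v) \<le> F * Q v" for v
  proof -
    let ?w = "mv N T v"
    have lin: "mv N T (\<lambda>a. v a - w a / F) = (\<lambda>b. mv N T v b - mv N T w b / F)" for w
      by (simp add: mv_def right_diff_distrib sum_subtractf sum_divide_distrib)
    have "Q (\<lambda>a. v a - ?w a / F)
        = Q v - (\<Sum>a<N. v a * mv N T ?w a) / F - nrm2 N ?w / F + Q ?w / F\<^sup>2"
      unfolding Q_def nrm2_def lin
      by (simp add: sum_subtractf sum.distrib sum_divide_distrib algebra_simps power2_eq_square
          diff_divide_distrib add_divide_distrib)
    also have "(\<Sum>a<N. v a * mv N T ?w a) = nrm2 N ?w"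
      using msym_mv_adjoint[OF T(2), of N v ?w] by (simp add: nrm2_def power2_eq_square)
    also have "Q v - nrm2 N ?w / F - nrm2 N ?w / F + Q ?w / F\<^sup>2 \<le> Q v - nrm2 N ?w / F"
      using QF[of ?w] F by (simp add: field_simps power2_eq_square)
    finally have "0 \<le> Q v - nrm2 N ?w / F" using psd unfolding Q_def by (meson order.trans)
    then show ?thesis using F by (simp add: field_simps)
  qed
  have vT: "nrm2 N v \<le> K * nrm2 N (mv N T v)" for v
  proof -
    have "nrm2 N v = nrm2 N (mv N (minv N T) (mv N T v))"
      by (simp add: mv_mmul[symmetric] mmul_minv(2)[OF T(1,3)] nrm2_mv_idm)
    then show ?thesis using nrm2_mv_le_frobenius[of N "minv N T"] by (simp add: K_def)
  qed
  show thesis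
  proof (rule that[of "K * F + 1"])
    show "K * F + 1 > 0" using K F by (simp add: add_nonneg_pos)
    fix v
    have "nrm2 N v \<le> K * (F * Q v)"
      using vT[of v] mult_left_mono[OF TQ[of v] K] by linarith
    also have "\<dots> \<le> (K * F + 1) * Q v"
      using psd[of v] by (simp add: Q_def algebra_simps)
    finally show "nrm2 N v \<le> (K * F + 1) * (\<Sum>a<N. v a * mv N T v a)" by (simp add: Q_def)
  qed
qed

text \<open>If \<open>\<rho>\<^sup>2\<close> is the infimum of \<open>|Z v|\<^sup>2 / |v|\<^sup>2\<close>, then \<open>Z\<^sup>2 - \<rho>\<^sup>2\<close> is positive semidefinite but
  not bounded below, hence singular, and \<open>\<rho>\<close> or \<open>- \<rho>\<close> is an eigenvalue of \<open>Z\<close>.\<close>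

lemma spectral_gap:
  assumes Z: "msupp N Z" "msym Z" and \<kappa>: "\<kappa> > 0"
    and no: "\<And>\<mu> v. \<bar>\<mu>\<bar> < \<kappa> \<Longrightarrow> nrm2 N v \<noteq> 0 \<Longrightarrow> \<exists>a<N. mv N Z v a \<noteq> \<mu> * v a"
  shows "\<kappa>\<^sup>2 * nrm2 N v \<le> nrm2 N (mv N Z v)"
proof (rule ccontr)
  assume neg: "\<not> \<kappa>\<^sup>2 * nrm2 N v \<le> nrm2 N (mv N Z v)"
  define r where "r v = nrm2 N (mv N Z v) / nrm2 N v" for v
  define S where "S = r ` {v. nrm2 N v \<noteq> 0}"
  define m where "m = Inf S"
  define \<rho> where "\<rho> = sqrt m"
  have v0: "nrm2 N v \<noteq> 0"
    using neg nrm2_nonneg[of N "mv N Z v"] by auto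
  have S0: "S \<noteq> {}" using v0 by (auto simp: S_def)
  have bdd: "bdd_below S"
    by (rule bdd_belowI[of _ 0]) (auto simp: S_def r_def nrm2_nonneg)
  have m0: "m \<ge> 0" unfolding m_def
    by (rule cInf_greatest[OF S0]) (auto simp: S_def r_def nrm2_nonneg)
  have "m \<le> r v" unfolding m_def using v0 bdd by (intro cInf_lower) (auto simp: S_def)
  also have "r v < \<kappa>\<^sup>2"
    using neg v0 nrm2_nonneg[of N v] by (simp add: r_def divide_less_eq)
  finally have \<rho>: "0 \<le> \<rho>" "\<rho> < \<kappa>" "\<rho>\<^sup>2 = m"
    using m0 \<kappa> real_sqrt_less_mono[of m "\<kappa>\<^sup>2"] by (auto simp: \<rho>_def)
  define T where "T = (\<lambda>a b. mmul N Z Z a b - m * idm N a b)"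
  have T: "msupp N T" "msym T"
    using msupp_mmul[OF Z(1) Z(1)] msupp_idm[of N] msym_mmul_swap[OF Z(2) Z(2)]
    by (auto simp: T_def msupp_def msym_def idm_def)
  have Tv: "mv N T u a = mv N Z (mv N Z u) a - m * u a" if "a < N" for u a
  proof -
    have "mv N T u a = mv N (mmul N Z Z) u a - m * mv N (idm N) u a"
      by (simp add: T_def mv_def left_diff_distrib sum_subtractf sum_distrib_left mult.assoc)
    then show ?thesis using that by (simp add: mv_mmul mv_idm)
  qed
  have quad: "(\<Sum>a<N. u a * mv N T u a) = nrm2 N (mv N Z u) - m * nrm2 N u" for u
  proof -
    have "(\<Sum>a<N. u a * mv N T u a) = (\<Sum>a<N. u a * mv N Z (mv N Z u) a) - m * nrm2 N u"
      by (simp add: Tv right_diff_distrib sum_subtractf nrm2_def sum_distrib_left power2_eq_square mult_ac)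
    then show ?thesis
      using msym_mv_adjoint[OF Z(2), of N u "mv N Z u"] by (simp add: nrm2_def power2_eq_square)
  qed
  have low: "m * nrm2 N u \<le> nrm2 N (mv N Z u)" for u
  proof (cases "nrm2 N u = 0")
    case False
    then have "m \<le> r u" unfolding m_def using bdd by (intro cInf_lower) (auto simp: S_def)
    then show ?thesis using False nrm2_nonneg[of N u] by (simp add: r_def le_divide_eq)
  qed (simp add: nrm2_nonneg)
  show False
  proof (cases "mdet N T = 0")
    case False
    then obtain D where D: "D > 0" "\<And>u. nrm2 N u \<le> D * (\<Sum>a<N. u a * mv N T u a)"
      using rayleigh_bound[OF T False] low by (metis quad diff_ge_0_iff_ge)
    have "m + 1 / D \<le> m"
      unfolding m_def
    proof (rule cInf_greatest[OF S0], unfold m_def[symmetric])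
      fix y assume "y \<in> S"
      then obtain u where u: "nrm2 N u \<noteq> 0" "y = r u" by (auto simp: S_def)
      have "nrm2 N u / D \<le> nrm2 N (mv N Z u) - m * nrm2 N u"
        using D(2)[of u] D(1) by (simp add: quad divide_le_eq mult.commute)
      then have "(m + 1 / D) * nrm2 N u \<le> nrm2 N (mv N Z u)" by (simp add: algebra_simps)
      then show "m + 1 / D \<le> y"
        using u nrm2_nonneg[of N u] by (simp add: r_def le_divide_eq)
    qed
    then show False using D(1) by simp
  next
    case True
    then obtain u where u: "nrm2 N u \<noteq> 0" "\<And>a. a < N \<Longrightarrow> mv N T u a = 0"
      using mdet_zero_kernel by blast
    have ZZ: "mv N Z (mv N Z u) a = \<rho>\<^sup>2 * u a" if "a < N" for a
      using u(2)[OF that] Tv[OF that] \<rho>(3) by simp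
    \<comment> \<open>From \<open>(Z - \<rho>) (Z + \<rho>) u = 0\<close>: either
      \<open>w = (Z + \<rho>) u\<close> is an eigenvector for \<open>\<rho>\<close>, or it vanishes
      and \<open>u\<close> is one for \<open>- \<rho>\<close>. Both values lie in the excluded
      interval.\<close>
    define w where "w = (\<lambda>a. mv N Z u a + \<rho> * u a)"
    have Zw: "mv N Z w a = \<rho> * w a" if "a < N" for a
    proof -
      have "mv N Z w a = mv N Z (mv N Z u) a + \<rho> * mv N Z u a"
        by (simp add: w_def mv_def[of N Z "\<lambda>a. mv N Z u a + \<rho> * u a"] distrib_left sum.distrib)
          (simp add: mv_def sum_distrib_left mult_ac)
      then show ?thesis by (simp add: ZZ[OF that] w_def algebra_simps power2_eq_square)
    qed
    show False
    proof (cases "nrm2 N w = 0")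
      case True
      then have "mv N Z u a = - \<rho> * u a" if "a < N" for a
        using that by (auto simp: nrm2_zero_iff w_def add_eq_0_iff)
      then show False using no[of "- \<rho>" u] u(1) \<rho> by auto
    next
      case False
      then show False using no[of \<rho> w] Zw \<rho> by auto
    qed
  qed
qed

section \<open>Euclidean differentials of the Hamiltonian\<close>

definition hess_form ::
    "nat \<Rightarrow> nat \<Rightarrow> ((nat \<Rightarrow> nat) \<Rightarrow> real) \<Rightarrow> (nat \<Rightarrow> real) \<Rightarrow> (nat \<Rightarrow> real) \<Rightarrow> (nat \<Rightarrow> real) \<Rightarrow> real" where
  "hess_form N p j x u w = spin_scale p N * (\<Sum>i\<in>multi_indices p N. j i *
     (\<Sum>z\<in>slot_pairs p. u (i (fst z)) * w (i (snd z)) * (\<Prod>r\<in>{..<p} - {fst z, snd z}. x (i r))))"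

text \<open>The partial derivative in direction \<open>a\<close>: the differentiated slot is
  evaluated at the basis vector \<open>bvec a\<close>.\<close>

definition grad_fun :: "nat \<Rightarrow> nat \<Rightarrow> ((nat \<Rightarrow> nat) \<Rightarrow> real) \<Rightarrow> (nat \<Rightarrow> real) \<Rightarrow> nat \<Rightarrow> real" where
  "grad_fun N p j y a = spin_scale p N * (\<Sum>i\<in>multi_indices p N. j i *
     (\<Sum>l<p. bvec a (i l) * (\<Prod>r\<in>{..<p} - {l}. y (i r))))"

definition ham_fun :: "nat \<Rightarrow> nat \<Rightarrow> ((nat \<Rightarrow> nat) \<Rightarrow> real) \<Rightarrow> (nat \<Rightarrow> real) \<Rightarrow> real" where
  "ham_fun N p j y = spin_scale p N * (\<Sum>i\<in>multi_indices p N. j i * (\<Prod>l<p. y (i l)))"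

lemma hamiltonian_ham_fun: "hamiltonian p j N x = ham_fun N p j (vec_index x)"
  by (simp add: hamiltonian_def ham_fun_def spin_scale_def)

lemma index_PiE: "i \<in> multi_indices p N \<Longrightarrow> l < p \<Longrightarrow> i l < (N :: nat)"
  by auto

lemma ham_fun_cong: "(\<And>n. n < N \<Longrightarrow> y n = y' n) \<Longrightarrow> ham_fun N p j y = ham_fun N p j y'"
  unfolding ham_fun_def by (intro arg_cong[of _ _ "(*) _"] sum.cong prod.cong refl) (auto simp: index_PiE)

lemma grad_fun_cong: "(\<And>n. n < N \<Longrightarrow> y n = y' n) \<Longrightarrow> grad_fun N p j y a = grad_fun N p j y' a"
  unfolding grad_fun_def
  by (intro arg_cong[of _ _ "(*) _"] sum.cong prod.cong refl) (auto simp: index_PiE)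

lemma sum_bvec: "n < N \<Longrightarrow> (\<Sum>a<N. u a * bvec a n) = u n"
  by (auto simp: bvec_def if_distrib[of "(*) _"] cong: if_cong)

lemma hess_form_linear_left:
  assumes "\<And>n. n < N \<Longrightarrow> u n = (\<Sum>b\<in>S. c b * e b n)"
  shows "hess_form N p j x u w = (\<Sum>b\<in>S. c b * hess_form N p j x (e b) w)"
proof -
  let ?R = "\<lambda>i z. \<Prod>r\<in>{..<p} - {fst z, snd z}. x (i r)"
  have "hess_form N p j x u w = spin_scale p N * (\<Sum>i\<in>multi_indices p N. j i *
     (\<Sum>z\<in>slot_pairs p. (\<Sum>b\<in>S. c b * e b (i (fst z))) * w (i (snd z)) * ?R i z))"
    unfolding hess_form_def using assms
    by (intro arg_cong[of _ _ "(*) _"] sum.cong refl)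
      (auto simp: slot_pairs_def intro!: sum.cong dest: index_PiE)
  also have "\<dots> = (\<Sum>i\<in>multi_indices p N. \<Sum>z\<in>slot_pairs p. \<Sum>b\<in>S.
      c b * (spin_scale p N * (j i * (e b (i (fst z)) * w (i (snd z)) * ?R i z))))"
    by (simp add: sum_distrib_left sum_distrib_right mult_ac)
  also have "\<dots> = (\<Sum>b\<in>S. \<Sum>i\<in>multi_indices p N. \<Sum>z\<in>slot_pairs p.
      c b * (spin_scale p N * (j i * (e b (i (fst z)) * w (i (snd z)) * ?R i z))))"
    by (subst sum.swap[of _ S], subst sum.swap[of _ S "multi_indices p N"]) (rule refl)
  also have "\<dots> = (\<Sum>b\<in>S. c b * hess_form N p j x (e b) w)"
    by (simp add: hess_form_def sum_distrib_left)
  finally show ?thesis .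
qed

lemma hess_form_sym: "hess_form N p j x u w = hess_form N p j x w u"
proof -
  have "(\<Sum>z\<in>slot_pairs p. u (i (fst z)) * w (i (snd z)) * (\<Prod>r\<in>{..<p} - {fst z, snd z}. x (i r)))
      = (\<Sum>z\<in>slot_pairs p. w (i (fst z)) * u (i (snd z)) * (\<Prod>r\<in>{..<p} - {fst z, snd z}. x (i r)))" for i
    by (subst sum.reindex_bij_betw[OF slot_pairs_swap, symmetric]) (simp add: insert_commute mult_ac)
  then show ?thesis by (simp add: hess_form_def)
qed

lemma hess_form_linear_right:
  assumes "\<And>n. n < N \<Longrightarrow> w n = (\<Sum>b\<in>S. c b * e b n)"
  shows "hess_form N p j x u w = (\<Sum>b\<in>S. c b * hess_form N p j x u (e b))"
  using hess_form_linear_left[OF assms] by (simp add: hess_form_sym[of _ _ _ _ u])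

text \<open>The compression of the second differential to the tangent space, kept of size
  \<open>N\<close> with \<open>x\<close> in its kernel. The probabilistic part and the comparison of
  nearby points thus avoid frames that vary with the point.\<close>

definition hess_mat :: "nat \<Rightarrow> nat \<Rightarrow> ((nat \<Rightarrow> nat) \<Rightarrow> real) \<Rightarrow> (nat \<Rightarrow> real) \<Rightarrow> nat \<Rightarrow> nat \<Rightarrow> real" where
  "hess_mat N p j x a b = (\<Sum>i\<in>multi_indices p N. j i * hess_coeff N p x i a b)"

lemma hess_mat_hess_form: "hess_mat N p j x a b = hess_form N p j x (mproj N x a) (mproj N x b)"
  by (simp add: hess_mat_def hess_form_def hess_coeff_def sum_distrib_left mult_ac)

lemma mproj_tangent:
  assumes "(\<Sum>a<N. u a * x a) = 0" "n < N"
  shows "(\<Sum>b<N. u b * mproj N x b n) = u n"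
proof -
  have "(\<Sum>b<N. u b * mproj N x b n) = (\<Sum>b<N. u b * idm N b n - u b * x b * x n / real N)"
    using assms(2) by (intro sum.cong refl) (simp add: mproj_def algebra_simps)
  also have "\<dots> = (\<Sum>b<N. u b * bvec b n) - (\<Sum>b<N. u b * x b) * x n / real N"
    using assms(2)
    by (simp add: sum_subtractf sum_distrib_right sum_divide_distrib bvec_def idm_def eq_commute cong: if_cong)
  finally show ?thesis using assms by (simp add: sum_bvec)
qed

text \<open>The projections inside \<open>hess_mat\<close> fix tangent vectors, so the compression
  is invisible to them.\<close>

lemma hess_mat_form:
  assumes u: "(\<Sum>a<N. u a * x a) = 0" and w: "(\<Sum>a<N. w a * x a) = 0"
  shows "(\<Sum>a<N. u a * mv N (hess_mat N p j x) w a) = hess_form N p j x u w"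
proof -
  have "mv N (hess_mat N p j x) w a = hess_form N p j x (mproj N x a) w" for a
    using hess_form_linear_right[of N w w "mproj N x" "{..<N}"] mproj_tangent[OF w]
    by (simp add: mv_def hess_mat_hess_form mult.commute)
  then show ?thesis
    using hess_form_linear_left[of N u u "mproj N x" "{..<N}"] mproj_tangent[OF u] by simp
qed

lemma DERIV_line_prod:
  "((\<lambda>t. \<Prod>r\<in>S. (y (i r) + t * u (i r) :: real)) has_real_derivative
    (\<Sum>l\<in>S. u (i l) * (\<Prod>r\<in>S - {l}. y (i r) + t * u (i r)))) (at t)"
  by (rule has_field_derivative_prod) (auto intro!: derivative_eq_intros)

lemma DERIV_ham_fun:
  "((\<lambda>t. ham_fun N p j (\<lambda>n. y n + t * u n)) has_real_derivative
    (\<Sum>a<N. u a * grad_fun N p j (\<lambda>n. y n + t * u n) a)) (at t)"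
proof -
  let ?y = "\<lambda>n. y n + t * u n"
  have "((\<lambda>t. ham_fun N p j (\<lambda>n. y n + t * u n)) has_real_derivative
      spin_scale p N * (\<Sum>i\<in>multi_indices p N. j i * (\<Sum>l<p. u (i l) * (\<Prod>r\<in>{..<p} - {l}. ?y (i r))))) (at t)"
    unfolding ham_fun_def by (intro DERIV_cmult DERIV_sum DERIV_line_prod)
  also have "spin_scale p N * (\<Sum>i\<in>multi_indices p N. j i * (\<Sum>l<p. u (i l) * (\<Prod>r\<in>{..<p} - {l}. ?y (i r))))
      = spin_scale p N * (\<Sum>i\<in>multi_indices p N. j i * (\<Sum>l<p. (\<Sum>a<N. u a * bvec a (i l)) * (\<Prod>r\<in>{..<p} - {l}. ?y (i r))))"
    by (intro arg_cong[of _ _ "(*) _"] sum.cong refl)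
      (auto simp: sum_bvec index_PiE intro!: sum.cong)
  also have "\<dots> = (\<Sum>i\<in>multi_indices p N. \<Sum>l<p. \<Sum>a<N. u a * (spin_scale p N * (j i * (bvec a (i l) * (\<Prod>r\<in>{..<p} - {l}. ?y (i r))))))"
    by (simp add: sum_distrib_left sum_distrib_right mult_ac)
  also have "\<dots> = (\<Sum>a<N. \<Sum>i\<in>multi_indices p N. \<Sum>l<p. u a * (spin_scale p N * (j i * (bvec a (i l) * (\<Prod>r\<in>{..<p} - {l}. ?y (i r))))))"
    by (subst sum.swap[of _ "{..<N}"], subst sum.swap[of _ "{..<N}" "multi_indices p N"]) (rule refl)
  also have "\<dots> = (\<Sum>a<N. u a * grad_fun N p j ?y a)"
    by (simp add: grad_fun_def sum_distrib_left)
  finally show ?thesis .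
qed

lemma DERIV_grad_fun:
  "((\<lambda>t. grad_fun N p j (\<lambda>n. y n + t * u n) a) has_real_derivative
    hess_form N p j (\<lambda>n. y n + t * u n) (bvec a) u) (at t)"
proof -
  let ?y = "\<lambda>n. y n + t * u n"
  have "((\<lambda>t. grad_fun N p j (\<lambda>n. y n + t * u n) a) has_real_derivative
      spin_scale p N * (\<Sum>i\<in>multi_indices p N. j i * (\<Sum>l<p. bvec a (i l) *
        (\<Sum>l'\<in>{..<p} - {l}. u (i l') * (\<Prod>r\<in>{..<p} - {l} - {l'}. ?y (i r)))))) (at t)"
    unfolding grad_fun_def by (intro DERIV_cmult DERIV_sum DERIV_line_prod)
  moreover have "(\<Sum>l<p. bvec a (i l) *
        (\<Sum>l'\<in>{..<p} - {l}. u (i l') * (\<Prod>r\<in>{..<p} - {l} - {l'}. ?y (i r))))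
      = (\<Sum>z\<in>slot_pairs p. bvec a (i (fst z)) * u (i (snd z)) *
          (\<Prod>r\<in>{..<p} - {fst z, snd z}. ?y (i r)))" for i
    unfolding slot_pairs_Sigma
    by (simp add: sum.Sigma sum_distrib_left mult.assoc case_prod_unfold
        Diff_insert2[symmetric] insert_commute)
  ultimately show ?thesis by (simp only: hess_form_def)
qed

text \<open>Euler's identity, by differentiating \<open>H (t y) = t^p H y\<close> at
  \<open>t = 1\<close>. It gives the radial part of the gradient and is the source of the shift
  \<open>p H / N\<close>.\<close>

lemma euler_grad_fun: "(\<Sum>a<N. y a * grad_fun N p j y a) = real p * ham_fun N p j y"
proof -
  have "((\<lambda>t. ham_fun N p j (\<lambda>n. 0 + t * y n)) has_real_derivative
      (\<Sum>a<N. y a * grad_fun N p j (\<lambda>n. 0 + 1 * y n) a)) (at 1)"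
    by (rule DERIV_ham_fun)
  moreover have "ham_fun N p j (\<lambda>n. 0 + t * y n) = t ^ p * ham_fun N p j y" for t
    by (simp add: ham_fun_def prod.distrib sum_distrib_left mult_ac)
  moreover have "((\<lambda>t. t ^ p * ham_fun N p j y) has_real_derivative real p * ham_fun N p j y) (at 1)"
    by (auto intro!: derivative_eq_intros)
  ultimately show ?thesis using DERIV_unique by force
qed

section \<open>Gradient and covariant Hessian on the sphere\<close>

no_notation vec_nth (infixl \<open>$\<close> 90)
no_notation inner (infix \<open>\<bullet>\<close> 70)

lemma vec_sphere_nrm2:
  assumes "x \<in> vec_sphere N (sqrt (real N))"
  shows "dim_vec x = N" "(\<Sum>a<N. (vec_index x a)\<^sup>2) = real N"
  using assms by (auto simp: vec_sphere_def scalar_prod_def lessThan_atLeast0 power2_eq_square)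

lemma index_add_smult:
  assumes "dim_vec u = N" "n < N"
  shows "(y + t \<cdot>\<^sub>v u) $ n = y $ n + t * u $ n"
  using assms by simp

lemma dir_deriv_hamiltonian:
  assumes "dim_vec u = N"
  shows "dir_deriv (hamiltonian p j N) y u = (\<Sum>a<N. u $ a * grad_fun N p j (vec_index y) a)"
proof -
  have "(\<lambda>t. hamiltonian p j N (y + t \<cdot>\<^sub>v u)) = (\<lambda>t. ham_fun N p j (\<lambda>n. y $ n + t * u $ n))"
    unfolding hamiltonian_ham_fun by (intro ext ham_fun_cong) (simp add: index_add_smult[OF assms])
  then show ?thesis
    unfolding dir_deriv_def
    using DERIV_imp_deriv[OF DERIV_ham_fun[of N p j "vec_index y" "vec_index u" 0]] by simp
qed

lemma eucl_grad_hamiltonian: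
  assumes "dim_vec y = N"
  shows "eucl_grad (hamiltonian p j N) y = vec N (grad_fun N p j (vec_index y))"
proof -
  have "(\<Sum>b<N. unit_vec N a $ b * grad_fun N p j (vec_index y) b) = grad_fun N p j (vec_index y) a"
    if "a < N" for a
  proof -
    have "(\<Sum>b<N. unit_vec N a $ b * grad_fun N p j (vec_index y) b)
        = (\<Sum>b<N. if b = a then grad_fun N p j (vec_index y) a else 0)"
      using that by (intro sum.cong) (auto simp: unit_vec_def)
    then show ?thesis using that by simp
  qed
  then show ?thesis
    unfolding eucl_grad_def assms by (intro eq_vecI) (auto simp: dir_deriv_hamiltonian)
qed

text \<open>Needed off the sphere as well, because covariant differentiation proceeds along straight
  lines that leave it; hence \<open>|y|^2\<close> in the denominator instead of
  \<open>N\<close>.\<close>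

lemma sphere_grad_hamiltonian:
  assumes "dim_vec y = N" "a < N"
  shows "sphere_grad (hamiltonian p j N) y $ a
    = grad_fun N p j (vec_index y) a
      - real p * ham_fun N p j (vec_index y) / nrm2 N (vec_index y) * y $ a"
proof -
  have "vec N (grad_fun N p j (vec_index y)) \<bullet> y = real p * ham_fun N p j (vec_index y)"
    using assms euler_grad_fun[where N = N and p = p and j = j and y = "vec_index y"]
    by (simp add: scalar_prod_def lessThan_atLeast0 mult.commute)
  moreover have "y \<bullet> y = nrm2 N (vec_index y)"
    using assms by (simp add: scalar_prod_def nrm2_def lessThan_atLeast0 power2_eq_square)
  ultimately show ?thesis
    using assms by (simp add: sphere_grad_def tangent_proj_def eucl_grad_hamiltonian)
qed

lemma nrm2_line:
  "nrm2 N (\<lambda>n. y n + t * u n) = nrm2 N y + 2 * t * (\<Sum>n<N. y n * u n) + t\<^sup>2 * nrm2 N u"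
  unfolding nrm2_def
  by (simp add: power2_eq_square algebra_simps sum.distrib sum_distrib_left)

text \<open>For tangent \<open>u\<close> one has \<open>|x + t u|^2 = N + t^2 |u|^2\<close>, so the
  denominator has derivative 0 at \<open>t = 0\<close>. Only the value and the moving point in the
  radial term are differentiated.\<close>

lemma dir_deriv_sphere_grad:
  assumes x: "x \<in> vec_sphere N (sqrt (real N))" and N: "N > 0"
    and u: "dim_vec u = N" "(\<Sum>n<N. x $ n * u $ n) = 0" and a: "a < N"
  shows "dir_deriv (\<lambda>y. sphere_grad (hamiltonian p j N) y $ a) x u
    = hess_form N p j (vec_index x) (bvec a) (vec_index u)
      - real p * dir_deriv (hamiltonian p j N) x u / real N * x $ a
      - real p * hamiltonian p j N x / real N * u $ a"
proof -
  let ?x = "vec_index x" and ?u = "vec_index u"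
  let ?y = "\<lambda>t n. x $ n + t * u $ n"
  let ?D = "dir_deriv (hamiltonian p j N) x u"
  note dx = vec_sphere_nrm2[OF x]
  have eq: "(\<lambda>t. sphere_grad (hamiltonian p j N) (x + t \<cdot>\<^sub>v u) $ a)
    = (\<lambda>t. grad_fun N p j (?y t) a - real p * ham_fun N p j (?y t) / (real N + t\<^sup>2 * nrm2 N ?u) * ?y t a)"
  proof
    fix t
    have d: "dim_vec (x + t \<cdot>\<^sub>v u) = N" using u(1) by simp
    have "ham_fun N p j (vec_index (x + t \<cdot>\<^sub>v u)) = ham_fun N p j (?y t)"
      by (intro ham_fun_cong) (simp add: index_add_smult[OF u(1)])
    moreover have "grad_fun N p j (vec_index (x + t \<cdot>\<^sub>v u)) a = grad_fun N p j (?y t) a"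
      by (intro grad_fun_cong) (simp add: index_add_smult[OF u(1)])
    moreover have "nrm2 N (vec_index (x + t \<cdot>\<^sub>v u)) = real N + t\<^sup>2 * nrm2 N ?u"
    proof -
      have "nrm2 N (vec_index (x + t \<cdot>\<^sub>v u)) = nrm2 N (?y t)"
        by (intro nrm2_cong) (simp add: index_add_smult[OF u(1)])
      also have "\<dots> = real N + t\<^sup>2 * nrm2 N ?u"
        using dx(2) u(2) by (simp only: nrm2_line) (simp add: nrm2_def)
      finally show ?thesis .
    qed
    ultimately show "sphere_grad (hamiltonian p j N) (x + t \<cdot>\<^sub>v u) $ a
      = grad_fun N p j (?y t) a - real p * ham_fun N p j (?y t) / (real N + t\<^sup>2 * nrm2 N ?u) * ?y t a"
      using sphere_grad_hamiltonian[OF d a] a u(1) by simp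
  qed
  have dH: "((\<lambda>t. ham_fun N p j (?y t)) has_real_derivative ?D) (at 0)"
    using DERIV_ham_fun[of N p j ?x ?u 0] dir_deriv_hamiltonian[OF u(1), of p j x] by simp
  have dG: "((\<lambda>t. grad_fun N p j (?y t) a) has_real_derivative hess_form N p j ?x (bvec a) ?u) (at 0)"
    using DERIV_grad_fun[of N p j ?x ?u a 0] by simp
  have dN: "((\<lambda>t. real N + t\<^sup>2 * nrm2 N ?u) has_real_derivative 0) (at 0)"
    by (auto intro!: derivative_eq_intros)
  have dy: "((\<lambda>t. ?y t a) has_real_derivative u $ a) (at 0)"
    by (auto intro!: derivative_eq_intros)
  have dq: "((\<lambda>t. ham_fun N p j (?y t) / (real N + t\<^sup>2 * nrm2 N ?u)) has_real_derivative ?D / real N) (at 0)"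
    using DERIV_divide[OF dH dN] N by simp
  have "((\<lambda>t. grad_fun N p j (?y t) a - real p * (ham_fun N p j (?y t) / (real N + t\<^sup>2 * nrm2 N ?u)) * ?y t a)
     has_real_derivative
      (hess_form N p j ?x (bvec a) ?u - (real p * (?D / real N) * ?y 0 a
        + u $ a * (real p * (ham_fun N p j (?y 0) / (real N + 0\<^sup>2 * nrm2 N ?u)))))) (at 0)"
    by (intro DERIV_diff dG DERIV_mult DERIV_cmult dq dy)
  then have "deriv (\<lambda>t. grad_fun N p j (?y t) a - real p * (ham_fun N p j (?y t) / (real N + t\<^sup>2 * nrm2 N ?u)) * ?y t a) 0
      = hess_form N p j ?x (bvec a) ?u - real p * ?D / real N * x $ a
        - real p * hamiltonian p j N x / real N * u $ a"
    by (simp add: DERIV_imp_deriv hamiltonian_ham_fun mult_ac)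
  then show ?thesis
    unfolding dir_deriv_def[of "\<lambda>y. sphere_grad (hamiltonian p j N) y $ a"] eq by simp
qed

text \<open>Pairing with a tangent \<open>w\<close> kills the outer projection and the term with the
  derivative of \<open>H\<close>, both multiples of \<open>x\<close>. The curvature of the sphere
  survives as the multiple \<open>p H / N\<close> of the metric.\<close>

lemma sphere_hess_hamiltonian:
  assumes x: "x \<in> vec_sphere N (sqrt (real N))" and N: "N > 0"
    and u: "dim_vec u = N" "(\<Sum>n<N. x $ n * u $ n) = 0"
    and w: "dim_vec w = N" "(\<Sum>n<N. x $ n * w $ n) = 0"
  shows "sphere_hess (hamiltonian p j N) x u w
    = hess_form N p j (vec_index x) (vec_index w) (vec_index u)
      - real p * hamiltonian p j N x / real N * (\<Sum>n<N. u $ n * w $ n)"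
proof -
  note dx = vec_sphere_nrm2[OF x]
  define W where "W = vec N (\<lambda>i. dir_deriv (\<lambda>y. sphere_grad (hamiltonian p j N) y $ i) x u)"
  have W: "dim_vec W = N" by (simp add: W_def)
  let ?D = "real p * dir_deriv (hamiltonian p j N) x u / real N"
  let ?h = "real p * hamiltonian p j N x / real N"
  have "sphere_hess (hamiltonian p j N) x u w = (\<Sum>n<N. tangent_proj x W $ n * w $ n)"
    using w(1) by (simp add: sphere_hess_def cov_deriv_def W_def dx(1) scalar_prod_def lessThan_atLeast0)
  also have "\<dots> = (\<Sum>n<N. W $ n * w $ n - (W \<bullet> x / (x \<bullet> x)) * (x $ n * w $ n))"
    using W dx(1) by (intro sum.cong refl) (simp add: tangent_proj_def algebra_simps)
  also have "\<dots> = (\<Sum>n<N. W $ n * w $ n)"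
    by (simp only: sum_subtractf sum_distrib_left[symmetric] w(2) mult_zero_right diff_zero)
  also have "\<dots> = (\<Sum>n<N. w $ n * hess_form N p j (vec_index x) (bvec n) (vec_index u)
      - ?D * (x $ n * w $ n) - ?h * (u $ n * w $ n))"
    by (intro sum.cong refl) (simp add: W_def dir_deriv_sphere_grad[OF x N u] algebra_simps)
  also have "\<dots> = (\<Sum>n<N. w $ n * hess_form N p j (vec_index x) (bvec n) (vec_index u))
      - ?D * (\<Sum>n<N. x $ n * w $ n) - ?h * (\<Sum>n<N. u $ n * w $ n)"
    by (simp only: sum_subtractf sum_distrib_left)
  also have "(\<Sum>n<N. w $ n * hess_form N p j (vec_index x) (bvec n) (vec_index u))
      = hess_form N p j (vec_index x) (vec_index w) (vec_index u)"
    by (rule hess_form_linear_left[symmetric]) (simp add: sum_bvec)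
  finally show ?thesis using w(2) by simp
qed

lemma msupp_hess_mat: "msupp N (hess_mat N p j x)"
  using msupp_hess_coeff[of N p x] by (auto simp: hess_mat_def msupp_def)

lemma msym_hess_mat: "msym (hess_mat N p j x)"
  using msym_hess_coeff[of N p x] by (auto simp: hess_mat_def msym_def intro!: sum.cong)

lemma mv_hess_mat:
  assumes "(\<Sum>a<N. (x a)\<^sup>2) = real N" "a < N"
  shows "mv N (hess_mat N p j x) x a = 0"
proof -
  have "mv N (hess_mat N p j x) x a = (\<Sum>b<N. \<Sum>i\<in>multi_indices p N. j i * (hess_coeff N p x i a b * x b))"
    by (simp add: mv_def hess_mat_def sum_distrib_right mult.assoc)
  also have "\<dots> = (\<Sum>i\<in>multi_indices p N. j i * mv N (hess_coeff N p x i) x a)"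
    by (subst sum.swap) (simp add: mv_def sum_distrib_left)
  also have "\<dots> = 0" using mv_hess_coeff[OF assms(1)] by simp
  finally show ?thesis .
qed

section \<open>Frames, eigenvalues and the index\<close>

lemma tangent_frameD:
  assumes x: "x \<in> vec_sphere N (sqrt (real N))" and e: "tangent_frame x e" and a: "a < N - 1"
  shows "dim_vec (e a) = N" "(\<Sum>n<N. e a $ n * x $ n) = 0"
    and "b < N - 1 \<Longrightarrow> (\<Sum>n<N. e a $ n * e b $ n) = (if a = b then 1 else 0)"
proof -
  note dx = vec_sphere_nrm2[OF x]
  have d: "dim_vec (e c) = N" if "c < N - 1" for c
    using e that dx(1) by (auto simp: tangent_frame_def)
  then show "dim_vec (e a) = N" using a by simp
  show "(\<Sum>n<N. e a $ n * x $ n) = 0"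
    using e a dx(1) by (auto simp: tangent_frame_def scalar_prod_def lessThan_atLeast0)
  assume b: "b < N - 1"
  have "scalar_prod (e a) (e b) = (if a = b then 1 else 0)"
    using e a b dx(1) unfolding tangent_frame_def by blast
  then show "(\<Sum>n<N. e a $ n * e b $ n) = (if a = b then 1 else 0)"
    using d[OF b] by (simp add: scalar_prod_def lessThan_atLeast0)
qed

text \<open>Adjoining \<open>x / sqrt N\<close> gives a square matrix with orthonormal rows. A
  one-sided inverse of a square matrix is two-sided, so the columns are orthonormal too, which is
  completeness; the coefficient along \<open>x\<close> drops out.\<close>

lemma tangent_frame_complete:
  assumes x: "x \<in> vec_sphere N (sqrt (real N))" and N: "N > 0" and e: "tangent_frame x e"
    and v: "(\<Sum>n<N. v n * x $ n) = 0" and n: "n < N"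
  shows "v n = (\<Sum>a<N - 1. (\<Sum>m<N. e a $ m * v m) * e a $ n)"
proof -
  note dx = vec_sphere_nrm2[OF x]
  note ed = tangent_frameD(1)[OF x e] and ex = tangent_frameD(2)[OF x e]
    and ee = tangent_frameD(3)[OF x e]
  define E where "E a m = (if a < N - 1 then e a $ m else x $ m / sqrt (real N))" for a m
  have orth: "(\<Sum>m<N. E a m * E b m) = (if a = b then 1 else 0)" if "a < N" "b < N" for a b
  proof -
    have xe: "(\<Sum>m<N. x $ m * e c $ m) = 0" if "c < N - 1" for c
      using ex[OF that] by (simp add: mult.commute)
    have "(\<Sum>m<N. x $ m / sqrt (real N) * (x $ m / sqrt (real N))) = 1"
    proof -
      have "(\<Sum>m<N. x $ m / sqrt (real N) * (x $ m / sqrt (real N))) = (\<Sum>m<N. (x $ m)\<^sup>2) / real N"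
        by (simp add: power2_eq_square sum_divide_distrib)
      then show ?thesis using dx(2) N by simp
    qed
    moreover have "(\<Sum>m<N. e c $ m * (x $ m / sqrt (real N))) = 0"
      "(\<Sum>m<N. x $ m / sqrt (real N) * e c $ m) = 0" if "c < N - 1" for c
      using ex[OF that] xe[OF that] by (simp_all add: sum_divide_distrib[symmetric])
    moreover have "a = N - 1" if "\<not> a < N - 1" using that \<open>a < N\<close> by simp
    moreover have "b = N - 1" if "\<not> b < N - 1" using that \<open>b < N\<close> by simp
    ultimately show ?thesis
      using ee[of a b] by (cases "a < N - 1"; cases "b < N - 1") (simp_all add: E_def)
  qed
  let ?E = "mat N N (\<lambda>(a, m). E a m)" and ?F = "mat N N (\<lambda>(m, a). E a m)"
  have "?E * ?F = 1\<^sub>m N"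
    by (intro eq_matI) (auto simp: scalar_prod_def lessThan_atLeast0[symmetric] orth)
  then have FE: "?F * ?E = 1\<^sub>m N"
    by (intro mat_mult_left_right_inverse[of ?E N ?F]) auto
  have comp: "(\<Sum>a<N. E a n * E a m) = (if n = m then 1 else 0)" if "m < N" for m
  proof -
    have "(?F * ?E) $$ (n, m) = (if n = m then 1 else 0)" unfolding FE using n that by simp
    then show ?thesis using n that by (simp add: scalar_prod_def lessThan_atLeast0[symmetric])
  qed
  have "(\<Sum>m<N. (if n = m then 1 else 0) * v m) = (\<Sum>m<N. if m = n then v n else 0)"
    by (intro sum.cong) auto
  then have "v n = (\<Sum>m<N. (if n = m then 1 else 0) * v m)" using n by simp
  also have "\<dots> = (\<Sum>m<N. (\<Sum>a<N. E a n * E a m) * v m)"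
    by (intro sum.cong refl) (simp add: comp)
  also have "\<dots> = (\<Sum>m<N. \<Sum>a<N. E a m * v m * E a n)"
    by (simp add: sum_distrib_left sum_distrib_right mult_ac)
  also have "\<dots> = (\<Sum>a<N. (\<Sum>m<N. E a m * v m) * E a n)"
    by (subst sum.swap) (simp add: sum_distrib_right)
  also have "\<dots> = (\<Sum>a<N - 1. (\<Sum>m<N. E a m * v m) * E a n)"
  proof -
    obtain N' where N': "N = Suc N'" using N by (cases N) auto
    have EN: "E N' m = x $ m / sqrt (real N)" for m by (simp add: E_def N')
    have "(\<Sum>m<N. E N' m * v m) = 0"
    proof -
      have "(\<Sum>m<N. E N' m * v m) = (\<Sum>m<N. v m * x $ m) / sqrt (real N)"
        by (simp only: EN) (simp add: sum_divide_distrib mult.commute)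
      then show ?thesis using v by simp
    qed
    then show ?thesis using N' by simp
  qed
  also have "\<dots> = (\<Sum>a<N - 1. (\<Sum>m<N. e a $ m * v m) * e a $ n)"
    by (intro sum.cong refl) (simp add: E_def)
  finally show ?thesis .
qed

text \<open>Since \<open>x\<close> lies in the kernel and the matrix is symmetric, an eigenvector
  with \<open>\<mu> \<noteq> 0\<close> is orthogonal to \<open>x\<close>. It is therefore described
  by its frame coordinates, and these form an eigenvector of the shifted matrix.\<close>

lemma eigenvalue_hess_matrix:
  assumes x: "x \<in> vec_sphere N (sqrt (real N))" and N: "N > 0" and e: "tangent_frame x e"
    and v: "nrm2 N v \<noteq> 0" "\<And>a. a < N \<Longrightarrow> mv N (hess_mat N p j (vec_index x)) v a = \<mu> * v a"
    and \<mu>: "\<mu> \<noteq> 0"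
  shows "eigenvalue (hess_matrix (hamiltonian p j N) x e) (\<mu> - real p * hamiltonian p j N x / real N)"
proof -
  let ?x = "vec_index x"
  let ?B = "hess_mat N p j ?x"
  let ?h = "real p * hamiltonian p j N x / real N"
  note dx = vec_sphere_nrm2[OF x]
  note ed = tangent_frameD(1)[OF x e] and ex = tangent_frameD(2)[OF x e]
    and ee = tangent_frameD(3)[OF x e]
  have xe: "(\<Sum>n<N. x $ n * e a $ n) = 0" if "a < N - 1" for a
    using ex[OF that] by (simp add: mult.commute)
  have vx: "(\<Sum>n<N. v n * x $ n) = 0"
  proof -
    have "\<mu> * (\<Sum>n<N. v n * x $ n) = (\<Sum>n<N. mv N ?B v n * x $ n)"
      by (simp add: v(2) sum_distrib_left mult.assoc)
    also have "\<dots> = (\<Sum>n<N. v n * mv N ?B ?x n)"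
      by (rule msym_mv_adjoint[OF msym_hess_mat])
    also have "\<dots> = 0" by (simp add: mv_hess_mat[OF dx(2)])
    finally show ?thesis using \<mu> by simp
  qed
  define c where "c a = (\<Sum>m<N. e a $ m * v m)" for a
  have vc: "v n = (\<Sum>a<N - 1. c a * e a $ n)" if "n < N" for n
    unfolding c_def by (rule tangent_frame_complete[OF x N e vx that])
  have hc: "hess_form N p j ?x (vec_index (e a)) v = \<mu> * c a" if a: "a < N - 1" for a
  proof -
    have "hess_form N p j ?x (vec_index (e a)) v = (\<Sum>n<N. e a $ n * mv N ?B v n)"
      by (rule hess_mat_form[symmetric]) (use ex[OF a] vx in auto)
    also have "\<dots> = \<mu> * c a"
      by (simp add: v(2) c_def sum_distrib_left mult_ac)
    finally show ?thesis .
  qed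
  let ?A = "hess_matrix (hamiltonian p j N) x e"
  have A: "?A \<in> carrier_mat (N - 1) (N - 1)" by (simp add: hess_matrix_def dx(1))
  have Aab: "?A $$ (a, b) = hess_form N p j ?x (vec_index (e a)) (vec_index (e b)) - (if a = b then ?h else 0)"
    if "a < N - 1" "b < N - 1" for a b
  proof -
    have "?A $$ (a, b) = sphere_hess (hamiltonian p j N) x (e a) (e b)"
      using that by (simp add: hess_matrix_def dx(1))
    also have "\<dots> = hess_form N p j ?x (vec_index (e b)) (vec_index (e a)) - ?h * (\<Sum>n<N. e a $ n * e b $ n)"
      by (rule sphere_hess_hamiltonian[OF x N ed[OF that(1)] xe[OF that(1)] ed[OF that(2)] xe[OF that(2)]])
    finally show ?thesis using ee[OF that] hess_form_sym[of N p j ?x "vec_index (e b)"] by simp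
  qed
  let ?c = "vec (N - 1) c"
  have "?A *\<^sub>v ?c = (\<mu> - ?h) \<cdot>\<^sub>v ?c"
  proof (intro eq_vecI)
    show "dim_vec (?A *\<^sub>v ?c) = dim_vec ((\<mu> - ?h) \<cdot>\<^sub>v ?c)" using A by simp
    fix a assume "a < dim_vec ((\<mu> - ?h) \<cdot>\<^sub>v ?c)"
    then have a: "a < N - 1" by simp
    have "(?A *\<^sub>v ?c) $ a = (\<Sum>b<N - 1. ?A $$ (a, b) * c b)"
      using a A by (simp add: scalar_prod_def lessThan_atLeast0)
    also have "\<dots> = (\<Sum>b<N - 1. c b * hess_form N p j ?x (vec_index (e a)) (vec_index (e b)))
        - (\<Sum>b<N - 1. if a = b then ?h * c a else 0)"
      unfolding sum_subtractf[symmetric] using a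
      by (intro sum.cong refl) (auto simp: Aab algebra_simps)
    also have "(\<Sum>b<N - 1. c b * hess_form N p j ?x (vec_index (e a)) (vec_index (e b)))
        = hess_form N p j ?x (vec_index (e a)) v"
      by (rule hess_form_linear_right[symmetric]) (simp add: vc)
    finally show "(?A *\<^sub>v ?c) $ a = ((\<mu> - ?h) \<cdot>\<^sub>v ?c) $ a"
      using a by (simp add: hc left_diff_distrib)
  qed
  moreover have "?c \<noteq> 0\<^sub>v (N - 1)"
  proof
    assume "?c = 0\<^sub>v (N - 1)"
    then have "c a = 0" if "a < N - 1" for a using that by (metis index_vec index_zero_vec(1))
    then have "v n = 0" if "n < N" for n using vc[OF that] by simp
    then show False using v(1) by (simp add: nrm2_zero_iff)
  qed
  ultimately show ?thesis
    using A unfolding eigenvalue_def eigenvector_def by (intro exI[of _ ?c]) auto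
qed

text \<open>Distinct eigenvalues suffice for a lower bound, as each is a root of the characteristic
  polynomial of order at least 1.\<close>

lemma card_le_num_neg_eigenvalues:
  assumes A: "A \<in> carrier_mat n n" and S: "\<And>l. l \<in> S \<Longrightarrow> eigenvalue A l \<and> l < 0"
  shows "card S \<le> num_neg_eigenvalues A"
proof -
  have cp: "char_poly A \<noteq> 0"
    using degree_monic_char_poly[OF A] by auto
  let ?T = "{l. eigenvalue A l \<and> l < 0}"
  have "?T \<subseteq> {l. poly (char_poly A) l = 0}"
    using eigenvalue_root_char_poly[OF A] by auto
  \<comment> \<open>Finiteness matters: on an infinite set both \<open>card\<close> and the sum
    defining the index would be 0.\<close>
  then have fin: "finite ?T" using poly_roots_finite[OF cp] finite_subset by blast
  have "card S \<le> card ?T" using S fin by (intro card_mono) auto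
  also have "\<dots> = (\<Sum>l\<in>?T. 1)" by simp
  also have "\<dots> \<le> num_neg_eigenvalues A"
    unfolding num_neg_eigenvalues_def
  proof (intro sum_mono)
    fix l assume "l \<in> ?T"
    then have "poly (char_poly A) l = 0" using eigenvalue_root_char_poly[OF A] by auto
    then show "1 \<le> Polynomial.order l (char_poly A)"
      using cp by (simp add: order_root Suc_le_eq)
  qed
  finally show ?thesis .
qed

text \<open>Each of the \<open>k + 1\<close> disjoint windows around \<open>- c m\<close> that contains an eigenvalue contributes a
  negative eigenvalue of the covariant Hessian, so an index \<open>k\<close> leaves one window empty.\<close>

lemma empty_window:
  assumes x: "x \<in> vec_sphere N (sqrt (real N))" and N: "N > 0"
    and idx: "has_index (hamiltonian p j N) x k"
    and \<kappa>: "\<kappa> > 0"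
    and pos: "\<And>m. m \<le> k \<Longrightarrow> c m \<ge> \<kappa>"
    and low: "\<And>m. m \<le> k \<Longrightarrow> - c m + \<kappa> \<le> real p * hamiltonian p j N x / real N"
    and disj: "\<And>m m'. m \<le> k \<Longrightarrow> m' \<le> k \<Longrightarrow> m \<noteq> m' \<Longrightarrow> 2 * \<kappa> \<le> \<bar>c m - c m'\<bar>"
  shows "\<exists>m\<le>k. \<forall>v. \<kappa>\<^sup>2 * nrm2 N v
    \<le> nrm2 N (mv N (\<lambda>a b. c m * idm N a b + hess_mat N p j (vec_index x) a b) v)"
proof (rule ccontr)
  let ?B = "hess_mat N p j (vec_index x)"
  let ?Z = "\<lambda>m a b. c m * idm N a b + ?B a b"
  let ?h = "real p * hamiltonian p j N x / real N"
  assume neg: "\<not> ?thesis"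
  obtain e where e: "tangent_frame x e" "num_neg_eigenvalues (hess_matrix (hamiltonian p j N) x e) = k"
    using idx by (auto simp: has_index_def)
  let ?A = "hess_matrix (hamiltonian p j N) x e"
  have "\<exists>\<mu>. \<bar>\<mu> + c m\<bar> < \<kappa> \<and> eigenvalue ?A (\<mu> - ?h)" if m: "m \<le> k" for m
  proof -
    have Z: "msupp N (?Z m)" "msym (?Z m)"
      using msupp_hess_mat[of N p j] msym_hess_mat[of N p j] msupp_idm[of N]
      by (auto simp: msupp_def msym_def idm_def)
    obtain v where v: "\<not> \<kappa>\<^sup>2 * nrm2 N v \<le> nrm2 N (mv N (?Z m) v)" using neg m by blast
    then obtain \<nu> w where w: "\<bar>\<nu>\<bar> < \<kappa>" "nrm2 N w \<noteq> 0" "\<And>a. a < N \<Longrightarrow> mv N (?Z m) w a = \<nu> * w a"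
      using spectral_gap[OF Z \<kappa>, of v] by blast
    have Bw: "mv N ?B w a = (\<nu> - c m) * w a" if "a < N" for a
    proof -
      have "mv N (?Z m) w a = c m * mv N (idm N) w a + mv N ?B w a"
        by (simp add: mv_def distrib_right sum.distrib sum_distrib_left mult.assoc)
      then show ?thesis using w(3)[OF that] that by (simp add: mv_idm algebra_simps)
    qed
    \<comment> \<open>The condition \<open>c m \<ge> \<kappa>\<close> keeps the window away from 0,
      so the eigenvalue found there cannot be the trivial one belonging to \<open>x\<close>.\<close>
    have "\<nu> - c m \<noteq> 0" using w(1) pos[OF m] by auto
    from eigenvalue_hess_matrix[OF x N e(1) w(2) Bw this] w(1) show ?thesis
      by (intro exI[of _ "\<nu> - c m"]) auto
  qed
  then obtain \<mu> where \<mu>: "\<And>m. m \<le> k \<Longrightarrow> \<bar>\<mu> m + c m\<bar> < \<kappa>" "\<And>m. m \<le> k \<Longrightarrow> eigenvalue ?A (\<mu> m - ?h)"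
    by metis
  have inj: "inj_on (\<lambda>m. \<mu> m - ?h) {..k}"
  proof (rule inj_onI, rule ccontr)
    fix m m' assume "m \<in> {..k}" "m' \<in> {..k}" "\<mu> m - ?h = \<mu> m' - ?h" "m \<noteq> m'"
    then show False using disj[of m m'] \<mu>(1)[of m] \<mu>(1)[of m'] by auto
  qed
  have "card ((\<lambda>m. \<mu> m - ?h) ` {..k}) \<le> num_neg_eigenvalues ?A"
  proof (rule card_le_num_neg_eigenvalues)
    show "?A \<in> carrier_mat (N - 1) (N - 1)"
      by (simp add: hess_matrix_def vec_sphere_nrm2[OF x])
    fix l assume "l \<in> (\<lambda>m. \<mu> m - ?h) ` {..k}"
    then obtain m where m: "m \<le> k" "l = \<mu> m - ?h" by auto
    have "\<mu> m - ?h < 0" using \<mu>(1)[OF m(1)] low[OF m(1)] by linarith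
    then show "eigenvalue ?A l \<and> l < 0" using \<mu>(2)[OF m(1)] m(2) by simp
  qed
  then show False using card_image[OF inj] e(2) by simp
qed

section \<open>Lipschitz estimates and a net of the sphere\<close>

lemma prod_diff_le:
  fixes f g :: "nat \<Rightarrow> real"
  assumes "\<And>r. r < p \<Longrightarrow> \<bar>f r\<bar> \<le> R" "\<And>r. r < p \<Longrightarrow> \<bar>g r\<bar> \<le> R"
    and "\<And>r. r < p \<Longrightarrow> \<bar>f r - g r\<bar> \<le> \<delta>" and R: "R \<ge> 1" and \<delta>: "\<delta> \<ge> 0"
  shows "\<bar>(\<Prod>r<p. f r) - (\<Prod>r<p. g r)\<bar> \<le> real p * R ^ p * \<delta>"
  using assms(1-3)
proof (induction p)
  case (Suc p)
  let ?F = "\<Prod>r<p. f r" and ?G = "\<Prod>r<p. g r"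
  have IH: "\<bar>?F - ?G\<bar> \<le> real p * R ^ p * \<delta>" using Suc.prems by (intro Suc.IH) auto
  have G: "\<bar>?G\<bar> \<le> R ^ p"
  proof -
    have "\<bar>?G\<bar> = (\<Prod>r<p. \<bar>g r\<bar>)" by (rule abs_prod)
    also have "\<dots> \<le> (\<Prod>r<p. R)" using Suc.prems by (intro prod_mono) auto
    finally show ?thesis by simp
  qed
  have "(\<Prod>r<Suc p. f r) - (\<Prod>r<Suc p. g r) = (?F - ?G) * f p + ?G * (f p - g p)"
    by (simp add: algebra_simps)
  then have "\<bar>(\<Prod>r<Suc p. f r) - (\<Prod>r<Suc p. g r)\<bar> \<le> \<bar>?F - ?G\<bar> * \<bar>f p\<bar> + \<bar>?G\<bar> * \<bar>f p - g p\<bar>"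
    by (metis abs_mult abs_triangle_ineq)
  also have "\<dots> \<le> (real p * R ^ p * \<delta>) * R + R ^ p * \<delta>"
    using IH G Suc.prems R \<delta> by (intro add_mono mult_mono) auto
  also have "\<dots> \<le> (real p * R ^ p * \<delta>) * R + R ^ p * \<delta> * R"
    using R \<delta> mult_left_mono[of 1 R "R ^ p * \<delta>"] by simp
  also have "\<dots> = real (Suc p) * R ^ Suc p * \<delta>" by (simp add: algebra_simps)
  finally show ?case .
qed simp

lemma sphere_coord_le:
  assumes "(\<Sum>a<N. (x a)\<^sup>2) = real N" "a < N"
  shows "\<bar>x a\<bar> \<le> sqrt (real N)"
proof -
  have "(x a)\<^sup>2 \<le> (\<Sum>a<N. (x a)\<^sup>2)" using assms(2) by (intro member_le_sum) auto
  then show ?thesis using assms(1) by (intro real_le_rsqrt) simp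
qed

lemma mproj_bounds:
  assumes x: "(\<Sum>a<N. (x a)\<^sup>2) = real N" and y: "(\<Sum>a<N. (y a)\<^sup>2) = real N"
    and d: "\<And>a. a < N \<Longrightarrow> \<bar>x a - y a\<bar> \<le> \<eta>" and ab: "a < N" "b < N"
  shows "\<bar>mproj N x a b\<bar> \<le> 2" "\<bar>mproj N x a b - mproj N y a b\<bar> \<le> 2 * \<eta>"
proof -
  have N: "real N \<ge> 1" using ab by simp
  have s: "sqrt (real N) * sqrt (real N) = real N" by simp
  have "\<bar>x a * x b\<bar> \<le> sqrt (real N) * sqrt (real N)"
    unfolding abs_mult using ab by (intro mult_mono sphere_coord_le x) auto
  then have "\<bar>x a * x b / real N\<bar> \<le> 1" using N by (simp add: abs_divide)
  moreover have "\<bar>idm N a b\<bar> \<le> 1" by (simp add: idm_def)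
  moreover have "mproj N x a b = idm N a b - x a * x b / real N" using ab by (simp add: mproj_def)
  ultimately show "\<bar>mproj N x a b\<bar> \<le> 2" by linarith
  have \<eta>: "\<eta> \<ge> 0" using d[OF ab(1)] by linarith
  have "\<bar>x a * x b - y a * y b\<bar> = \<bar>(x a - y a) * x b + y a * (x b - y b)\<bar>"
    by (simp add: algebra_simps)
  also have "\<dots> \<le> \<bar>x a - y a\<bar> * \<bar>x b\<bar> + \<bar>y a\<bar> * \<bar>x b - y b\<bar>"
    by (metis abs_mult abs_triangle_ineq)
  also have "\<dots> \<le> \<eta> * sqrt (real N) + sqrt (real N) * \<eta>"
    using ab \<eta> by (intro add_mono mult_mono sphere_coord_le x y d) auto
  also have "\<dots> = 2 * \<eta> * sqrt (real N)" by simp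
  also have "\<dots> \<le> 2 * \<eta> * real N"
    using \<eta> N real_sqrt_ge_one[OF N] s
    by (intro mult_left_mono) (auto intro: order.trans[OF mult_right_mono[of 1 "sqrt (real N)" "sqrt (real N)", simplified]])
  finally have "\<bar>x a * x b - y a * y b\<bar> / real N \<le> 2 * \<eta>" using N by (simp add: divide_le_eq)
  moreover have "mproj N x a b - mproj N y a b = - ((x a * x b - y a * y b) / real N)"
    using ab by (simp add: mproj_def diff_divide_distrib)
  ultimately show "\<bar>mproj N x a b - mproj N y a b\<bar> \<le> 2 * \<eta>" by (simp add: abs_divide)
qed

text \<open>Any constant polynomial in \<open>N\<close> is good enough: it only refines the mesh of
  the net, and polynomially many cells per coordinate cost \<open>exp (O (N log N))\<close>.\<close>

lemma hess_coeff_lipschitz: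
  assumes x: "(\<Sum>a<N. (x a)\<^sup>2) = real N" and y: "(\<Sum>a<N. (y a)\<^sup>2) = real N"
    and d: "\<And>a. a < N \<Longrightarrow> \<bar>x a - y a\<bar> \<le> \<eta>" and ab: "a < N" "b < N"
    and i: "i \<in> multi_indices p N"
  shows "\<bar>hess_coeff N p x i a b - hess_coeff N p y i a b\<bar> \<le> 2 * real p ^ 3 * (2 * real N) ^ p * \<eta>"
proof -
  have N: "real N \<ge> 1" using ab by simp
  have \<eta>: "\<eta> \<ge> 0" using d[OF ab(1)] by linarith
  have sN: "sqrt (real N) \<le> 2 * real N"
    using N real_sqrt_le_mono[of "real N" "real N * real N"] by (simp add: mult_le_cancel_left1)
  have slot: "\<bar>slot N x a b z r (i r)\<bar> \<le> 2 * real N" "\<bar>slot N y a b z r (i r)\<bar> \<le> 2 * real N"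
    "\<bar>slot N x a b z r (i r) - slot N y a b z r (i r)\<bar> \<le> 2 * \<eta>" if "r < p" for z r
  proof -
    have ir: "i r < N" using i that by auto
    have d0: "\<bar>y a - y a\<bar> \<le> \<eta>" for a using \<eta> by simp
    show "\<bar>slot N x a b z r (i r)\<bar> \<le> 2 * real N"
      using mproj_bounds(1)[OF x y d ab(1) ir] mproj_bounds(1)[OF x y d ab(2) ir]
        sphere_coord_le[OF x ir] N sN by (auto simp: slot_def)
    show "\<bar>slot N y a b z r (i r)\<bar> \<le> 2 * real N"
      using mproj_bounds(1)[OF y y d0 ab(1) ir] mproj_bounds(1)[OF y y d0 ab(2) ir]
        sphere_coord_le[OF y ir] N sN by (auto simp: slot_def)
    show "\<bar>slot N x a b z r (i r) - slot N y a b z r (i r)\<bar> \<le> 2 * \<eta>"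
      using mproj_bounds(2)[OF x y d ab(1) ir] mproj_bounds(2)[OF x y d ab(2) ir]
        d[OF ir] \<eta> by (auto simp: slot_def)
  qed
  have sc: "\<bar>spin_scale p N\<bar> \<le> 1" if "p \<ge> 1"
    using N that by (simp add: spin_scale_def divide_le_eq ge_one_powr_ge_zero)
  have "\<bar>hess_coeff N p x i a b - hess_coeff N p y i a b\<bar>
      = \<bar>spin_scale p N\<bar> * \<bar>\<Sum>z\<in>slot_pairs p. (\<Prod>r<p. slot N x a b z r (i r)) - (\<Prod>r<p. slot N y a b z r (i r))\<bar>"
    by (simp only: hess_coeff_slot right_diff_distrib[symmetric] sum_subtractf[symmetric] abs_mult)
  also have "\<dots> \<le> \<bar>spin_scale p N\<bar> * (\<Sum>z\<in>slot_pairs p. real p * (2 * real N) ^ p * (2 * \<eta>))"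
    using slot N \<eta> by (intro mult_left_mono order.trans[OF sum_abs] sum_mono prod_diff_le) auto
  also have "\<dots> = \<bar>spin_scale p N\<bar> * (real (p * (p - 1)) * (real p * (2 * real N) ^ p * (2 * \<eta>)))"
    by (simp add: card_slot_pairs)
  also have "\<dots> \<le> 1 * (real (p * p) * (real p * (2 * real N) ^ p * (2 * \<eta>)))"
  proof (cases "p = 0")
    case False
    have "real (p * (p - 1)) \<le> real (p * p)" by (intro of_nat_mono mult_le_mono) auto
    then show ?thesis using sc False N \<eta> by (intro mult_mono) auto
  qed simp
  also have "\<dots> = 2 * real p ^ 3 * (2 * real N) ^ p * \<eta>"
    by (simp add: power3_eq_cube mult_ac)
  finally show ?thesis .
qed

text \<open>The couplings are capped at \<open>N\<close>: exceeding the cap has probability of order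
  \<open>exp (- N^2 / 4)\<close>, already of the required speed, and below it the Lipschitz constant
  stays polynomial.\<close>

lemma hess_mat_lipschitz:
  assumes x: "(\<Sum>a<N. (x a)\<^sup>2) = real N" and y: "(\<Sum>a<N. (y a)\<^sup>2) = real N"
    and d: "\<And>a. a < N \<Longrightarrow> \<bar>x a - y a\<bar> \<le> \<eta>" and ab: "a < N" "b < N"
    and j: "\<And>i. i \<in> multi_indices p N \<Longrightarrow> \<bar>j i\<bar> \<le> real N"
  shows "\<bar>hess_mat N p j x a b - hess_mat N p j y a b\<bar>
    \<le> real N ^ p * (real N * (2 * real p ^ 3 * (2 * real N) ^ p * \<eta>))"
proof -
  have \<eta>: "\<eta> \<ge> 0" using d[OF ab(1)] by linarith
  have "hess_mat N p j x a b - hess_mat N p j y a b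
      = (\<Sum>i\<in>multi_indices p N. j i * (hess_coeff N p x i a b - hess_coeff N p y i a b))"
    by (simp only: hess_mat_def right_diff_distrib sum_subtractf)
  then have "\<bar>hess_mat N p j x a b - hess_mat N p j y a b\<bar>
      \<le> (\<Sum>i\<in>multi_indices p N. \<bar>j i * (hess_coeff N p x i a b - hess_coeff N p y i a b)\<bar>)"
    by (simp only: sum_abs)
  also have "\<dots> \<le> (\<Sum>i\<in>multi_indices p N. real N * (2 * real p ^ 3 * (2 * real N) ^ p * \<eta>))"
    unfolding abs_mult using \<eta> by (intro sum_mono mult_mono j hess_coeff_lipschitz x y d ab) auto
  also have "\<dots> = real N ^ p * (real N * (2 * real p ^ 3 * (2 * real N) ^ p * \<eta>))"
    by (simp add: card_PiE)
  finally show ?thesis .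
qed

text \<open>From \<open>|A v|^2 \<le> 2 |B v|^2 + 2 |D v|^2\<close> with Frobenius norm of
  \<open>D = A - B\<close> at most \<open>\<kappa> / 2\<close>: half of \<open>\<kappa>^2\<close> is
  lost to \<open>D\<close>, and the factor 2 leaves \<open>\<kappa>^2 / 4\<close>.\<close>

lemma gap_perturb:
  assumes gap: "\<kappa>\<^sup>2 * nrm2 N v \<le> nrm2 N (mv N A v)"
    and AB: "\<And>a b. a < N \<Longrightarrow> b < N \<Longrightarrow> \<bar>A a b - B a b\<bar> \<le> \<delta>" and \<delta>: "0 \<le> \<delta>" "real N * \<delta> \<le> \<kappa> / 2" and \<kappa>: "\<kappa> > 0"
  shows "(\<kappa> / 2)\<^sup>2 * nrm2 N v \<le> nrm2 N (mv N B v)"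
proof -
  let ?D = "\<lambda>a b. A a b - B a b"
  have "nrm2 N (mv N A v) = (\<Sum>a<N. (mv N B v a + mv N ?D v a)\<^sup>2)"
    unfolding nrm2_def by (intro sum.cong refl) (simp add: mv_def left_diff_distrib sum_subtractf)
  also have "\<dots> \<le> (\<Sum>a<N. 2 * (mv N B v a)\<^sup>2 + 2 * (mv N ?D v a)\<^sup>2)"
  proof (intro sum_mono)
    fix a
    have "0 \<le> (mv N B v a - mv N ?D v a)\<^sup>2" by simp
    then show "(mv N B v a + mv N ?D v a)\<^sup>2 \<le> 2 * (mv N B v a)\<^sup>2 + 2 * (mv N ?D v a)\<^sup>2"
      by (simp add: power2_sum power2_diff)
  qed
  also have "\<dots> = 2 * nrm2 N (mv N B v) + 2 * nrm2 N (mv N ?D v)"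
    by (simp add: nrm2_def sum.distrib sum_distrib_left)
  finally have 1: "nrm2 N (mv N A v) \<le> 2 * nrm2 N (mv N B v) + 2 * nrm2 N (mv N ?D v)" .
  have "(\<Sum>a<N. \<Sum>b<N. (?D a b)\<^sup>2) \<le> (\<Sum>a<N. \<Sum>b<N. \<delta>\<^sup>2)"
    using AB \<delta>(1) by (intro sum_mono) (metis abs_ge_zero abs_of_nonneg lessThan_iff power2_abs power_mono)
  also have "\<dots> = (real N * \<delta>)\<^sup>2" by (simp add: power2_eq_square mult_ac)
  also have "\<dots> \<le> (\<kappa> / 2)\<^sup>2" using \<delta> by (intro power_mono) auto
  finally have "nrm2 N (mv N ?D v) \<le> (\<kappa> / 2)\<^sup>2 * nrm2 N v"
    using nrm2_mv_le_frobenius[of N ?D v] mult_right_mono nrm2_nonneg by (meson order.trans)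
  then show ?thesis using 1 gap by (simp add: power2_eq_square field_simps)
qed

text \<open>Round coordinates to a grid of side \<open>\<eta>\<close> and keep one point per
  occupied cell. The representatives lie on the sphere itself, where the covariance of the
  tangential Hessian is known.\<close>

lemma sphere_net:
  assumes N: "N > 0" and \<eta>: "\<eta> > 0"
  obtains T where "T \<subseteq> vec_sphere N (sqrt (real N))" "finite T"
    "real (card T) \<le> (2 * (real N / \<eta>) + 5) ^ N"
    "\<And>x. x \<in> vec_sphere N (sqrt (real N)) \<Longrightarrow> \<exists>y\<in>T. \<forall>a<N. \<bar>vec_index x a - vec_index y a\<bar> \<le> \<eta>"
proof -
  let ?S = "vec_sphere N (sqrt (real N))"
  define K :: int where "K = \<lceil>real N / \<eta>\<rceil> + 1"
  have "0 \<le> real N / \<eta>" using \<eta> by simp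
  then have K: "K \<ge> 1" unfolding K_def by linarith
  define \<rho> where "\<rho> x = (\<lambda>a\<in>{..<N}. \<lfloor>vec_index x a / \<eta>\<rfloor>)" for x :: "real Matrix.vec"
  have sub: "\<rho> ` ?S \<subseteq> {..<N} \<rightarrow>\<^sub>E {-K..K}"
  proof
    fix g assume "g \<in> \<rho> ` ?S"
    then obtain x where x: "x \<in> ?S" "g = \<rho> x" by auto
    have "\<lfloor>vec_index x a / \<eta>\<rfloor> \<in> {-K..K}" if a: "a < N" for a
    proof -
      have "sqrt (real N) \<le> real N"
        using N real_sqrt_le_mono[of "real N" "real N * real N"] by (simp add: mult_le_cancel_left1)
      then have "\<bar>vec_index x a\<bar> \<le> real N"
        using sphere_coord_le[OF vec_sphere_nrm2(2)[OF x(1)] a] by linarith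
      then have "\<bar>vec_index x a / \<eta>\<bar> \<le> real N / \<eta>"
        using \<eta> by (simp add: abs_divide divide_right_mono)
      then show ?thesis unfolding K_def by (simp, linarith)
    qed
    then show "g \<in> {..<N} \<rightarrow>\<^sub>E {-K..K}" by (auto simp: x(2) \<rho>_def)
  qed
  have fin: "finite ({..<N} \<rightarrow>\<^sub>E {-K..K})" by (intro finite_PiE) auto
  \<comment> \<open>A section of the rounding map: one representative for each value it takes on the
    sphere.\<close>
  obtain T where T: "T \<subseteq> ?S" "inj_on \<rho> T" "\<rho> ` ?S = \<rho> ` T"
    using subset_image_inj[of "\<rho> ` ?S" \<rho> ?S] by auto
  show thesis
  proof (rule that[of T])
    show "T \<subseteq> ?S" by (rule T(1))
    have finT: "finite (\<rho> ` T)" using T(3) sub fin finite_subset by metis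
    then show "finite T" using T(2) finite_imageD by blast
    have "card T = card (\<rho> ` T)" using card_image[OF T(2)] by simp
    also have "\<dots> \<le> card ({..<N} \<rightarrow>\<^sub>E {-K..K})"
      using T(3) sub by (intro card_mono fin) auto
    also have "\<dots> = nat (2 * K + 1) ^ N" by (simp add: card_PiE)
    finally have "real (card T) \<le> real (nat (2 * K + 1) ^ N)" by (simp only: of_nat_le_iff)
    also have "\<dots> = (2 * real_of_int K + 1) ^ N" using K by simp
    \<comment> \<open>Here \<open>K < N / \<eta> + 2\<close>, so \<open>2 K + 1\<close> stays below
      \<open>2 N / \<eta> + 5\<close>.\<close>
    also have "\<dots> \<le> (2 * (real N / \<eta>) + 5) ^ N"
      using K by (intro power_mono) (simp_all add: K_def, linarith)
    finally show "real (card T) \<le> (2 * (real N / \<eta>) + 5) ^ N" .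
    fix x assume "x \<in> ?S"
    then obtain y where y: "y \<in> T" "\<rho> x = \<rho> y" using T(3) by (metis image_iff)
    have "\<bar>vec_index x a - vec_index y a\<bar> \<le> \<eta>" if a: "a < N" for a
    proof -
      have "\<lfloor>vec_index x a / \<eta>\<rfloor> = \<lfloor>vec_index y a / \<eta>\<rfloor>"
        using fun_cong[OF y(2), of a] a by (simp add: \<rho>_def)
      then have "\<bar>vec_index x a / \<eta> - vec_index y a / \<eta>\<bar> \<le> 1" by linarith
      then show ?thesis using \<eta> by (simp add: diff_divide_distrib[symmetric] abs_divide divide_le_eq)
    qed
    then show "\<exists>y\<in>T. \<forall>a<N. \<bar>vec_index x a - vec_index y a\<bar> \<le> \<eta>" using y(1) by blast
  qed
qed

text \<open>Markov's inequality for \<open>exp (t^2 / 4)\<close>. This weight turns the standard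
  density into \<open>sqrt 2\<close> times the density of variance 2, so its mean is
  \<open>sqrt 2\<close>.\<close>

lemma gaussian_tail:
  assumes "r \<ge> 0"
  shows "measure gaussian {t. r \<le> \<bar>t\<bar>} \<le> sqrt 2 * exp (- r\<^sup>2 / 4)"
proof -
  interpret prob_space gaussian by (rule prob_space_gaussian)
  let ?u = "\<lambda>t :: real. exp (t\<^sup>2 / 4)"
  have eq: "std_normal_density t * ?u t = sqrt 2 * normal_density 0 (sqrt 2) t" for t
  proof -
    have "exp (- t\<^sup>2 / 2) * exp (t\<^sup>2 / 4) = exp (- t\<^sup>2 / 4)"
      by (simp add: exp_add[symmetric])
    then show ?thesis
      by (simp add: std_normal_density_def normal_density_def real_sqrt_mult field_simps)
  qed
  have i: "integrable lborel (\<lambda>t. sqrt 2 * normal_density 0 (sqrt 2) t)"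
    by (intro integrable_mult_right integrable_normal_density) simp
  have int: "integrable gaussian ?u"
    unfolding gaussian_def using i by (subst integrable_density) (auto simp: eq)
  have val: "(\<integral>t. ?u t \<partial>gaussian) = sqrt 2"
    unfolding gaussian_def by (subst integral_density) (auto simp: eq integral_normal_density)
  have "{t. r \<le> \<bar>t\<bar>} \<subseteq> {t \<in> space gaussian. exp (r\<^sup>2 / 4) \<le> ?u t}"
    using assms abs_le_square_iff[of r] by auto
  then have "measure gaussian {t. r \<le> \<bar>t\<bar>} \<le> measure gaussian {t \<in> space gaussian. exp (r\<^sup>2 / 4) \<le> ?u t}"
    by (intro finite_measure_mono) auto
  also have "\<dots> \<le> (\<integral>t. ?u t \<partial>gaussian) / exp (r\<^sup>2 / 4)"
    by (rule integral_Markov_inequality_measure[OF int sets.top]) auto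
  also have "\<dots> = sqrt 2 * exp (- r\<^sup>2 / 4)"
    unfolding val by (simp add: exp_minus field_simps)
  finally show ?thesis .
qed

section \<open>The union bound\<close>

lemma hess_mat_restrict:
  "hess_mat N p (\<lambda>i\<in>multi_indices p N. j i) x = hess_mat N p j x"
  unfolding hess_mat_def by (intro ext sum.cong) auto

text \<open>For the choice \<open>l = N\<close>: the Schatten norm then exceeds the operator norm by
  at most the constant factor \<open>exp 1\<close>.\<close>

lemma root_self_le_exp: "N > 0 \<Longrightarrow> root (N + N) (real N) \<le> exp 1"
proof -
  assume N: "N > 0"
  have "real N \<le> exp (real N)" using exp_ge_add_one_self[of "real N"] by linarith
  also have "\<dots> \<le> exp (real (N + N))" by simp
  also have "\<dots> = exp 1 ^ (N + N)" by (simp add: exp_of_nat_mult[symmetric])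
  finally have "root (N + N) (real N) \<le> root (N + N) (exp 1 ^ (N + N))"
    using N by (intro real_root_le_mono) auto
  then show ?thesis using N by (simp add: real_root_power_cancel)
qed

context prob_space
begin

lemma distr_couplings:
  fixes J :: "'i \<Rightarrow> 'a \<Rightarrow> real"
  assumes indep: "indep_vars (\<lambda>_. borel) J I" and I: "I \<noteq> {}"
    and dist: "\<And>i. i \<in> I \<Longrightarrow> distributed M lborel (J i) std_normal_density"
  shows "(\<lambda>\<omega>. \<lambda>i\<in>I. J i \<omega>) \<in> M \<rightarrow>\<^sub>M gaussian_product I"
    and "distr M (gaussian_product I) (\<lambda>\<omega>. \<lambda>i\<in>I. J i \<omega>) = gaussian_product I"
    and "\<And>i. i \<in> I \<Longrightarrow> distr M borel (J i) = gaussian"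
proof -
  have rv: "random_variable borel (J i)" if "i \<in> I" for i
    using indep that by (auto simp: indep_vars_def)
  show dJ: "distr M borel (J i) = gaussian" if "i \<in> I" for i
  proof -
    have "distr M borel (J i) = distr M lborel (J i)" by (intro distr_cong) auto
    also have "\<dots> = gaussian"
      using distributed_distr_eq_density[OF dist[OF that]] by (simp add: gaussian_def)
    finally show ?thesis .
  qed
  have sets: "sets (gaussian_product I) = sets (Pi\<^sub>M I (\<lambda>_. borel :: real measure))"
    by (intro sets_PiM_cong) auto
  have "(\<lambda>\<omega>. \<lambda>i\<in>I. J i \<omega>) \<in> M \<rightarrow>\<^sub>M Pi\<^sub>M I (\<lambda>_. borel)"
    using rv by (intro measurable_restrict) auto
  then show "(\<lambda>\<omega>. \<lambda>i\<in>I. J i \<omega>) \<in> M \<rightarrow>\<^sub>M gaussian_product I"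
    by (simp only: measurable_cong_sets[OF refl sets])
  have "distr M (gaussian_product I) (\<lambda>\<omega>. \<lambda>i\<in>I. J i \<omega>)
      = distr M (Pi\<^sub>M I (\<lambda>_. borel)) (\<lambda>\<omega>. \<lambda>i\<in>I. J i \<omega>)"
    by (intro distr_cong sets) auto
  also have "\<dots> = Pi\<^sub>M I (\<lambda>i. distr M borel (J i))"
    using indep indep_vars_iff_distr_eq_PiM'[OF I, of J "\<lambda>_. borel"] rv by simp
  also have "\<dots> = gaussian_product I"
    by (intro PiM_cong dJ refl)
  finally show "distr M (gaussian_product I) (\<lambda>\<omega>. \<lambda>i\<in>I. J i \<omega>) = gaussian_product I" .
qed

lemma coupling_tail:
  assumes "distr M borel X = gaussian" "random_variable borel X" "r \<ge> 0"
  shows "prob {\<omega> \<in> space M. r \<le> \<bar>X \<omega>\<bar>} \<le> sqrt 2 * exp (- r\<^sup>2 / 4)"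
proof -
  have "measure (distr M borel X) {t. r \<le> \<bar>t\<bar>} = prob (X -` {t. r \<le> \<bar>t\<bar>} \<inter> space M)"
    by (intro measure_distr assms) auto
  moreover have "X -` {t. r \<le> \<bar>t\<bar>} \<inter> space M = {\<omega> \<in> space M. r \<le> \<bar>X \<omega>\<bar>}" by auto
  ultimately show ?thesis using gaussian_tail[OF assms(3)] assms(1) by simp
qed

text \<open>A lower bound \<open>\<kappa>\<close> on the shifted matrix makes the Schatten norm of
  its inverse at most \<open>q0\<close>, hence the barrier at least \<open>exp (- s q0)\<close>, the
  event bounded by \<open>barrier_prob_le\<close>. The gap condition ranges over all vectors, so it
  is enclosed in a measurable event pulled back from the space of couplings.\<close>

lemma gap_prob:
  fixes J :: "(nat \<Rightarrow> nat) \<Rightarrow> 'a \<Rightarrow> real" and N p :: nat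
  defines "I \<equiv> multi_indices p N"
  assumes meas: "(\<lambda>\<omega>. \<lambda>i\<in>I. J i \<omega>) \<in> M \<rightarrow>\<^sub>M gaussian_product I"
    and distr: "distr M (gaussian_product I) (\<lambda>\<omega>. \<lambda>i\<in>I. J i \<omega>) = gaussian_product I"
    and x: "(\<Sum>a<N. (x a)\<^sup>2) = real N" and N: "N > 0" and p: "p \<ge> 2" and \<kappa>: "\<kappa> > 0"
    and b: "b > 0" "b\<^sup>2 \<le> 4 * real (p * (p - 1)) * (1 - 2 * \<delta>)" and \<delta>: "\<delta> > 0" "1 \<le> \<delta> * real N"
    and q0: "q0 = exp 1 / \<kappa>" and c: "c = \<delta> / (32 * real (p * (p - 1)) * q0 ^ 3)"
    and cN: "1 \<le> c * (real N)\<^sup>2"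
  shows "\<exists>U\<in>sets M. {\<omega> \<in> space M. \<forall>v. \<kappa>\<^sup>2 * nrm2 N v
      \<le> nrm2 N (mv N (\<lambda>a d. b * idm N a d + hess_mat N p (\<lambda>i. J i \<omega>) x a d) v)} \<subseteq> U
    \<and> prob U \<le> 24 * real (p * (p - 1)) * c / \<delta> * exp (2 * q0) * exp (- (c * q0) * (real N)\<^sup>2)"
proof -
  let ?P = "gaussian_product I"
  let ?Jr = "\<lambda>\<omega>. \<lambda>i\<in>I. J i \<omega>"
  define d where "d = real (p * (p - 1))"
  define v where "v = d / real N"
  \<comment> \<open>With \<open>v = d / N\<close> this gives \<open>v s = d c N\<close>. The
    constant \<open>c\<close> is chosen so that the absorption condition
    \<open>4 v s (2 q0)^3 \<le> m\<close> holds with equality; 32 is 4 times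
    \<open>2^3\<close>.\<close>
  define s where "s = c * (real N)\<^sup>2"
  \<comment> \<open>Of the slack \<open>2 \<delta>\<close> in the bound on \<open>b^2\<close>, one
    \<open>\<delta>\<close> becomes \<open>m\<close> and the other pays for the missing dimension in
    \<open>N - 1\<close>.\<close>
  define m where "m = \<delta> * real N"
  have d: "d > 0" using p by (simp add: d_def)
  have q0p: "q0 > 0" using \<kappa> by (simp add: q0)
  interpret T: tangent_goe N I "hess_coeff N p x" x v b
    unfolding I_def v_def d_def by (rule tangent_goe_hess_coeff) (use x N p b in auto)
  have X: "T.X j = (\<lambda>a e. b * idm N a e + hess_mat N p j x a e)" for j
    unfolding T.X_def hess_mat_def unfolding I_def by (rule refl)
  have vs: "v * s = d * c * real N"
    using N by (simp add: v_def s_def power2_eq_square)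
  have m1: "4 * v * s * (2 * q0) ^ 3 \<le> m"
  proof -
    have "4 * v * s * (2 * q0) ^ 3 = 32 * (v * s) * q0 ^ 3" by (simp add: power_mult_distrib)
    also have "\<dots> = (32 * d * q0 ^ 3) * c * real N" by (simp add: vs)
    also have "(32 * d * q0 ^ 3) * c = \<delta>"
      unfolding c d_def[symmetric] using d q0p by simp
    finally show ?thesis by (simp add: m_def)
  qed
  have m2: "m \<le> real N - 1 - b\<^sup>2 / (4 * v)"
  proof -
    have "b\<^sup>2 / (4 * v) = b\<^sup>2 / (4 * d) * real N" by (simp add: v_def)
    also have "\<dots> \<le> (1 - 2 * \<delta>) * real N"
    proof (intro mult_right_mono)
      have "b\<^sup>2 \<le> 4 * d * (1 - 2 * \<delta>)" using b(2) by (simp only: d_def)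
      then show "b\<^sup>2 / (4 * d) \<le> 1 - 2 * \<delta>" using d by (simp add: field_simps)
    qed simp
    finally show ?thesis using \<delta>(2) by (simp add: m_def algebra_simps)
  qed
  define A where "A = {j \<in> space ?P. exp (- s * q0) \<le> barrier N N s (T.X j)}"
  have A: "A \<in> sets ?P"
    unfolding A_def using measurable_field_comp(1)[OF T.measurable_X] by measurable
  have pA: "measure ?P A \<le> 24 * v * s / m * exp (2 * q0) * exp (- s * q0)"
    unfolding A_def
    by (rule T.barrier_prob_le[OF N _ _ _ m1 m2]) (use cN q0p \<delta> N in \<open>auto simp: s_def m_def\<close>)
  define U where "U = ?Jr -` A \<inter> space M"
  have "prob U = measure (distr M ?P ?Jr) A"
    unfolding U_def by (rule measure_distr[symmetric, OF meas A])
  also have "\<dots> \<le> 24 * v * s / m * exp (2 * q0) * exp (- s * q0)"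
    unfolding distr by (rule pA)
  also have "24 * v * s / m = 24 * d * c / \<delta>"
  proof -
    have "24 * v * s / m = 24 * (v * s) / m" by simp
    also have "\<dots> = 24 * d * c / \<delta>" unfolding vs m_def using N \<delta> by simp
    finally show ?thesis .
  qed
  also have "- s * q0 = - (c * q0) * (real N)\<^sup>2" by (simp add: s_def)
  finally have pU: "prob U \<le> 24 * d * c / \<delta> * exp (2 * q0) * exp (- (c * q0) * (real N)\<^sup>2)" .
  have "\<omega> \<in> U" if \<omega>: "\<omega> \<in> space M" and gap: "\<And>v. \<kappa>\<^sup>2 * nrm2 N v
      \<le> nrm2 N (mv N (\<lambda>a e. b * idm N a e + hess_mat N p (\<lambda>i. J i \<omega>) x a e) v)" for \<omega>
  proof -
    have XJ: "T.X (?Jr \<omega>) = (\<lambda>a e. b * idm N a e + hess_mat N p (\<lambda>i. J i \<omega>) x a e)"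
      unfolding X unfolding I_def hess_mat_restrict ..
    have gap': "\<kappa>\<^sup>2 * nrm2 N v \<le> nrm2 N (mv N (T.X (?Jr \<omega>)) v)" for v
      unfolding XJ by (rule gap)
    have "qn N N (minv N (T.X (?Jr \<omega>))) \<le> root (N + N) (real N) / \<kappa>"
      by (rule qn_gap_le[OF \<kappa> gap' T.X N])
    also have "\<dots> \<le> q0"
      unfolding q0 using \<kappa> by (intro divide_right_mono root_self_le_exp N) auto
    finally have "- s * q0 \<le> - s * qn N N (minv N (T.X (?Jr \<omega>)))"
      using cN by (simp add: s_def mult_left_mono)
    then have "exp (- s * q0) \<le> barrier N N s (T.X (?Jr \<omega>))"
      using mdet_nonzeroI[OF \<kappa> gap'] by (simp add: barrier_def)
    then show "\<omega> \<in> U"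
      using \<omega> measurable_space[OF meas \<omega>] by (auto simp: U_def A_def)
  qed
  moreover have "U \<in> sets M" unfolding U_def by (rule measurable_sets[OF meas A])
  ultimately show ?thesis using pU unfolding d_def by (intro bexI[of _ U]) auto
qed

end

section \<open>Asymptotics of the union bound\<close>

lemma exp_quadratic_dominates:
  fixes C1 C2 C3 a :: real
  assumes "a > 0"
  shows "\<forall>\<^sub>F N in sequentially. C1 + C2 * real N + C3 * (real N * ln (real N)) \<le> a * (real N)\<^sup>2"
proof -
  have l: "(\<lambda>N. C1 * (1 / (real N)\<^sup>2) + C2 * (1 / real N) + C3 * (ln (real N) / real N)) \<longlonglongrightarrow> C1 * 0 + C2 * 0 + C3 * 0"
    by (intro tendsto_add tendsto_mult tendsto_const; real_asymp)
  then have "\<forall>\<^sub>F N in sequentially. C1 * (1 / (real N)\<^sup>2) + C2 * (1 / real N) + C3 * (ln (real N) / real N) < a"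
    using assms by (intro order_tendstoD(2)[OF l]) auto
  then show ?thesis
    using eventually_gt_at_top[of 0]
  proof eventually_elim
    case (elim N)
    then have "(C1 * (1 / (real N)\<^sup>2) + C2 * (1 / real N) + C3 * (ln (real N) / real N)) * (real N)\<^sup>2 \<le> a * (real N)\<^sup>2"
      by (intro mult_right_mono) auto
    moreover have "(C1 * (1 / (real N)\<^sup>2) + C2 * (1 / real N) + C3 * (ln (real N) / real N)) * (real N)\<^sup>2
        = C1 + C2 * real N + C3 * (real N * ln (real N))"
      using elim(2) by (simp add: field_simps power2_eq_square)
    ultimately show ?case by simp
  qed
qed

lemma union_bound_asymptotics:
  fixes A K a :: real
  assumes A: "A \<ge> 2" and K: "K \<ge> 0" and a: "a > 0" and d: "d \<ge> p"
  shows "\<exists>c>0. \<forall>\<^sub>F N in sequentially.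
    real N ^ p * (sqrt 2 * exp (- (real N)\<^sup>2 / 4)) + (A * real N ^ d) ^ N * (K * exp (- a * (real N)\<^sup>2))
      \<le> exp (- c * (real N)\<^sup>2)"
proof -
  \<comment> \<open>The slower of the rates of the coupling tail and the gap estimate; half of it is
    spent on the size of the net.\<close>
  define a0 where "a0 = min (1 / 4) a"
  have a0: "a0 > 0" "a0 \<le> 1 / 4" "a0 \<le> a" using a by (auto simp: a0_def)
  have ev: "\<forall>\<^sub>F N in sequentially. ln (1 + K) + ln A * real N + real d * (real N * ln (real N)) \<le> a0 / 2 * (real N)\<^sup>2"
    by (rule exp_quadratic_dominates) (use a0 in simp)
  have "\<forall>\<^sub>F N in sequentially.
    real N ^ p * (sqrt 2 * exp (- (real N)\<^sup>2 / 4)) + (A * real N ^ d) ^ N * (K * exp (- a * (real N)\<^sup>2))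
      \<le> exp (- (a0 / 2) * (real N)\<^sup>2)"
    using ev eventually_gt_at_top[of 0]
  proof eventually_elim
    case (elim N)
    have N: "real N \<ge> 1" using elim(2) by simp
    define Z where "Z = (A * real N ^ d) ^ N"
    have AN: "A * real N ^ d \<ge> 1"
      using A N mult_mono[of 1 A 1 "real N ^ d"] one_le_power[OF N] by simp
    have Z: "Z = exp (ln A * real N + real d * (real N * ln (real N)))"
    proof -
      have "Z = exp (real N * ln (A * real N ^ d))"
        unfolding Z_def using AN by (simp add: exp_of_nat_mult)
      also have "ln (A * real N ^ d) = ln A + real d * ln (real N)"
        using A N by (simp add: ln_mult ln_realpow)
      finally show ?thesis by (simp add: algebra_simps)
    qed
    \<comment> \<open>As \<open>sqrt 2 \<le> A\<close> and \<open>p \<le> d\<close>, the prefactor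
      of the coupling tail is below the bound \<open>Z\<close> for the net, so one exponential
      handles both terms.\<close>
    have "real N ^ p * sqrt 2 \<le> real N ^ d * A"
      using d N A real_le_lsqrt[of 2 2] by (intro mult_mono power_increasing) auto
    also have "\<dots> \<le> Z"
      using power_increasing[of 1 N "A * real N ^ d"] AN elim(2) by (simp add: Z_def mult.commute)
    finally have 1: "real N ^ p * sqrt 2 \<le> Z" .
    have Z0: "Z \<ge> 0" by (simp add: Z)
    have "real N ^ p * (sqrt 2 * exp (- (real N)\<^sup>2 / 4)) + Z * (K * exp (- a * (real N)\<^sup>2))
        = (real N ^ p * sqrt 2) * exp (- (1 / 4) * (real N)\<^sup>2) + Z * K * exp (- a * (real N)\<^sup>2)"
      by simp
    also have "\<dots> \<le> Z * exp (- a0 * (real N)\<^sup>2) + Z * K * exp (- a0 * (real N)\<^sup>2)"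
    proof -
      have "exp (- (1 / 4) * (real N)\<^sup>2) \<le> exp (- a0 * (real N)\<^sup>2)"
        using mult_right_mono[OF a0(2), of "(real N)\<^sup>2"] by simp
      moreover have "exp (- a * (real N)\<^sup>2) \<le> exp (- a0 * (real N)\<^sup>2)"
        using mult_right_mono[OF a0(3), of "(real N)\<^sup>2"] by simp
      ultimately show ?thesis using 1 Z0 K by (intro add_mono mult_mono) auto
    qed
    also have "\<dots> = (1 + K) * Z * exp (- a0 * (real N)\<^sup>2)" by (simp add: algebra_simps)
    also have "\<dots> = exp (ln (1 + K) + (ln A * real N + real d * (real N * ln (real N))) + - a0 * (real N)\<^sup>2)"
      unfolding Z using K by (simp only: exp_add) simp
    also have "\<dots> \<le> exp (- (a0 / 2) * (real N)\<^sup>2)"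
      using elim(1) by simp
    finally show ?case unfolding Z_def .
  qed
  then show ?thesis using a0 by (intro exI[of _ "a0 / 2"]) auto
qed

lemma Crt_positiveE:
  assumes "Crt p j N k {l<..} > 0"
  obtains x where "x \<in> vec_sphere N (sqrt (real N))" "has_index (hamiltonian p j N) x k"
    "N > 0 \<Longrightarrow> l < hamiltonian p j N x / real N"
proof -
  let ?S = "{x \<in> vec_sphere N (sqrt (real N)). sphere_grad (hamiltonian p j N) x = 0\<^sub>v N \<and>
      hamiltonian p j N x \<in> (\<lambda>b. real N * b) ` {l<..} \<and> has_index (hamiltonian p j N) x k}"
  have "?S \<noteq> {}"
  proof
    assume "?S = {}"
    then have "Crt p j N k {l<..} = 0" unfolding Crt_def by (simp only: emeasure_empty)
    then show False using assms by simp
  qed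
  then obtain x where x: "x \<in> ?S" by blast
  show thesis by (rule that[of x]) (use x in auto)
qed

text \<open>All windows lie in \<open>(- \<theta>, - \<theta> + p \<epsilon>)\<close>, where \<open>\<theta> = p E\<^sub>\<infinity>(p)\<close> is the edge of the limiting spectrum
  of the tangential Euclidean Hessian; the Hessian on the sphere is shifted by \<open>p H / N\<close>.\<close>

lemma (in prob_space) crt_prob_bound:
  fixes J :: "(nat \<Rightarrow> nat) \<Rightarrow> 'a \<Rightarrow> real" and p k :: nat and \<epsilon> :: real
  assumes p: "p \<ge> 2"
    and indep: "indep_vars (\<lambda>_. borel) J ({..<p} \<rightarrow>\<^sub>E UNIV)"
    and dist: "\<And>i. i \<in> {..<p} \<rightarrow>\<^sub>E UNIV \<Longrightarrow> distributed M lborel (J i) std_normal_density"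
    and \<epsilon>: "\<epsilon> > 0"
  shows "\<exists>c>0. \<forall>\<^sub>F N in sequentially. prob {\<omega> \<in> space M.
    Crt p (\<lambda>i. J i \<omega>) N k {- E_infty p + \<epsilon> <..} > 0} \<le> exp (- c * (real N)\<^sup>2)"
proof -
  define d where "d = real (p * (p - 1))"
  define \<theta> where "\<theta> = real p * E_infty p"
  have d: "d > 0" using p by (simp add: d_def)
  have \<theta>2: "\<theta>\<^sup>2 = 4 * d"
  proof -
    have "\<theta>\<^sup>2 = (real p)\<^sup>2 * (4 * ((real p - 1) / real p))"
      using p by (simp add: \<theta>_def E_infty_def power_mult_distrib)
    also have "\<dots> = 4 * d" using p by (simp add: d_def power2_eq_square of_nat_diff)
    finally show ?thesis .
  qed
  have \<theta>: "\<theta> > 0" using p by (simp add: \<theta>_def E_infty_def)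
  \<comment> \<open>The \<open>k + 1\<close> windows of width \<open>w\<close> are centred at
    \<open>w, 2 w, ..., (k + 1) w\<close> above the edge \<open>- \<theta>\<close>, so all end
    before \<open>(k + 2) w\<close>. The bound \<open>p \<epsilon>\<close> puts them below the shift
    \<open>p H / N\<close>; the bound \<open>\<theta> / 2\<close> keeps them negative when
    \<open>\<epsilon>\<close> is large.\<close>
  define w where "w = min (real p * \<epsilon>) (\<theta> / 2) / (real k + 2)"
  have w: "w > 0" using p \<epsilon> \<theta> by (simp add: w_def)
  have kw: "(real k + 2) * w \<le> real p * \<epsilon>" "(real k + 2) * w \<le> \<theta> / 2"
    by (simp_all add: w_def)
  define b where "b m = \<theta> - (real m + 1) * w" for m :: nat
  define \<kappa> where "\<kappa> = w / 2"
  have \<kappa>: "\<kappa> > 0" using w by (simp add: \<kappa>_def)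
  have mw: "(real m + 1) * w + w \<le> (real k + 2) * w" "w \<le> (real m + 1) * w" if "m \<le> k" for m
  proof -
    have "(real m + 2) * w \<le> (real k + 2) * w" using that w by (intro mult_right_mono) auto
    then show "(real m + 1) * w + w \<le> (real k + 2) * w" by (simp add: algebra_simps)
    show "w \<le> (real m + 1) * w" using w by (simp add: algebra_simps)
  qed
  have b_pos: "b m \<ge> \<kappa>" if "m \<le> k" for m
    using mw[OF that] kw w \<theta> unfolding b_def \<kappa>_def by linarith
  have b_low: "- b m + \<kappa> \<le> - \<theta> + real p * \<epsilon>" if "m \<le> k" for m
    using mw[OF that] kw w unfolding b_def \<kappa>_def by linarith
  have b_disj: "2 * \<kappa> \<le> \<bar>b m - b m'\<bar>" if "m \<noteq> m'" for m m'
  proof -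
    have "b m - b m' = (real m' - real m) * w" by (simp add: b_def algebra_simps)
    moreover have "1 * w \<le> \<bar>real m' - real m\<bar> * w"
      using that w by (intro mult_right_mono) auto
    ultimately show ?thesis using w by (simp add: \<kappa>_def abs_mult)
  qed
  \<comment> \<open>Chosen so that the window nearest the edge, with
    \<open>b 0 = \<theta> - w\<close>, satisfies \<open>b^2 = 4 d (1 - 2 \<delta>)\<close> exactly;
    the others lie deeper in the bulk.\<close>
  define \<delta> where "\<delta> = (1 - (\<theta> - w)\<^sup>2 / \<theta>\<^sup>2) / 2"
  have w\<theta>: "w \<le> \<theta> / 2"
  proof -
    have "1 * w \<le> (real k + 2) * w" using w by (intro mult_right_mono) auto
    then show ?thesis using kw(2) by linarith
  qed
  have "(\<theta> - w)\<^sup>2 < \<theta>\<^sup>2" using w w\<theta> \<theta> by (intro power_strict_mono) auto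
  then have \<delta>: "\<delta> > 0" using \<theta> by (simp add: \<delta>_def)
  have b_sq: "(b m)\<^sup>2 \<le> 4 * d * (1 - 2 * \<delta>)" if "m \<le> k" for m
  proof -
    have "(b m)\<^sup>2 \<le> (\<theta> - w)\<^sup>2"
      using b_pos[OF that] \<kappa> mw(2)[OF that] by (intro power_mono) (auto simp: b_def)
    also have "\<dots> = 4 * d * (1 - 2 * \<delta>)"
    proof -
      have "2 * \<delta> = 1 - (\<theta> - w)\<^sup>2 / (4 * d)" by (simp add: \<delta>_def \<theta>2)
      then show ?thesis using d by simp
    qed
    finally show ?thesis .
  qed
  \<comment> \<open>Half of the gap survives the passage from a point to its neighbour in the
    net.\<close>
  define \<kappa>' where "\<kappa>' = \<kappa> / 2"
  have \<kappa>': "\<kappa>' > 0" using \<kappa> by (simp add: \<kappa>'_def)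
  define q0 where "q0 = exp 1 / \<kappa>'"
  have q0: "q0 > 0" using \<kappa>' by (simp add: q0_def)
  define c where "c = \<delta> / (32 * d * q0 ^ 3)"
  have c: "c > 0" using \<delta> d q0 by (simp add: c_def)
  define K where "K = 24 * d * c / \<delta> * exp (2 * q0)"
  have K: "K \<ge> 0" using \<delta> d c by (simp add: K_def)
  \<comment> \<open>Collects the constants of the cell count: with the mesh used below,
    \<open>2 N / \<eta> + 5 \<le> A N^(2 p + 3)\<close>.\<close>
  define A where "A = 8 * real p ^ 3 * 2 ^ p / \<kappa> + 5"
  have A: "A \<ge> 2" using \<kappa> by (simp add: A_def add_nonneg_nonneg order_trans[of 2 5])
  have main: "prob {\<omega> \<in> space M. Crt p (\<lambda>i. J i \<omega>) N k {- E_infty p + \<epsilon> <..} > 0}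
      \<le> real N ^ p * (sqrt 2 * exp (- (real N)\<^sup>2 / 4))
        + (A * real N ^ (2 * p + 3)) ^ N * ((real k + 1) * K * exp (- (c * q0) * (real N)\<^sup>2))"
    if N: "N > 0" and N1: "1 \<le> \<delta> * real N" and N2: "1 \<le> c * (real N)\<^sup>2" for N
  proof -
    let ?I = "multi_indices p N"
    let ?event = "{\<omega> \<in> space M. Crt p (\<lambda>i. J i \<omega>) N k {- E_infty p + \<epsilon> <..} > 0}"
    have Isub: "?I \<subseteq> {..<p} \<rightarrow>\<^sub>E UNIV" by (intro PiE_mono) auto
    have Ine: "?I \<noteq> {}" using N by (auto simp: PiE_eq_empty_iff)
    have indepI: "indep_vars (\<lambda>_. borel) J ?I" using indep_vars_subset[OF indep Isub] .
    have distI: "\<And>i. i \<in> ?I \<Longrightarrow> distributed M lborel (J i) std_normal_density"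
      using dist Isub by blast
    note cpl = distr_couplings[OF indepI Ine distI]
    have rv: "random_variable borel (J i)" if "i \<in> ?I" for i
      using indepI that by (auto simp: indep_vars_def)
    \<comment> \<open>The mesh for which \<open>N\<close> times the entrywise Lipschitz bound equals
      \<open>\<kappa> / 2\<close>, the perturbation that \<open>gap_perturb\<close> allows.\<close>
    define \<eta> where "\<eta> = \<kappa> / (4 * real p ^ 3 * (2 * real N) ^ p * real N ^ (p + 2))"
    have \<eta>: "\<eta> > 0" using \<kappa> N p by (simp add: \<eta>_def)
    let ?lip = "real N ^ p * (real N * (2 * real p ^ 3 * (2 * real N) ^ p * \<eta>))"
    have lip: "real N * ?lip = \<kappa> / 2"
    proof -
      have "real N * ?lip = 2 * (real p ^ 3 * (2 * real N) ^ p * real N ^ (p + 2)) * \<eta>"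
        by (simp add: power_add power2_eq_square mult_ac)
      also have "\<dots> = \<kappa> / 2" using N p by (simp add: \<eta>_def)
      finally show ?thesis .
    qed
    obtain T where T: "T \<subseteq> vec_sphere N (sqrt (real N))" "finite T"
      "real (card T) \<le> (2 * (real N / \<eta>) + 5) ^ N"
      "\<And>x. x \<in> vec_sphere N (sqrt (real N)) \<Longrightarrow> \<exists>y\<in>T. \<forall>a<N. \<bar>vec_index x a - vec_index y a\<bar> \<le> \<eta>"
      using sphere_net[OF N \<eta>] by metis
    have cT: "real (card T) \<le> (A * real N ^ (2 * p + 3)) ^ N"
    proof -
      have "2 * (real N / \<eta>) = 8 * real p ^ 3 * 2 ^ p / \<kappa> * real N ^ (2 * p + 3)"
      proof -
        have "2 * p + 3 = p + (p + 2) + 1" by simp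
        then have e: "real N ^ (2 * p + 3) = real N ^ p * real N ^ (p + 2) * real N"
          by (simp only: power_add power_one_right)
        have "2 * (real N / \<eta>) = 2 * (real N * (4 * real p ^ 3 * (2 * real N) ^ p * real N ^ (p + 2)) / \<kappa>)"
          by (simp only: \<eta>_def divide_divide_eq_right)
        then show ?thesis unfolding e power_mult_distrib by (simp only: times_divide_eq_left mult_ac) simp
      qed
      moreover have "5 * 1 \<le> 5 * real N ^ (2 * p + 3)"
        using N by (intro mult_left_mono one_le_power) auto
      ultimately have "2 * (real N / \<eta>) + 5 \<le> A * real N ^ (2 * p + 3)"
        by (simp add: A_def distrib_right)
      then show ?thesis
        using \<eta> N by (intro order.trans[OF T(3)] power_mono) auto
    qed
    define bound where "bound = K * exp (- (c * q0) * (real N)\<^sup>2)"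
    have bound: "bound \<ge> 0" using K by (simp add: bound_def)
    define gap where "gap \<kappa> m \<omega> y \<longleftrightarrow> (\<forall>v. \<kappa>\<^sup>2 * nrm2 N v
      \<le> nrm2 N (mv N (\<lambda>a e. b m * idm N a e + hess_mat N p (\<lambda>i. J i \<omega>) (vec_index y) a e) v))"
      for \<kappa> m \<omega> y
    define good where "good y m W \<longleftrightarrow> W \<in> sets M \<and> {\<omega> \<in> space M. gap \<kappa>' m \<omega> y} \<subseteq> W \<and> prob W \<le> bound"
      for y m W
    have ex: "\<exists>W. good y m W" if "y \<in> T" "m \<le> k" for y m
    proof -
      have y: "(\<Sum>a<N. (vec_index y a)\<^sup>2) = real N" using T(1) that(1) vec_sphere_nrm2(2) by blast
      have bm: "b m > 0" using b_pos[OF that(2)] \<kappa> by linarith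
      have "\<exists>W\<in>sets M. {\<omega> \<in> space M. gap \<kappa>' m \<omega> y} \<subseteq> W \<and> prob W \<le> bound"
        unfolding bound_def K_def d_def gap_def
        by (rule gap_prob[OF cpl(1,2) y N p \<kappa>' bm b_sq[OF that(2), unfolded d_def] \<delta> N1 q0_def
              c_def[unfolded d_def] N2])
      then show ?thesis unfolding good_def by blast
    qed
    define U where "U y m = (SOME W. good y m W)" for y m
    have "good y m (U y m)" if "y \<in> T" "m \<le> k" for y m
      unfolding U_def by (rule someI_ex[OF ex[OF that]])
    then have U: "\<And>y m. y \<in> T \<Longrightarrow> m \<le> k \<Longrightarrow> U y m \<in> sets M"
      "\<And>y m. y \<in> T \<Longrightarrow> m \<le> k \<Longrightarrow> {\<omega> \<in> space M. gap \<kappa>' m \<omega> y} \<subseteq> U y m"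
      "\<And>y m. y \<in> T \<Longrightarrow> m \<le> k \<Longrightarrow> prob (U y m) \<le> bound"
      unfolding good_def by blast+
    define V where "V i = {\<omega> \<in> space M. real N \<le> \<bar>J i \<omega>\<bar>}" for i
    have V: "V i \<in> sets M" if "i \<in> ?I" for i
      unfolding V_def using rv[OF that] by measurable
    define W1 where "W1 = (\<Union>i\<in>?I. V i)"
    define W2 where "W2 = (\<Union>y\<in>T. \<Union>m\<in>{..k}. U y m)"
    have finI: "finite ?I" by (intro finite_PiE) auto
    have W: "W1 \<in> sets M" "W2 \<in> sets M"
      unfolding W1_def W2_def using V U(1) finI T(2) by auto
    have sub: "?event \<subseteq> W1 \<union> W2"
    proof
      fix \<omega> assume \<omega>: "\<omega> \<in> ?event"
      let ?j = "\<lambda>i. J i \<omega>"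
      show "\<omega> \<in> W1 \<union> W2"
      proof (cases "\<exists>i\<in>?I. real N \<le> \<bar>?j i\<bar>")
        case True
        then show ?thesis using \<omega> by (auto simp: W1_def V_def)
      next
        case False
        have "Crt p ?j N k {- E_infty p + \<epsilon> <..} > 0" using \<omega> by simp
        then obtain x where x: "x \<in> vec_sphere N (sqrt (real N))" "has_index (hamiltonian p ?j N) x k"
          "- E_infty p + \<epsilon> < hamiltonian p ?j N x / real N"
          using N by (elim Crt_positiveE) auto
        have "real p * (- E_infty p + \<epsilon>) \<le> real p * (hamiltonian p ?j N x / real N)"
          using x(3) by (intro mult_left_mono) auto
        then have cap: "- \<theta> + real p * \<epsilon> \<le> real p * hamiltonian p ?j N x / real N"
          by (simp add: \<theta>_def algebra_simps)
        have "\<exists>m\<le>k. gap \<kappa> m \<omega> x"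
          unfolding gap_def
          by (rule empty_window[OF x(1) N x(2) \<kappa> b_pos order.trans[OF b_low cap] b_disj])
        then obtain m where m: "m \<le> k" "gap \<kappa> m \<omega> x" by blast
        obtain y where y: "y \<in> T" "\<And>a. a < N \<Longrightarrow> \<bar>vec_index x a - vec_index y a\<bar> \<le> \<eta>"
          using T(4)[OF x(1)] by blast
        have ys: "y \<in> vec_sphere N (sqrt (real N))" using y(1) T(1) by blast
        have "gap \<kappa>' m \<omega> y"
          unfolding gap_def
        proof
          fix v
          show "\<kappa>'\<^sup>2 * nrm2 N v
            \<le> nrm2 N (mv N (\<lambda>a e. b m * idm N a e + hess_mat N p ?j (vec_index y) a e) v)"
            unfolding \<kappa>'_def
          proof (rule gap_perturb[where \<delta> = ?lip])
            show "\<kappa>\<^sup>2 * nrm2 N v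
              \<le> nrm2 N (mv N (\<lambda>a e. b m * idm N a e + hess_mat N p ?j (vec_index x) a e) v)"
              using m(2) unfolding gap_def by blast
            show "\<bar>b m * idm N a e + hess_mat N p ?j (vec_index x) a e
                - (b m * idm N a e + hess_mat N p ?j (vec_index y) a e)\<bar> \<le> ?lip"
              if "a < N" "e < N" for a e
              using hess_mat_lipschitz[OF vec_sphere_nrm2(2)[OF x(1)] vec_sphere_nrm2(2)[OF ys] y(2) that,
                  of p ?j] False by force
            show "0 \<le> ?lip" using \<eta> by simp
            show "real N * ?lip \<le> \<kappa> / 2" using lip by simp
          qed (rule \<kappa>)
        qed
        then have "\<omega> \<in> U y m" using U(2)[OF y(1) m(1)] \<omega> by blast
        then show ?thesis using y(1) m(1) by (auto simp: W2_def)
      qed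
    qed
    have "prob ?event \<le> prob (W1 \<union> W2)"
    \<comment> \<open>A set outside the sigma-algebra has \<open>measure\<close> 0, so the bound
      holds in either case.\<close>
    proof (cases "?event \<in> sets M")
      case True
      then show ?thesis using sub W by (intro finite_measure_mono) auto
    qed (simp add: measure_notin_sets)
    also have "\<dots> \<le> prob W1 + prob W2" by (rule measure_Un_le[OF W])
    also have "prob W1 \<le> real N ^ p * (sqrt 2 * exp (- (real N)\<^sup>2 / 4))"
    proof -
      have "prob W1 \<le> (\<Sum>i\<in>?I. prob (V i))"
        unfolding W1_def using V finI by (intro finite_measure_subadditive_finite) auto
      also have "\<dots> \<le> (\<Sum>i\<in>?I. sqrt 2 * exp (- (real N)\<^sup>2 / 4))"
        unfolding V_def by (intro sum_mono coupling_tail cpl(3) rv) auto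
      finally show ?thesis by (simp add: card_PiE)
    qed
    also have "prob W2 \<le> (A * real N ^ (2 * p + 3)) ^ N * ((real k + 1) * bound)"
    proof -
      have "prob W2 \<le> (\<Sum>y\<in>T. prob (\<Union>m\<in>{..k}. U y m))"
        unfolding W2_def using U(1) T(2) by (intro finite_measure_subadditive_finite) auto
      also have "\<dots> \<le> (\<Sum>y\<in>T. \<Sum>m\<in>{..k}. prob (U y m))"
        using U(1) by (intro sum_mono finite_measure_subadditive_finite) auto
      also have "\<dots> \<le> (\<Sum>y\<in>T. \<Sum>m\<in>{..k}. bound)"
        using U(3) by (intro sum_mono) auto
      also have "\<dots> = real (card T) * ((real k + 1) * bound)" by (simp add: algebra_simps)
      also have "\<dots> \<le> (A * real N ^ (2 * p + 3)) ^ N * ((real k + 1) * bound)"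
        using bound by (intro mult_right_mono cT) auto
      finally show ?thesis .
    qed
    finally show ?thesis by (simp add: bound_def mult.assoc)
  qed
  obtain c' where c': "c' > 0" "\<forall>\<^sub>F N in sequentially.
    real N ^ p * (sqrt 2 * exp (- (real N)\<^sup>2 / 4))
      + (A * real N ^ (2 * p + 3)) ^ N * ((real k + 1) * K * exp (- (c * q0) * (real N)\<^sup>2))
      \<le> exp (- c' * (real N)\<^sup>2)"
    using union_bound_asymptotics[OF A, of "(real k + 1) * K" "c * q0" p "2 * p + 3"] K c q0 by auto
  have e1: "\<forall>\<^sub>F N in sequentially. 1 \<le> \<delta> * real N"
    using \<delta> by real_asymp
  have e2: "\<forall>\<^sub>F N in sequentially. 1 \<le> c * (real N)\<^sup>2"
    using c by real_asymp
  have "\<forall>\<^sub>F N in sequentially. prob {\<omega> \<in> space M.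
    Crt p (\<lambda>i. J i \<omega>) N k {- E_infty p + \<epsilon> <..} > 0} \<le> exp (- c' * (real N)\<^sup>2)"
    using c'(2) e1 e2 eventually_gt_at_top[of 0]
    by eventually_elim (use main in \<open>auto intro: order.trans\<close>)
  then show ?thesis using c'(1) by blast
qed

theorem theorem2p14:
  fixes M :: "'a measure" and J :: "(nat \<Rightarrow> nat) \<Rightarrow> 'a \<Rightarrow> real"
    and p k :: nat and \<epsilon> :: real
  assumes "prob_space M"
    and "p \<ge> 2"
    and "prob_space.indep_vars M (\<lambda>_. borel) J ({..<p} \<rightarrow>\<^sub>E UNIV)"
    and "\<And>i. i \<in> {..<p} \<rightarrow>\<^sub>E UNIV \<Longrightarrow> distributed M lborel (J i) std_normal_density"
    and "\<epsilon> > 0"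
  shows "limsup (\<lambda>N. ereal (1 / (real N)^2) *
           ereal_log (measure M {\<omega> \<in> space M.
             Crt p (\<lambda>i. J i \<omega>) N k {- E_infty p + \<epsilon> <..} > 0})) < 0"
proof -
  interpret prob_space M by (rule assms(1))
  define P where "P N = prob {\<omega> \<in> space M. Crt p (\<lambda>i. J i \<omega>) N k {- E_infty p + \<epsilon> <..} > 0}" for N
  obtain c where c: "c > 0" "\<forall>\<^sub>F N in sequentially. P N \<le> exp (- c * (real N)\<^sup>2)"
    using crt_prob_bound[OF assms(2-5)] unfolding P_def by blast
  have P0: "P N \<ge> 0" for N by (simp add: P_def)
  have "\<forall>\<^sub>F N in sequentially. ereal (1 / (real N)^2) * ereal_log (P N) \<le> ereal (- c)"
    using c(2) eventually_gt_at_top[of 0]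
  proof eventually_elim
    case (elim N)
    show ?case
    proof (cases "P N = 0")
      \<comment> \<open>A positive factor times minus infinity is minus infinity. Only
        \<open>N > 0\<close> is considered, since at \<open>N = 0\<close> the factor is
        \<open>1 / 0 = 0\<close> and the product would be 0.\<close>
      case True
      then show ?thesis using elim(2) by (simp add: ereal_log_def)
    next
      case False
      then have pos: "P N > 0" using P0[of N] by simp
      have "ln (P N) \<le> ln (exp (- c * (real N)\<^sup>2))"
        using elim(1) pos by (subst ln_le_cancel_iff) auto
      then have "1 / (real N)\<^sup>2 * ln (P N) \<le> - c"
        using elim(2) by (simp add: divide_le_eq)
      then show ?thesis using False by (simp add: ereal_log_def)
    qed
  qed
  then have "limsup (\<lambda>N. ereal (1 / (real N)^2) * ereal_log (P N)) \<le> ereal (- c)"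
    by (rule Limsup_bounded)
  also have "\<dots> < 0" using c(1) by simp
  finally show ?thesis unfolding P_def .
qed

end
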